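(* Let $\Sigma_0\in\mathbb{R}^{n\times n}$ be a full-rank symmetric positive definite matrix with spectral decomposition $\Sigma_0=\Omega\Lambda\Omega^\top$ ($\Omega$ orthogonal, $\Lambda=\mathrm{Diag}(\lambda_1,\dots,\lambda_n)$) and distinct eigenvalues $\lambda_1>\cdots>\lambda_n>0$. Let $\tau\in(0,\lambda_n]$. If $\overrightarrow{W}^*\in\Theta$ is a critical point of $L^N_\tau$, then $W^*=\mu(\overrightarrow{W}^* )$ is a critical point of $L^1_\tau|_{\mathcal{M}(k)}$, where $k=\operatorname{rank}W^*$. Moreover, when $k=\underline{d}$, $\overrightarrow{W}^*$ is a local minimizer of $L^N_\tau$ if and only if $W^*=\mu(\overrightarrow{W}^* )$ is a local minimizer, and therefore the global minimizer (i.e. a point attaining the global minimum), of $L^1_\tau|_{\mathcal{M}(\underline{d})}$. In this case, $\Sigma^*_\tau=W^*{W^*}^\top+\tau I_n$ is the $\tau$-best $\underline{d}$-rank approximation of the target, in the sense that $$\Sigma^*_\tau=\Omega\begin{pmatrix}\bar\Lambda_{[\underline{d}]}&0\\0&\tau I_{n-\underline{d}}\end{pmatrix}\Omega^\top,\qquad \bar\Lambda_{[\underline{d}]}=\mathrm{Diag}(\lambda_1,\dots,\lambda_{\underline{d}}).$$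
   Context: A linear network has $N\geqslant1$ layers with widths $d_0=m,d_1,\dots,d_N=n$; its parameter space $\Theta$ consists of tuples $\overrightarrow{W}=(W_1,\dots,W_N)$ with $W_j\in\mathbb{R}^{d_j\times d_{j-1}}$, its parametrization map is $\mu:\Theta\to\mathbb{R}^{n\times m}$, $\mu(\overrightarrow{W})=W_N\cdots W_1$, and $\underline{d}=\min\{d_0,\dots,d_N\}$. The perturbed loss is $L^1_\tau(W)=\operatorname{tr}\big(WW^\top+\tau I_n+\Sigma_0-2(\Sigma_0^{1/2}(WW^\top+\tau I_n)\Sigma_0^{1/2})^{1/2}\big)$ for $W\in\mathbb{R}^{n\times m}$, and $L^N_\tau=L^1_\tau\circ\mu$ on $\Theta$. $\mathcal{M}(k)$ is the manifold of $n\times m$ matrices of rank exactly $k$; a critical point of $L^1_\tau|_{\mathcal{M}(k)}$ is a point of $\mathcal{M}(k)$ at which the differential of the restriction of $L^1_\tau$ to $\mathcal{M}(k)$ vanishes. *)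

theory Defs
  imports
    Complex_Main
    "HOL-Library.FuncSet"
    "Jordan_Normal_Form.DL_Rank"
begin

definition pos_semidef :: "nat \<Rightarrow> real mat \<Rightarrow> bool" where
  "pos_semidef n A \<longleftrightarrow> A \<in> carrier_mat n n \<and> A\<^sup>T = A \<and>
     (\<forall>v \<in> carrier_vec n. 0 \<le> v \<bullet> (A *\<^sub>v v))"

definition pos_def :: "nat \<Rightarrow> real mat \<Rightarrow> bool" where
  "pos_def n A \<longleftrightarrow> A \<in> carrier_mat n n \<and> A\<^sup>T = A \<and>
     (\<forall>v \<in> carrier_vec n. v \<noteq> 0\<^sub>v n \<longrightarrow> 0 < v \<bullet> (A *\<^sub>v v))"

text \<open>The principal square root: unique for positive semidefinite \<^term>\<open>A\<close>, unspecified otherwise.\<close>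

definition mat_sqrt :: "nat \<Rightarrow> real mat \<Rightarrow> real mat" where
  "mat_sqrt n A = (THE S. pos_semidef n S \<and> S * S = A)"

definition mat_trace :: "real mat \<Rightarrow> real" where
  "mat_trace A = (\<Sum>i<dim_row A. A $$ (i, i))"

definition frob_norm :: "real mat \<Rightarrow> real" where
  "frob_norm A = sqrt (\<Sum>i<dim_row A. \<Sum>j<dim_col A. (A $$ (i, j))\<^sup>2)"

definition frob_dist :: "real mat \<Rightarrow> real mat \<Rightarrow> real" where
  "frob_dist A B = frob_norm (A - B)"

definition fixed_rank :: "nat \<Rightarrow> nat \<Rightarrow> nat \<Rightarrow> real mat set" where
  "fixed_rank n m k = {W \<in> carrier_mat n m. vec_space.rank n W = k}"

text \<open>Parameters are tuples indexed by \<open>1, \<dots>, N\<close>; the \<open>j\<close>-th layer maps dimension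
  \<open>d (j - 1)\<close> to dimension \<open>d j\<close>.\<close>

definition params :: "nat \<Rightarrow> (nat \<Rightarrow> nat) \<Rightarrow> (nat \<Rightarrow> real mat) set" where
  "params N d = (\<Pi>\<^sub>E j\<in>{1..N}. carrier_mat (d j) (d (j - 1)))"

text \<open>\<open>layer_prod d N W = W N * \<dots> * W 1\<close>\<close>

primrec layer_prod :: "(nat \<Rightarrow> nat) \<Rightarrow> nat \<Rightarrow> (nat \<Rightarrow> real mat) \<Rightarrow> real mat" where
  "layer_prod d 0 W = 1\<^sub>m (d 0)"
| "layer_prod d (Suc j) W = W (Suc j) * layer_prod d j W"

definition params_dist :: "nat \<Rightarrow> (nat \<Rightarrow> real mat) \<Rightarrow> (nat \<Rightarrow> real mat) \<Rightarrow> real" where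
  "params_dist N V W = sqrt (\<Sum>j = 1..N. (frob_dist (V j) (W j))\<^sup>2)"

definition reg_cov :: "nat \<Rightarrow> real \<Rightarrow> real mat \<Rightarrow> real mat" where
  "reg_cov n \<tau> W = W * W\<^sup>T + \<tau> \<cdot>\<^sub>m 1\<^sub>m n"

definition loss1 :: "nat \<Rightarrow> real mat \<Rightarrow> real \<Rightarrow> real mat \<Rightarrow> real" where
  "loss1 n \<Sigma>0 \<tau> W = mat_trace (reg_cov n \<tau> W + \<Sigma>0
     - 2 \<cdot>\<^sub>m mat_sqrt n (mat_sqrt n \<Sigma>0 * reg_cov n \<tau> W * mat_sqrt n \<Sigma>0))"

definition lossN :: "nat \<Rightarrow> (nat \<Rightarrow> nat) \<Rightarrow> real mat \<Rightarrow> real \<Rightarrow> (nat \<Rightarrow> real mat) \<Rightarrow> real" where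
  "lossN N d \<Sigma>0 \<tau> W = loss1 (d N) \<Sigma>0 \<tau> (layer_prod d N W)"

text \<open>The differential at \<open>W\<close> exists and is zero. Since matrices of unspecified dimension
  do not form a normed space type, Frechet differentiability (with derivative \<open>0\<close>) is written
  out with respect to the Euclidean norm on the parameter space.\<close>

definition critical_params ::
  "nat \<Rightarrow> (nat \<Rightarrow> nat) \<Rightarrow> ((nat \<Rightarrow> real mat) \<Rightarrow> real) \<Rightarrow> (nat \<Rightarrow> real mat) \<Rightarrow> bool" where
  "critical_params N d f W \<longleftrightarrow> W \<in> params N d \<and>
     (\<forall>\<epsilon>>0. \<exists>\<delta>>0. \<forall>V \<in> params N d. params_dist N V W < \<delta> \<longrightarrow>
        \<bar>f V - f W\<bar> \<le> \<epsilon> * params_dist N V W)"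

text \<open>Tangent vectors of the manifold of rank-\<open>k\<close> matrices at \<open>W\<close> are the velocities at \<open>0\<close>
  of curves \<open>\<gamma>\<close> in the manifold with \<open>\<gamma> 0 = W\<close>, and the differential of the restriction of \<open>f\<close>
  maps such a velocity to the derivative of \<open>f \<circ> \<gamma>\<close> at \<open>0\<close>. As the manifold is embedded,
  curves that are merely differentiable at \<open>0\<close> have the same velocities as smooth ones.\<close>

definition critical_fixed_rank :: "nat \<Rightarrow> nat \<Rightarrow> nat \<Rightarrow> (real mat \<Rightarrow> real) \<Rightarrow> real mat \<Rightarrow> bool" where
  "critical_fixed_rank n m k f W \<longleftrightarrow> W \<in> fixed_rank n m k \<and>
     (\<forall>\<gamma> :: real \<Rightarrow> real mat.
        (\<forall>t. \<gamma> t \<in> fixed_rank n m k) \<and> \<gamma> 0 = W \<and>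
        (\<forall>i<n. \<forall>j<m. (\<lambda>t. \<gamma> t $$ (i, j)) differentiable (at 0)) \<longrightarrow>
        ((\<lambda>t. f (\<gamma> t)) has_real_derivative 0) (at 0))"

definition local_minimizer :: "('a \<Rightarrow> 'a \<Rightarrow> real) \<Rightarrow> 'a set \<Rightarrow> ('a \<Rightarrow> real) \<Rightarrow> 'a \<Rightarrow> bool" where
  "local_minimizer D S f x \<longleftrightarrow> x \<in> S \<and> (\<exists>\<epsilon>>0. \<forall>y\<in>S. D y x < \<epsilon> \<longrightarrow> f x \<le> f y)"

end

theory Submission
  imports Defs "Jordan_Normal_Form.Spectral_Radius" "HOL-Analysis.L2_Norm"
begin

text \<open>
  Near \<open>W\<close>, every matrix of the same rank is \<open>(1 + A) W (1 + B)\<close> with \<open>A\<close> and \<open>B\<close> of size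
  linear in the displacement, and such a matrix lifts to nearby layers by changing only the first
  and the last one. So first-order and local-minimality statements pass between the layers and
  the fixed-rank manifold without differentiating the loss.

  For the loss itself, the optimal transport map \<open>T\<close> from \<open>S = W W\<^sup>T + \<tau>\<close> to \<open>\<Sigma>0\<close> gives an
  affine minorant \<open>tr ((1 - T) S')\<close> touching it at \<open>S\<close>. Criticality therefore forces
  \<open>T W W\<^sup>T = W W\<^sup>T\<close>, and then \<open>W W\<^sup>T\<close> is diagonal in the eigenbasis of \<open>\<Sigma>0\<close>, with eigenvalues
  \<open>0\<close> or \<open>\<lambda>\<^sub>i - \<tau>\<close>. If the selected eigenvalues are not the largest ones, a plane rotation
  exchanging a selected and a larger unselected direction decreases the loss, so \<open>W\<close> is no local
  minimizer. Otherwise the loss equals the lower bound that a trace inequality of von Neumann type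
  gives for all matrices of rank at most \<open>r\<close>.
\<close>

text \<open>The rank of the product varies over the parameter space and the loss contains a matrix
  square root, so neither is differentiated. Criticality in the layers is tested only on two-sided
  multiplicative perturbations of the product; a bound linear in the size of the multipliers is all
  that the curve formulation of criticality on the manifold consumes. The same lift lets local
  minimality descend at every rank. The converse is where maximal rank enters: no product has rank
  above the smallest width, and rank cannot drop nearby, so all nearby parameters are mapped into
  the manifold. At smaller rank nearby products may leave it.

  Distinct eigenvalues act twice: they make a matrix commuting with \<open>\<Sigma>0\<close>
  diagonal in its eigenbasis, and they make the rotation decrease the loss strictly. The bound of
  \<open>\<tau>\<close> by the smallest eigenvalue makes the cost
  \<open>(sqrt (lam i) - sqrt \<tau>)\<^sup>2\<close> of an omitted direction grow with
  \<open>lam i\<close>, so omitting the smallest eigenvalues is cheapest. A competitor of rank at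
  most \<open>r\<close> has at least \<open>n - r\<close> null directions, and a doubly stochastic
  coupling distributes this cost over the eigenvalues.\<close>

subsection \<open>Matrix algebra\<close>

text \<open>With side conditions on dimensions instead of carriers, the simplifier need not guess the
  inner dimension of a product.\<close>

lemma mat_mult_assoc:
  fixes A B C :: "'a :: semiring_0 mat"
  assumes "dim_col A = dim_row B" "dim_col B = dim_row C"
  shows "(A * B) * C = A * (B * C)"
  using assms by (intro assoc_mult_mat[of _ "dim_row A" "dim_row B" _ "dim_row C" _ "dim_col C"]) auto

lemma mat_mult_add_right:
  fixes A B C :: "'a :: semiring_0 mat"
  assumes "dim_col A = dim_row B" "dim_row C = dim_row B" "dim_col C = dim_col B"
  shows "A * (B + C) = A * B + A * C"
  using assms by (intro mult_add_distrib_mat[of _ "dim_row A" "dim_row B" _ "dim_col B"]) auto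

lemma mat_mult_add_left:
  fixes A B C :: "'a :: semiring_0 mat"
  assumes "dim_col B = dim_row A" "dim_row C = dim_row B" "dim_col C = dim_col B"
  shows "(B + C) * A = B * A + C * A"
  using assms by (intro add_mult_distrib_mat[of _ "dim_row B" "dim_row A" _ _ "dim_col A"]) auto

lemma mat_mult_diff_right:
  fixes A B C :: "'a :: ring mat"
  assumes "dim_col A = dim_row B" "dim_row C = dim_row B" "dim_col C = dim_col B"
  shows "A * (B - C) = A * B - A * C"
  using assms by (intro mult_minus_distrib_mat[of _ "dim_row A" "dim_row B" _ "dim_col B"]) auto

lemma mat_mult_diff_left:
  fixes A B C :: "'a :: ring mat"
  assumes "dim_col B = dim_row A" "dim_row C = dim_row B" "dim_col C = dim_col B"
  shows "(B - C) * A = B * A - C * A"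
  using assms by (intro minus_mult_distrib_mat[of _ "dim_row B" "dim_row A" _ _ "dim_col A"]) auto

lemma mat_mult_smult_left:
  fixes A B :: "'a :: comm_semiring_0 mat"
  assumes "dim_col A = dim_row B"
  shows "(c \<cdot>\<^sub>m A) * B = c \<cdot>\<^sub>m (A * B)"
  using assms by (intro mult_smult_assoc_mat[of _ "dim_row A" "dim_row B" _ "dim_col B"]) auto

lemma mat_mult_smult_right:
  fixes A B :: "'a :: comm_semiring_0 mat"
  assumes "dim_col A = dim_row B"
  shows "A * (c \<cdot>\<^sub>m B) = c \<cdot>\<^sub>m (A * B)"
  using assms by (intro mult_smult_distrib[of _ "dim_row A" "dim_row B" _ "dim_col B"]) auto

lemma mat_mult_one_left: "n = dim_row A \<Longrightarrow> 1\<^sub>m n * A = (A :: 'a :: semiring_1 mat)"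
  by (intro left_mult_one_mat[of _ _ "dim_col A"]) auto

lemma mat_mult_one_right: "n = dim_col A \<Longrightarrow> A * 1\<^sub>m n = (A :: 'a :: semiring_1 mat)"
  by (intro right_mult_one_mat[of _ "dim_row A"]) auto

lemma mat_transpose_mult:
  fixes A B :: "'a :: comm_semiring_0 mat"
  assumes "dim_col A = dim_row B"
  shows "(A * B)\<^sup>T = B\<^sup>T * A\<^sup>T"
  using assms by (intro transpose_mult[of _ "dim_row A" "dim_row B" _ "dim_col B"]) auto

lemma mat_transpose_add:
  "dim_row B = dim_row A \<Longrightarrow> dim_col B = dim_col A \<Longrightarrow> (A + B)\<^sup>T = A\<^sup>T + B\<^sup>T"
  by (intro eq_matI) auto

lemma mat_transpose_diff:
  "dim_row B = dim_row A \<Longrightarrow> dim_col B = dim_col A \<Longrightarrow> (A - B)\<^sup>T = A\<^sup>T - B\<^sup>T"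
  by (intro eq_matI) auto

lemma mat_transpose_smult: "(c \<cdot>\<^sub>m A)\<^sup>T = c \<cdot>\<^sub>m A\<^sup>T"
  by (intro eq_matI) auto

lemma mat_transpose_mat_diag: "(mat_diag n f)\<^sup>T = mat_diag n f"
  by (intro eq_matI) (auto simp: mat_diag_def)

lemma mat_diag_dims [simp]: "dim_row (mat_diag n f) = n" "dim_col (mat_diag n f) = n"
  by (auto simp: mat_diag_def)

lemma mat_mult_index:
  "i < dim_row A \<Longrightarrow> j < dim_col B \<Longrightarrow> dim_col A = dim_row B \<Longrightarrow>
     (A * B) $$ (i, j) = (\<Sum>l<dim_row B. A $$ (i, l) * B $$ (l, j))"
  by (simp add: scalar_prod_def atLeast0LessThan)

lemmas mat_ring = mat_mult_assoc mat_mult_add_right mat_mult_add_left mat_mult_diff_right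
  mat_mult_diff_left mat_mult_smult_left mat_mult_smult_right mat_mult_one_left
  mat_mult_one_right mat_transpose_mult mat_transpose_add mat_transpose_diff
  mat_transpose_smult mat_transpose_mat_diag

text \<open>Products are normalized to nest to the right, so a known product \<open>A * B\<close>
  occurs only inside \<open>A * (B * C)\<close>, where its own equation cannot rewrite; this form
  applies there.\<close>

lemma mat_mult_cancel_mid:
  fixes A B C :: "real mat"
  assumes "A * B = D" "dim_col A = dim_row B" "dim_col B = dim_row C"
  shows "A * (B * C) = D * C"
  unfolding assms(1)[symmetric] by (rule mat_mult_assoc[OF assms(2,3), symmetric])

subsection \<open>Trace\<close>

lemma mat_trace_add:
  "dim_row B = dim_row A \<Longrightarrow> dim_row A = dim_col A \<Longrightarrow> dim_col B = dim_col A \<Longrightarrow>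
    mat_trace (A + B) = mat_trace A + mat_trace B"
  by (simp add: mat_trace_def sum.distrib)

lemma mat_trace_diff:
  "dim_row B = dim_row A \<Longrightarrow> dim_row A = dim_col A \<Longrightarrow> dim_col B = dim_col A \<Longrightarrow>
    mat_trace (A - B) = mat_trace A - mat_trace B"
  by (simp add: mat_trace_def sum_subtractf)

lemma mat_trace_smult:
  "dim_row A = dim_col A \<Longrightarrow> mat_trace (c \<cdot>\<^sub>m A) = c * mat_trace A"
  by (simp add: mat_trace_def sum_distrib_left)

lemma mat_trace_transpose: "dim_row A = dim_col A \<Longrightarrow> mat_trace (A\<^sup>T) = mat_trace A"
  by (simp add: mat_trace_def)

lemma mat_trace_mult:
  "dim_row B = dim_col A \<Longrightarrow> dim_row A = dim_col B \<Longrightarrow>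
    mat_trace (A * B) = (\<Sum>i<dim_row A. \<Sum>j<dim_row B. A $$ (i, j) * B $$ (j, i))"
  by (simp add: mat_trace_def mat_mult_index del: index_mult_mat(1))

lemma mat_trace_comm:
  assumes "dim_row B = dim_col A" "dim_row A = dim_col B"
  shows "mat_trace (A * B) = mat_trace (B * A)"
proof -
  have "mat_trace (A * B) = (\<Sum>j<dim_row B. \<Sum>i<dim_row A. A $$ (i, j) * B $$ (j, i))"
    unfolding mat_trace_mult[OF assms] by (rule sum.swap)
  then show ?thesis unfolding mat_trace_mult[OF assms(2,1)] by (simp only: mult.commute)
qed

lemma mat_trace_mat_diag: "mat_trace (mat_diag n f) = (\<Sum>i<n. f i)"
  by (simp add: mat_trace_def mat_diag_def)

lemmas mat_trace_linear = mat_trace_add mat_trace_diff mat_trace_smult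

subsection \<open>Frobenius norm\<close>

text \<open>Reading the index pairs as one index set makes Minkowski's inequality and definiteness
  available from \<open>L2_set\<close>.\<close>

lemma frob_norm_L2:
  "frob_norm A = L2_set (\<lambda>x. A $$ x) ({..<dim_row A} \<times> {..<dim_col A})"
  unfolding frob_norm_def L2_set_def by (simp add: sum.cartesian_product)

lemma frob_norm_nonneg [simp]: "0 \<le> frob_norm A"
  unfolding frob_norm_L2 by (rule L2_set_nonneg)

lemma frob_norm_sq: "(frob_norm A)\<^sup>2 = (\<Sum>i<dim_row A. \<Sum>j<dim_col A. (A $$ (i, j))\<^sup>2)"
  unfolding frob_norm_def by (intro real_sqrt_pow2 sum_nonneg) auto

lemma frob_norm_triangle:
  assumes "dim_row B = dim_row A" "dim_col B = dim_col A"
  shows "frob_norm (A + B) \<le> frob_norm A + frob_norm B"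
proof -
  let ?I = "{..<dim_row A} \<times> {..<dim_col A}"
  have "frob_norm (A + B) = L2_set (\<lambda>x. A $$ x + B $$ x) ?I"
    unfolding frob_norm_L2 by (rule L2_set_cong) (use assms in auto)
  also have "\<dots> \<le> L2_set (\<lambda>x. A $$ x) ?I + L2_set (\<lambda>x. B $$ x) ?I"
    by (rule L2_set_triangle_ineq)
  finally show ?thesis by (simp add: frob_norm_L2 assms)
qed

lemma frob_norm_smult: "frob_norm (c \<cdot>\<^sub>m A) = \<bar>c\<bar> * frob_norm A"
  by (simp add: frob_norm_def power_mult_distrib sum_distrib_left[symmetric] real_sqrt_mult)

lemma frob_norm_triangle_diff:
  assumes "dim_row B = dim_row A" "dim_col B = dim_col A"
  shows "frob_norm (A - B) \<le> frob_norm A + frob_norm B"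
proof -
  have "A - B = A + (-1) \<cdot>\<^sub>m B" by (intro eq_matI) (use assms in auto)
  then show ?thesis using frob_norm_triangle[of "(-1) \<cdot>\<^sub>m B" A] assms
    by (simp add: frob_norm_smult)
qed

lemma frob_norm_zero [simp]: "frob_norm (0\<^sub>m n m) = 0"
  by (simp add: frob_norm_def)

lemma frob_norm_eq_0D:
  assumes "A \<in> carrier_mat n m" "frob_norm A = 0"
  shows "A = 0\<^sub>m n m"
proof -
  have "\<forall>x\<in>{..<dim_row A} \<times> {..<dim_col A}. A $$ x = 0"
    using assms(2) unfolding frob_norm_L2 by (subst (asm) L2_set_eq_0_iff) auto
  then show ?thesis using assms(1) by (intro eq_matI) auto
qed

text \<open>Cauchy-Schwarz bounds the square of each entry by a squared row norm of \<open>A\<close>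
  times a squared column norm of \<open>B\<close>, and the sum of these products factorizes.\<close>

lemma frob_norm_mult:
  assumes "dim_col A = dim_row B"
  shows "frob_norm (A * B) \<le> frob_norm A * frob_norm B"
proof -
  let ?a = "\<lambda>i. \<Sum>l<dim_row B. (A $$ (i, l))\<^sup>2"
  let ?b = "\<lambda>j. \<Sum>l<dim_row B. (B $$ (l, j))\<^sup>2"
  have CS: "((A * B) $$ (i, j))\<^sup>2 \<le> ?a i * ?b j" if "i < dim_row A" "j < dim_col B" for i j
  proof -
    have "\<bar>(A * B) $$ (i, j)\<bar> \<le> (\<Sum>l<dim_row B. \<bar>A $$ (i, l)\<bar> * \<bar>B $$ (l, j)\<bar>)"
      using that assms sum_abs[of "\<lambda>l. A $$ (i, l) * B $$ (l, j)" "{..<dim_row B}"]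
      by (simp add: mat_mult_index abs_mult del: index_mult_mat(1))
    also have "\<dots> \<le> L2_set (\<lambda>l. A $$ (i, l)) {..<dim_row B} * L2_set (\<lambda>l. B $$ (l, j)) {..<dim_row B}"
      by (rule L2_set_mult_ineq)
    finally have "\<bar>(A * B) $$ (i, j)\<bar>\<^sup>2 \<le> (L2_set (\<lambda>l. A $$ (i, l)) {..<dim_row B} *
        L2_set (\<lambda>l. B $$ (l, j)) {..<dim_row B})\<^sup>2"
      by (rule power_mono) simp
    then show ?thesis by (simp add: L2_set_def power_mult_distrib sum_nonneg del: index_mult_mat(1))
  qed
  have "(frob_norm (A * B))\<^sup>2 \<le> (\<Sum>i<dim_row A. \<Sum>j<dim_col B. ?a i * ?b j)"
    unfolding frob_norm_sq index_mult_mat(2,3) by (intro sum_mono CS) auto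
  also have "\<dots> = (\<Sum>i<dim_row A. ?a i) * (\<Sum>j<dim_col B. ?b j)"
    by (simp add: sum_product)
  also have "\<dots> = (frob_norm A * frob_norm B)\<^sup>2"
    unfolding power_mult_distrib frob_norm_sq assms
    by (subst (2) sum.swap) (rule refl)
  finally show ?thesis by (rule power2_le_imp_le) auto
qed

lemma frob_norm_le_sum: "frob_norm A \<le> (\<Sum>i<dim_row A. \<Sum>j<dim_col A. \<bar>A $$ (i, j)\<bar>)"
proof -
  have "frob_norm A \<le> (\<Sum>x\<in>{..<dim_row A} \<times> {..<dim_col A}. \<bar>A $$ x\<bar>)"
    unfolding frob_norm_L2 by (rule L2_set_le_sum_abs)
  then show ?thesis by (simp add: sum.cartesian_product)
qed

lemma mat_trace_mult_transpose: "mat_trace (A * A\<^sup>T) = (frob_norm A)\<^sup>2"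
  unfolding frob_norm_sq by (simp add: mat_trace_mult power2_eq_square)

subsection \<open>Orthogonal matrices\<close>

definition orth :: "nat \<Rightarrow> real mat \<Rightarrow> bool" where
  "orth n E \<longleftrightarrow> E \<in> carrier_mat n n \<and> E\<^sup>T * E = 1\<^sub>m n \<and> E * E\<^sup>T = 1\<^sub>m n"

text \<open>For square matrices a left inverse is also a right inverse, so one of the two identities
  is enough.\<close>

lemma orthI:
  assumes "E \<in> carrier_mat n n" "E\<^sup>T * E = 1\<^sub>m n"
  shows "orth n E"
  unfolding orth_def using assms mat_mult_left_right_inverse[of "E\<^sup>T" n E] by auto

lemma orth_transpose: "orth n E \<Longrightarrow> orth n (E\<^sup>T)"
  by (auto simp: orth_def)

lemma orth_one: "orth n (1\<^sub>m n)"
  by (auto simp: orth_def)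

lemma orth_cancel:
  assumes "orth n E" "dim_row X = n"
  shows "E\<^sup>T * (E * X) = X" "E * (E\<^sup>T * X) = X"
  using assms by (auto simp: orth_def mat_mult_assoc[symmetric] mat_mult_one_left)

lemma orth_mult:
  assumes "orth n E" "orth n F"
  shows "orth n (E * F)"
proof -
  have [simp]: "dim_row E = n" "dim_col E = n" "dim_row F = n" "dim_col F = n"
    using assms by (auto simp: orth_def)
  show ?thesis
    using assms orth_cancel[OF assms(1)] orth_cancel[OF assms(2)]
    by (intro orthI) (auto simp: orth_def mat_ring)
qed

subsection \<open>Spectral theorem\<close>

text \<open>A complex eigenvector exists; let x and y be its real and imaginary parts. Symmetry
  equates the pairings of x with A y and of y with A x, which reduces to Im e (|x|^2 + |y|^2) = 0.
  So the eigenvalue is real, and whichever of x, y is nonzero is a real eigenvector.\<close>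

lemma real_symmetric_eigenvector:
  assumes A: "A \<in> carrier_mat n n" and sym: "A\<^sup>T = A" and n: "n > 0"
  obtains a :: real and v :: "nat \<Rightarrow> real" where
    "\<And>i. i < n \<Longrightarrow> (\<Sum>l<n. A $$ (i, l) * v l) = a * v i" "(\<Sum>l<n. (v l)\<^sup>2) = 1"
proof -
  let ?C = "map_mat complex_of_real A"
  have C: "?C \<in> carrier_mat n n" using A by simp
  obtain e where "eigenvalue ?C e"
    using spectrum_non_empty[OF C] n unfolding spectrum_def by auto
  then obtain w where w: "w \<in> carrier_vec n" "w \<noteq> 0\<^sub>v n" "?C *\<^sub>v w = e \<cdot>\<^sub>v w"
    using A unfolding eigenvalue_def eigenvector_def by auto
  have ew: "(\<Sum>l<n. complex_of_real (A $$ (i, l)) * w $ l) = e * w $ i" if "i < n" for i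
  proof -
    have "(?C *\<^sub>v w) $ i = (e \<cdot>\<^sub>v w) $ i" by (simp add: w(3))
    then show ?thesis using that A w(1) by (simp add: scalar_prod_def atLeast0LessThan)
  qed
  define x where "x l = Re (w $ l)" for l
  define y where "y l = Im (w $ l)" for l
  have ex: "(\<Sum>l<n. A $$ (i, l) * x l) = Re e * x i - Im e * y i" if "i < n" for i
    using arg_cong[OF ew[OF that], of Re] by (simp add: x_def y_def)
  have ey: "(\<Sum>l<n. A $$ (i, l) * y l) = Re e * y i + Im e * x i" if "i < n" for i
    using arg_cong[OF ew[OF that], of Im] by (simp add: x_def y_def)
  have symA: "A $$ (i, l) = A $$ (l, i)" if "i < n" "l < n" for i l
    using arg_cong[OF sym, of "\<lambda>B. B $$ (l, i)"] that A by simp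
  have "(\<Sum>i<n. y i * (\<Sum>l<n. A $$ (i, l) * x l)) = (\<Sum>i<n. x i * (\<Sum>l<n. A $$ (i, l) * y l))"
  proof -
    have "(\<Sum>i<n. y i * (\<Sum>l<n. A $$ (i, l) * x l)) = (\<Sum>i<n. \<Sum>l<n. A $$ (i, l) * x l * y i)"
      by (simp add: sum_distrib_left mult_ac)
    also have "\<dots> = (\<Sum>l<n. \<Sum>i<n. A $$ (i, l) * x l * y i)"
      by (rule sum.swap)
    also have "\<dots> = (\<Sum>l<n. \<Sum>i<n. x l * (A $$ (l, i) * y i))"
      by (intro sum.cong refl) (auto simp: symA)
    finally show ?thesis by (simp add: sum_distrib_left)
  qed
  also have "(\<Sum>i<n. y i * (\<Sum>l<n. A $$ (i, l) * x l)) = (\<Sum>i<n. y i * (Re e * x i - Im e * y i))"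
    by (intro sum.cong refl) (simp add: ex)
  also have "(\<Sum>i<n. x i * (\<Sum>l<n. A $$ (i, l) * y l)) = (\<Sum>i<n. x i * (Re e * y i + Im e * x i))"
    by (intro sum.cong refl) (simp add: ey)
  finally have "(\<Sum>i<n. x i * (Re e * y i + Im e * x i) - y i * (Re e * x i - Im e * y i)) = 0"
    by (simp add: sum_subtractf)
  then have b0: "Im e * (\<Sum>i<n. (x i)\<^sup>2 + (y i)\<^sup>2) = 0"
    by (simp add: sum_distrib_left algebra_simps power2_eq_square)
  obtain k where k: "k < n" "w $ k \<noteq> 0" using w(1,2) by force
  then have "(x k)\<^sup>2 + (y k)\<^sup>2 > 0"
    unfolding x_def y_def by (metis cmod_power2 norm_eq_zero zero_less_power2)
  moreover have "(x k)\<^sup>2 + (y k)\<^sup>2 \<le> (\<Sum>i<n. (x i)\<^sup>2 + (y i)\<^sup>2)"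
    by (rule member_le_sum) (use k in auto)
  ultimately have "Im e = 0" using b0 by auto
  define v where "v = (if x k \<noteq> 0 then x else y)"
  have ev: "(\<Sum>l<n. A $$ (i, l) * v l) = Re e * v i" if "i < n" for i
    using ex[OF that] ey[OF that] \<open>Im e = 0\<close> by (simp add: v_def)
  have "v k \<noteq> 0" using \<open>(x k)\<^sup>2 + (y k)\<^sup>2 > 0\<close> by (auto simp: v_def)
  then have "0 < (v k)\<^sup>2" by simp
  moreover have "(v k)\<^sup>2 \<le> (\<Sum>i<n. (v i)\<^sup>2)"
    by (rule member_le_sum) (use k in auto)
  ultimately have s: "(\<Sum>i<n. (v i)\<^sup>2) > 0" by linarith
  define s where "s = sqrt (\<Sum>i<n. (v i)\<^sup>2)"
  have s0: "s > 0" and s2: "s\<^sup>2 = (\<Sum>i<n. (v i)\<^sup>2)" using s by (simp_all add: s_def)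
  show ?thesis
  proof (rule that)
    show "(\<Sum>l<n. A $$ (i, l) * (v l / s)) = Re e * (v i / s)" if "i < n" for i
      using ev[OF that] by (simp add: sum_divide_distrib[symmetric])
    show "(\<Sum>l<n. (v l / s)\<^sup>2) = 1"
      using s0 by (simp add: power_divide sum_divide_distrib[symmetric] s2[symmetric])
  qed
qed

lemma sum_if_eq_mult:
  fixes f :: "nat \<Rightarrow> real"
  shows "i < n \<Longrightarrow> (\<Sum>l<n. (if l = i then 1 else 0) * f l) = f i"
  by (simp add: if_distrib[of "\<lambda>x. x * _"] sum.delta cong: if_cong)

text \<open>A Householder reflection exchanging \<open>v\<close> and the first standard basis vector.\<close>

lemma orth_first_column:
  fixes v :: "nat \<Rightarrow> real"
  assumes n: "n > 0" and v: "(\<Sum>l<n. (v l)\<^sup>2) = 1"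
  obtains E where "orth n E" "\<And>i. i < n \<Longrightarrow> E $$ (i, 0) = v i"
proof -
  define u where "u i = v i - (if i = 0 then 1 else 0)" for i
  \<comment> \<open>This is 2 / |u|^2, because |u|^2 = 2 (1 - v 0). For \<open>v 0 = 1\<close> the
    division yields 0 and \<open>E\<close> is the identity, as it should be since then u =
    0.\<close>
  define c where "c = 1 / (1 - v 0)"
  define E where "E = mat n n (\<lambda>(i, j). (if i = j then 1 else 0) - c * u i * u j)"
  have uu: "(\<Sum>l<n. (u l)\<^sup>2) = 2 * (1 - v 0)"
  proof -
    have "(\<Sum>l<n. (u l)\<^sup>2) = (\<Sum>l<n. (v l)\<^sup>2 - 2 * ((if l = 0 then 1 else 0) * v l) +
        (if l = 0 then 1 else 0) * (1::real))"
      by (intro sum.cong refl) (auto simp: u_def power2_eq_square algebra_simps)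
    also have "\<dots> = 1 - 2 * v 0 + 1"
      unfolding sum.distrib sum_subtractf sum_distrib_left[symmetric] v
      using n by (simp add: sum_if_eq_mult[of 0 n v])
    finally show ?thesis by simp
  qed
  have cuu: "c * (c * (\<Sum>l<n. (u l)\<^sup>2)) = 2 * c"
  proof (cases "v 0 = 1")
    case False
    then have "c * (1 - v 0) = 1" by (simp add: c_def)
    moreover have "c * (c * (2 * (1 - v 0))) = 2 * c * (c * (1 - v 0))" by (simp only: mult_ac)
    ultimately show ?thesis unfolding uu by simp
  qed (simp add: c_def)
  have "orth n E"
  proof (rule orthI)
    show E: "E \<in> carrier_mat n n" by (simp add: E_def)
    show "E\<^sup>T * E = 1\<^sub>m n"
    proof (rule eq_matI)
      fix i j assume ij: "i < dim_row (1\<^sub>m n)" "j < dim_col (1\<^sub>m n)"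
      let ?d = "\<lambda>l i. if l = i then 1 else (0::real)"
      have "(E\<^sup>T * E) $$ (i, j) = (\<Sum>l<n. (?d l i - c * u l * u i) * (?d l j - c * u l * u j))"
        using ij E by (simp add: mat_mult_index E_def del: index_mult_mat(1))
      also have "\<dots> = (\<Sum>l<n. ?d l i * ?d l j - ?d l i * (c * u l * u j) - ?d l j * (c * u l * u i)
            + c * c * u i * u j * (u l)\<^sup>2)"
        by (intro sum.cong refl) (simp add: algebra_simps power2_eq_square)
      also have "\<dots> = ?d i j - c * u i * u j - c * u j * u i + c * c * u i * u j * (\<Sum>l<n. (u l)\<^sup>2)"
        unfolding sum.distrib sum_subtractf sum_distrib_left[symmetric]
        using ij sum_if_eq_mult[of i n "\<lambda>l. ?d l j"] sum_if_eq_mult[of i n "\<lambda>l. c * u l * u j"]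
          sum_if_eq_mult[of j n "\<lambda>l. c * u l * u i"] by simp
      also have "\<dots> = ?d i j - 2 * c * u i * u j + (c * (c * (\<Sum>l<n. (u l)\<^sup>2))) * u i * u j"
        by (simp add: algebra_simps)
      also have "\<dots> = 1\<^sub>m n $$ (i, j)" using ij by (simp add: cuu)
      finally show "(E\<^sup>T * E) $$ (i, j) = 1\<^sub>m n $$ (i, j)" .
    qed (simp_all add: E_def)
  qed
  moreover have "E $$ (i, 0) = v i" if i: "i < n" for i
  proof (cases "v 0 = 1")
    case True
    have "(u i)\<^sup>2 \<le> (\<Sum>l<n. (u l)\<^sup>2)" by (rule member_le_sum) (use i in auto)
    then have "u i = 0" using uu True by simp
    then show ?thesis using i n by (simp add: E_def) (simp add: u_def split: if_splits)
  next
    case False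
    have "c * u 0 = -1" using False by (simp add: c_def u_def field_simps)
    then have "c * u i * u 0 = - u i" by (metis mult.assoc mult.commute mult_minus1)
    then show ?thesis using i n by (simp add: E_def) (simp add: u_def)
  qed
  ultimately show ?thesis using that by blast
qed

lemma four_block_mat_diag:
  "four_block_mat (mat_diag k f) (0\<^sub>m k l) (0\<^sub>m l k) (mat_diag l g)
     = mat_diag (k + l) (\<lambda>i. if i < k then f i else g (i - k))"
  by (intro eq_matI) (auto simp: mat_diag_def)

text \<open>Deflation: conjugation by an orthogonal matrix whose first column is a unit eigenvector
  clears the rest of the first column, and by symmetry of the first row. The remaining block is
  diagonalized by induction.\<close>

theorem real_spectral:
  assumes "A \<in> carrier_mat n n" "A\<^sup>T = (A :: real mat)"
  obtains E \<mu> where "orth n E" "A = E * mat_diag n \<mu> * E\<^sup>T"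
proof -
  have "\<exists>E \<mu>. orth n E \<and> A = E * mat_diag n \<mu> * E\<^sup>T"
    using assms
  proof (induction n arbitrary: A)
    case 0
    then show ?case by (intro exI[of _ "1\<^sub>m 0"] exI[of _ "\<lambda>_. 0"]) (auto simp: orth_one)
  next
    case (Suc n A)
    have A: "A \<in> carrier_mat (Suc n) (Suc n)" by fact
    obtain a v where av: "\<And>i. i < Suc n \<Longrightarrow> (\<Sum>l<Suc n. A $$ (i, l) * v l) = a * v i"
      "(\<Sum>l<Suc n. (v l)\<^sup>2) = 1"
      using real_symmetric_eigenvector[OF Suc.prems] by blast
    obtain E where E: "orth (Suc n) E" "\<And>i. i < Suc n \<Longrightarrow> E $$ (i, 0) = v i"
      using orth_first_column[OF _ av(2)] by blast
    have EC: "E \<in> carrier_mat (Suc n) (Suc n)" using E(1) by (simp add: orth_def)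
    have [simp]: "dim_row A = Suc n" "dim_col A = Suc n" "dim_row E = Suc n" "dim_col E = Suc n"
      using A EC by auto
    define B where "B = E\<^sup>T * (A * E)"
    have Bsym: "B\<^sup>T = B" by (simp add: B_def mat_ring Suc.prems(2))
    have [simp]: "dim_row B = Suc n" "dim_col B = Suc n" by (simp_all add: B_def)
    have AE: "(A * E) $$ (l, 0) = a * E $$ (l, 0)" if "l < Suc n" for l
    proof -
      have "(A * E) $$ (l, 0) = (\<Sum>k<Suc n. A $$ (l, k) * v k)"
        using that by (subst mat_mult_index) (auto intro!: sum.cong simp: E(2) simp del: sum.lessThan_Suc)
      then show ?thesis using that by (simp add: av(1) E(2) del: sum.lessThan_Suc)
    qed
    have B0: "B $$ (i, 0) = (if i = 0 then a else 0)" if "i < Suc n" for i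
    proof -
      have "B $$ (i, 0) = (\<Sum>l<Suc n. E\<^sup>T $$ (i, l) * (a * E $$ (l, 0)))"
        unfolding B_def using that
        by (subst mat_mult_index) (auto intro!: sum.cong simp: AE simp del: sum.lessThan_Suc index_mult_mat(1))
      also have "\<dots> = a * (E\<^sup>T * E) $$ (i, 0)"
        using that by (subst mat_mult_index) (auto simp: sum_distrib_left mult_ac simp del: sum.lessThan_Suc)
      also have "E\<^sup>T * E = 1\<^sub>m (Suc n)" using E(1) by (simp add: orth_def)
      finally show ?thesis using that by simp
    qed
    have B0': "B $$ (0, i) = (if i = 0 then a else 0)" if "i < Suc n" for i
      using B0[OF that] arg_cong[OF Bsym, of "\<lambda>X. X $$ (0, i)"] that by simp
    define C where "C = mat n n (\<lambda>(i, j). B $$ (Suc i, Suc j))"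
    have C: "C \<in> carrier_mat n n" by (simp add: C_def)
    have Bs: "B $$ (i, j) = B $$ (j, i)" if "i < Suc n" "j < Suc n" for i j
      using arg_cong[OF Bsym, of "\<lambda>X. X $$ (j, i)"] that by simp
    have "C\<^sup>T = C" by (rule eq_matI) (auto simp: C_def intro: Bs)
    then obtain F \<mu> where F: "orth n F" "C = F * mat_diag n \<mu> * F\<^sup>T"
      using Suc.IH[OF C] by blast
    have FC: "F \<in> carrier_mat n n" using F(1) by (simp add: orth_def)
    \<comment> \<open>The diagonalizer of the smaller block, extended by fixing the first axis;
      \<open>\<nu>\<close> correspondingly shifts the eigenvalues by one to make room for
      \<open>a\<close>.\<close>
    define G where "G = four_block_mat (1\<^sub>m 1) (0\<^sub>m 1 n) (0\<^sub>m n 1) F"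
    define \<nu> where "\<nu> i = (if i < 1 then a else \<mu> (i - 1))" for i
    have GC: "G \<in> carrier_mat (Suc n) (Suc n)"
      unfolding G_def using four_block_carrier_mat[of "1\<^sub>m 1" 1 1 F n n] FC by simp
    have GT: "G\<^sup>T = four_block_mat (1\<^sub>m 1) (0\<^sub>m 1 n) (0\<^sub>m n 1) (F\<^sup>T)"
      unfolding G_def using FC by (subst transpose_four_block_mat) auto
    have "orth (Suc n) G"
    proof (rule orthI[OF GC])
      show "G\<^sup>T * G = 1\<^sub>m (Suc n)"
        unfolding GT unfolding G_def using FC F(1)
        by (subst mult_four_block_mat[of _ 1 1 _ n _ n _ _ 1 _ n]) (auto simp: orth_def)
    qed
    have D: "mat_diag (Suc n) \<nu> = four_block_mat (mat_diag 1 (\<lambda>_. a)) (0\<^sub>m 1 n) (0\<^sub>m n 1) (mat_diag n \<mu>)"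
      unfolding four_block_mat_diag by (simp add: \<nu>_def[abs_def])
    have "G * mat_diag (Suc n) \<nu> * G\<^sup>T = four_block_mat (mat_diag 1 (\<lambda>_. a)) (0\<^sub>m 1 n) (0\<^sub>m n 1) C"
      unfolding GT D unfolding G_def F(2) using FC left_add_zero_mat[OF C[unfolded F(2)]]
      by (simp add: mult_four_block_mat[of _ 1 1 _ n _ n _ _ 1 _ n])
    also have "\<dots> = B"
      by (rule eq_matI) (auto simp: C_def mat_diag_def B0 B0')
    finally have GB: "G * mat_diag (Suc n) \<nu> * G\<^sup>T = B" .
    have [simp]: "dim_row G = Suc n" "dim_col G = Suc n" using GC by auto
    have EE: "E * E\<^sup>T = 1\<^sub>m (Suc n)" using E(1) by (simp add: orth_def)
    have "(E * G) * mat_diag (Suc n) \<nu> * (E * G)\<^sup>T = E * (G * mat_diag (Suc n) \<nu> * G\<^sup>T) * E\<^sup>T"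
      by (simp add: mat_ring)
    also have "\<dots> = A"
      unfolding GB B_def using orth_cancel(2)[OF E(1)]
      by (simp add: mat_ring EE)
    finally show ?case using orth_mult[OF E(1) \<open>orth (Suc n) G\<close>] by metis
  qed
  then show ?thesis using that by blast
qed

subsection \<open>Positive semidefinite matrices and square roots\<close>

lemma pos_semidefD: "pos_semidef n A \<Longrightarrow> A \<in> carrier_mat n n" "pos_semidef n A \<Longrightarrow> A\<^sup>T = A"
  by (auto simp: pos_semidef_def)

lemma pos_semidef_congruence:
  assumes A: "pos_semidef k A" and C: "C \<in> carrier_mat k n"
  shows "pos_semidef n (C\<^sup>T * A * C)"
proof -
  have AC: "A \<in> carrier_mat k k" and AT: "A\<^sup>T = A" using A by (auto simp: pos_semidef_def)
  have [simp]: "dim_row A = k" "dim_col A = k" "dim_row C = k" "dim_col C = n" using AC C by auto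
  have "0 \<le> v \<bullet> ((C\<^sup>T * A * C) *\<^sub>v v)" if v: "v \<in> carrier_vec n" for v
  proof -
    have Cv: "C *\<^sub>v v \<in> carrier_vec k" using C v by (rule mult_mat_vec_carrier)
    have ACv: "A *\<^sub>v (C *\<^sub>v v) \<in> carrier_vec k" using AC Cv by (rule mult_mat_vec_carrier)
    have CT: "C\<^sup>T \<in> carrier_mat n k" using C by simp
    have "(C\<^sup>T * A * C) *\<^sub>v v = (C\<^sup>T * A) *\<^sub>v (C *\<^sub>v v)"
      by (rule assoc_mult_mat_vec[OF mult_carrier_mat[OF CT AC] C v])
    also have "\<dots> = C\<^sup>T *\<^sub>v (A *\<^sub>v (C *\<^sub>v v))"
      by (rule assoc_mult_mat_vec[OF CT AC Cv])
    finally have "(C\<^sup>T * A * C) *\<^sub>v v = C\<^sup>T *\<^sub>v (A *\<^sub>v (C *\<^sub>v v))" .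
    moreover have "v \<bullet> (C\<^sup>T *\<^sub>v (A *\<^sub>v (C *\<^sub>v v))) = (C\<^sup>T *\<^sub>v (A *\<^sub>v (C *\<^sub>v v))) \<bullet> v"
      by (rule comm_scalar_prod[OF v mult_mat_vec_carrier[OF CT ACv]])
    moreover have "\<dots> = (A *\<^sub>v (C *\<^sub>v v)) \<bullet> (C *\<^sub>v v)"
      by (rule transpose_vec_mult_scalar[OF C v ACv])
    moreover have "\<dots> = (C *\<^sub>v v) \<bullet> (A *\<^sub>v (C *\<^sub>v v))"
      by (rule comm_scalar_prod[OF ACv Cv])
    ultimately show ?thesis using A Cv by (simp add: pos_semidef_def)
  qed
  then show ?thesis using AT by (auto simp: pos_semidef_def mat_ring)
qed

lemma pos_semidef_diag_nonneg:
  assumes A: "pos_semidef n A" and i: "i < n"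
  shows "0 \<le> A $$ (i, i)"
proof -
  have AC: "A \<in> carrier_mat n n" using A by (simp add: pos_semidef_def)
  have "0 \<le> unit_vec n i \<bullet> (A *\<^sub>v unit_vec n i)" using A by (simp add: pos_semidef_def)
  also have "unit_vec n i \<bullet> (A *\<^sub>v unit_vec n i) = (A *\<^sub>v unit_vec n i) $ i"
    using AC i by (intro scalar_prod_left_unit) auto
  also have "\<dots> = A $$ (i, i)" using AC i by simp
  finally show ?thesis .
qed

lemma pos_semidef_trace_nonneg: "pos_semidef n A \<Longrightarrow> 0 \<le> mat_trace A"
  unfolding mat_trace_def using pos_semidef_diag_nonneg
  by (intro sum_nonneg) (auto simp: pos_semidef_def)

lemma pos_semidef_mat_diag:
  assumes "\<And>i. i < n \<Longrightarrow> 0 \<le> f i"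
  shows "pos_semidef n (mat_diag n f)"
proof -
  have "v \<bullet> (mat_diag n f *\<^sub>v v) = (\<Sum>i<n. f i * (v $ i)\<^sup>2)" if "v \<in> carrier_vec n" for v
  proof -
    have "(mat_diag n f *\<^sub>v v) $ i = f i * v $ i" if i: "i < n" for i
    proof -
      have "(mat_diag n f *\<^sub>v v) $ i = (\<Sum>l<n. (if l = i then 1 else 0) * (f l * v $ l))"
        using i \<open>v \<in> carrier_vec n\<close>
        by (auto simp: scalar_prod_def mat_diag_def atLeast0LessThan intro!: sum.cong)
      also have "\<dots> = f i * v $ i" by (rule sum_if_eq_mult[OF i])
      finally show ?thesis .
    qed
    then show ?thesis using that
      by (auto simp: scalar_prod_def atLeast0LessThan power2_eq_square simp del: index_mult_mat_vec intro!: sum.cong)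
  qed
  then show ?thesis using assms
    by (auto simp: pos_semidef_def mat_transpose_mat_diag intro!: sum_nonneg)
qed

lemma pos_semidef_orth_diag:
  assumes "orth n E" "\<And>i. i < n \<Longrightarrow> 0 \<le> f i"
  shows "pos_semidef n (E * mat_diag n f * E\<^sup>T)"
proof -
  have "pos_semidef n (mat_diag n f)" by (rule pos_semidef_mat_diag) (rule assms(2))
  from pos_semidef_congruence[OF this, of "E\<^sup>T" n] show ?thesis
    using assms(1) by (simp add: orth_def)
qed

lemma pos_semidef_gram:
  assumes "C \<in> carrier_mat n k"
  shows "pos_semidef n (C * C\<^sup>T)"
proof -
  have "pos_semidef k (1\<^sub>m k)" using pos_semidef_mat_diag[of k "\<lambda>_. 1"] by simp
  from pos_semidef_congruence[OF this, of "C\<^sup>T" n] show ?thesis using assms by simp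
qed

lemma orth_diag_eigenvalue:
  assumes E: "orth n E" and A: "A = E * mat_diag n \<mu> * E\<^sup>T" and i: "i < n"
  shows "(E\<^sup>T * A * E) $$ (i, i) = \<mu> i"
proof -
  have [simp]: "dim_row E = n" "dim_col E = n" and EE: "E\<^sup>T * E = 1\<^sub>m n"
    using E by (auto simp: orth_def)
  have "E\<^sup>T * A * E = mat_diag n \<mu>"
    unfolding A by (simp add: mat_ring orth_cancel[OF E] EE)
  then show ?thesis using i by (simp add: mat_diag_def)
qed

lemma pos_semidef_eigenvalue_nonneg:
  assumes "pos_semidef n A" "orth n E" "A = E * mat_diag n \<mu> * E\<^sup>T" "i < n"
  shows "0 \<le> \<mu> i"
  using pos_semidef_diag_nonneg[OF pos_semidef_congruence[OF assms(1), of E n] assms(4)]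
    orth_diag_eigenvalue[OF assms(2-4)] assms(2) by (simp add: orth_def)

lemma orth_diag_mult:
  assumes E: "orth n E"
  shows "(E * mat_diag n f * E\<^sup>T) * (E * mat_diag n g * E\<^sup>T) = E * mat_diag n (\<lambda>i. f i * g i) * E\<^sup>T"
proof -
  have [simp]: "dim_row E = n" "dim_col E = n" using E by (auto simp: orth_def)
  have "(E * mat_diag n f * E\<^sup>T) * (E * mat_diag n g * E\<^sup>T) = E * (mat_diag n f * mat_diag n g) * E\<^sup>T"
    by (simp add: mat_ring orth_cancel[OF E] del: mat_diag_diag)
  then show ?thesis by simp
qed

lemma pos_semidef_sqrt_exists:
  assumes "pos_semidef n A"
  obtains S where "pos_semidef n S" "S * S = A"
proof -
  obtain E \<mu> where E: "orth n E" "A = E * mat_diag n \<mu> * E\<^sup>T"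
    using real_spectral assms by (metis pos_semidef_def)
  have \<mu>: "0 \<le> \<mu> i" if "i < n" for i
    using pos_semidef_eigenvalue_nonneg[OF assms E that] .
  have *: "mat_diag n (\<lambda>i. sqrt (\<mu> i) * sqrt (\<mu> i)) = mat_diag n \<mu>"
    by (rule eq_matI) (auto simp: mat_diag_def \<mu>)
  show ?thesis
  proof (rule that)
    show "pos_semidef n (E * mat_diag n (\<lambda>i. sqrt (\<mu> i)) * E\<^sup>T)"
      by (rule pos_semidef_orth_diag[OF E(1)]) (simp add: \<mu>)
  qed (simp only: orth_diag_mult[OF E(1)] E(2) *)
qed

text \<open>In an eigenbasis of \<open>D = S - T\<close>, the identity \<open>D S + T D = 0\<close> has diagonal
  entries \<open>\<delta> i * (s i + t i) = 0\<close>, where \<open>\<delta> i = s i - t i\<close> and \<open>s i, t i \<ge> 0\<close>.\<close>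

lemma pos_semidef_sqrt_unique:
  assumes S: "pos_semidef n S" and T: "pos_semidef n T" and eq: "S * S = T * T"
  shows "S = T"
proof -
  have SC: "S \<in> carrier_mat n n" "S\<^sup>T = S" and TC: "T \<in> carrier_mat n n" "T\<^sup>T = T"
    using S T by (auto simp: pos_semidef_def)
  have [simp]: "dim_row S = n" "dim_col S = n" "dim_row T = n" "dim_col T = n"
    using SC TC by auto
  define D where "D = S - T"
  have "D \<in> carrier_mat n n" unfolding D_def by (rule carrier_matI) simp_all
  moreover have "D\<^sup>T = D" unfolding D_def by (simp add: mat_transpose_diff SC(2) TC(2))
  ultimately obtain E \<delta> where E: "orth n E" "D = E * mat_diag n \<delta> * E\<^sup>T"
    by (rule real_spectral)
  have EC: "E \<in> carrier_mat n n" and EE: "E\<^sup>T * E = 1\<^sub>m n" using E(1) by (auto simp: orth_def)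
  have [simp]: "dim_row E = n" "dim_col E = n" using EC by auto
  have DS: "D * S + T * D = 0\<^sub>m n n"
  proof -
    have "D * S + T * D = (S * S - T * S) + (T * S - T * T)"
      by (simp add: D_def mat_ring)
    also have "\<dots> = 0\<^sub>m n n" unfolding eq by (rule eq_matI) auto
    finally show ?thesis .
  qed
  define S' where "S' = E\<^sup>T * S * E"
  define T' where "T' = E\<^sup>T * T * E"
  have [simp]: "dim_row S' = n" "dim_col S' = n" "dim_row T' = n" "dim_col T' = n"
    by (simp_all add: S'_def T'_def)
  have diff: "S' - T' = mat_diag n \<delta>"
  proof -
    have "S' - T' = E\<^sup>T * D * E" by (simp add: S'_def T'_def D_def mat_ring)
    then show ?thesis by (simp add: E(2) mat_ring orth_cancel[OF E(1)] EE)
  qed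
  have "E\<^sup>T * (D * S + T * D) * E = mat_diag n \<delta> * S' + T' * mat_diag n \<delta>"
    unfolding S'_def T'_def E(2) by (simp add: mat_ring orth_cancel[OF E(1)] EE)
  moreover have "E\<^sup>T * (D * S + T * D) * E = 0\<^sub>m n n" unfolding DS using EC by simp
  ultimately have eq0: "mat_diag n \<delta> * S' + T' * mat_diag n \<delta> = 0\<^sub>m n n" by simp
  have "\<delta> i = 0" if i: "i < n" for i
  proof -
    have "mat_diag n \<delta> * S' = mat n n (\<lambda>(i, j). \<delta> i * S' $$ (i, j))"
      by (rule mat_diag_mult_left) (auto intro: carrier_matI)
    moreover have "T' * mat_diag n \<delta> = mat n n (\<lambda>(i, j). T' $$ (i, j) * \<delta> j)"
      by (rule mat_diag_mult_right) (auto intro: carrier_matI)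
    ultimately have "\<delta> i * S' $$ (i, i) + T' $$ (i, i) * \<delta> i = 0"
      using arg_cong[OF eq0, of "\<lambda>X. X $$ (i, i)"] i by simp
    then have "\<delta> i * (S' $$ (i, i) + T' $$ (i, i)) = 0" by (simp add: algebra_simps)
    moreover have "\<delta> i = S' $$ (i, i) - T' $$ (i, i)"
      using arg_cong[OF diff, of "\<lambda>X. X $$ (i, i)"] i by (simp add: mat_diag_def)
    moreover have "0 \<le> S' $$ (i, i)" "0 \<le> T' $$ (i, i)"
      unfolding S'_def T'_def
      using pos_semidef_diag_nonneg[OF pos_semidef_congruence[OF S EC] i]
        pos_semidef_diag_nonneg[OF pos_semidef_congruence[OF T EC] i] by auto
    ultimately show ?thesis by auto
  qed
  then have "mat_diag n \<delta> = 0\<^sub>m n n" by (intro eq_matI) (auto simp: mat_diag_def)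
  then have "D = 0\<^sub>m n n" using E(2) EC by simp
  show ?thesis
  proof (rule eq_matI)
    fix i j assume "i < dim_row T" "j < dim_col T"
    then show "S $$ (i, j) = T $$ (i, j)"
      using arg_cong[OF \<open>D = 0\<^sub>m n n\<close>, of "\<lambda>X. X $$ (i, j)"] by (simp add: D_def)
  qed auto
qed

lemma mat_sqrt_eq:
  assumes "pos_semidef n S" "S * S = A"
  shows "mat_sqrt n A = S"
  unfolding mat_sqrt_def using assms pos_semidef_sqrt_unique
  by (intro the_equality) auto

lemma mat_sqrt:
  assumes "pos_semidef n A"
  shows "pos_semidef n (mat_sqrt n A)" "mat_sqrt n A * mat_sqrt n A = A"
  using pos_semidef_sqrt_exists[OF assms] mat_sqrt_eq by metis+

subsection \<open>Rank\<close>

text \<open>Each column of \<open>A * B\<close> is \<open>A\<close> applied to a column of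
  \<open>B\<close>, so the column space can only shrink.\<close>

lemma rank_mult_le_left:
  fixes A B :: "real mat"
  assumes A: "A \<in> carrier_mat n k" and B: "B \<in> carrier_mat k m"
  shows "vec_space.rank n (A * B) \<le> vec_space.rank n A"
proof -
  interpret vec_space "TYPE(real)" n .
  have AB: "A * B \<in> carrier_mat n m" using A B by (rule mult_carrier_mat)
  have cA: "set (cols A) \<subseteq> carrier_vec n" and cAB: "set (cols (A * B)) \<subseteq> carrier_vec n"
    using cols_dim[of A] cols_dim[of "A * B"] A AB by (simp_all only: carrier_matD)
  have "set (cols (A * B)) \<subseteq> span (set (cols A))"
  proof
    fix x assume "x \<in> set (cols (A * B))"
    then obtain j where j: "j < m" "x = col (A * B) j"
      using AB by (auto simp: cols_def)
    have "x = A *\<^sub>v col B j"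
      unfolding j(2) using A B j(1) by (intro eq_vecI) auto
    moreover have "col B j \<in> carrier_vec k" using B by auto
    ultimately have "x \<in> col_space A"
      using col_space_eq[OF A] A mult_mat_vec_carrier[OF A, of "col B j"] by auto
    then show "x \<in> span (set (cols A))" by (simp add: col_space_def)
  qed
  then have sub: "span (set (cols (A * B))) \<subseteq> span (set (cols A))"
    using span_is_subset[OF _ span_is_submodule[OF cA]] by simp
  have sA: "VectorSpace.subspace class_ring (span (set (cols A))) V"
    and sAB: "VectorSpace.subspace class_ring (span (set (cols (A * B)))) V"
    using span_is_subspace[of "set (cols A)"] span_is_subspace[of "set (cols (A * B))"] cA cAB by simp_all
  have "VectorSpace.subspace class_ring (span (set (cols (A * B)))) (vs (span (set (cols A))))"
    by (rule nested_subspaces[OF sA sAB sub])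
  then show ?thesis
    unfolding rank_def
    using vectorspace.subspace_dim[OF subspace_is_vs[OF sA]] fin_dim_span_cols[OF A] fin_dim_span_cols[OF AB]
    by simp
qed

text \<open>\<open>A\<close> collects a maximal independent set of columns of \<open>W\<close>, and
  \<open>B\<close> the coordinates of all columns with respect to it. With this, rank is handled
  through the inner dimension of a product, without row rank.\<close>

lemma rank_factorization:
  fixes W :: "real mat"
  assumes W: "W \<in> carrier_mat n m"
  obtains A B where "A \<in> carrier_mat n (vec_space.rank n W)" "B \<in> carrier_mat (vec_space.rank n W) m"
    "W = A * B"
proof -
  interpret vec_space "TYPE(real)" n .
  have cW: "set (cols W) \<subseteq> carrier_vec n" using cols_dim[of W] W by (simp only: carrier_matD)
  let ?P = "\<lambda>T. T \<subseteq> set (cols W) \<and> lin_indpt T"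
  have "?P {}" by (metis empty_subsetI fin_dim finite_basis_exists subset_li_is_li basis_def)
  then obtain U where U: "finite U" "maximal U ?P"
    using maximal_exists_superset[of "set (cols W)" ?P "{}"] by auto
  have rk: "rank W = card U" by (rule rank_card_indpt[OF W U(2)])
  have US: "U \<subseteq> set (cols W)" and UI: "lin_indpt U" using U(2) unfolding maximal_def by auto
  have Uc: "U \<subseteq> carrier_vec n" using US cW by auto
  have in_span: "s \<in> span U" if s: "s \<in> set (cols W)" for s
  proof (rule ccontr)
    assume ns: "s \<notin> span U"
    then have "s \<notin> U" using span_mem[of U] Uc by auto
    then have "lin_indpt (U \<union> {s})"
      using lin_dep_iff_in_span[of U s] Uc UI ns s cW by auto
    then have "U \<union> {s} = U" using U(2) US s unfolding maximal_def by blast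
    then show False using \<open>s \<notin> U\<close> by auto
  qed
  obtain us where us: "set us = U" "distinct us" using finite_distinct_list[OF U(1)] by blast
  have len: "length us = rank W" using us distinct_card[OF us(2)] rk by simp
  define A where "A = mat_of_cols n us"
  have A: "A \<in> carrier_mat n (rank W)" unfolding A_def using mat_of_cols_carrier(1)[of n us] len by simp
  have cA: "cols A = us" unfolding A_def by (rule cols_mat_of_cols) (use us Uc in simp)
  have "\<exists>x \<in> carrier_vec (rank W). A *\<^sub>v x = col W j" if j: "j < m" for j
  proof -
    have "col W j \<in> set (cols W)" using j W by (auto simp: cols_def)
    then have "col W j \<in> col_space A" using in_span us unfolding col_space_def cA by simp
    then show ?thesis using col_space_eq[OF A] A by auto
  qed
  then obtain x where x: "\<And>j. j < m \<Longrightarrow> x j \<in> carrier_vec (rank W) \<and> A *\<^sub>v x j = col W j"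
    by metis
  define B where "B = mat_of_cols (rank W) (map x [0..<m])"
  have B: "B \<in> carrier_mat (rank W) m"
    unfolding B_def using mat_of_cols_carrier(1)[of "rank W" "map x [0..<m]"] by simp
  have "W = A * B"
  proof (rule eq_matI)
    fix i j assume ij: "i < dim_row (A * B)" "j < dim_col (A * B)"
    then have i: "i < n" and j: "j < m" using A B by auto
    have "W $$ (i, j) = col W j $ i" using i j W by simp
    also have "\<dots> = (A *\<^sub>v x j) $ i" using x[OF j] by simp
    also have "\<dots> = row A i \<bullet> x j" using i A by simp
    also have "x j = col B j" unfolding B_def using x[OF j] j by (subst col_mat_of_cols) auto
    finally show "W $$ (i, j) = (A * B) $$ (i, j)" using ij by simp
  qed (use A B W in auto)
  then show ?thesis using that A B by blast
qed

lemma rank_mult_le_inner: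
  fixes A B :: "real mat"
  assumes "A \<in> carrier_mat n k" "B \<in> carrier_mat k m"
  shows "vec_space.rank n (A * B) \<le> k"
  using rank_mult_le_left[OF assms] vec_space.rank_le_nc[OF assms(1)] by linarith

text \<open>If \<open>B = X * Y\<close> with inner dimension the rank of \<open>B\<close>, then
  \<open>A * B\<close> factors through the same dimension.\<close>

lemma rank_mult_le_right:
  fixes A B :: "real mat"
  assumes A: "A \<in> carrier_mat n k" and B: "B \<in> carrier_mat k m"
  shows "vec_space.rank n (A * B) \<le> vec_space.rank k B"
proof -
  obtain X Y where XY: "X \<in> carrier_mat k (vec_space.rank k B)" "Y \<in> carrier_mat (vec_space.rank k B) m"
    "B = X * Y" using rank_factorization[OF B] by blast
  have "A * B = (A * X) * Y" using A XY by (subst XY(3)) (simp add: mat_mult_assoc)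
  then show ?thesis
    using rank_mult_le_inner[OF mult_carrier_mat[OF A XY(1)] XY(2)] by simp
qed

section \<open>Invertibility, generalized inverses and the rank of Gram matrices\<close>

lemma det_nonzero_obtain_inverse:
  fixes A :: "real mat"
  assumes A: "A \<in> carrier_mat n n" and det: "det A \<noteq> 0"
  obtains B where "B \<in> carrier_mat n n" "A * B = 1\<^sub>m n" "B * A = 1\<^sub>m n"
proof -
  have "A \<in> Units (ring_mat TYPE(real) n ())" by (rule det_non_zero_imp_unit[OF A det])
  then show ?thesis using that unfolding Units_def ring_mat_simps by auto
qed

lemma full_rank_obtain_inverse:
  fixes A :: "real mat"
  assumes A: "A \<in> carrier_mat n n" and rk: "n \<le> vec_space.rank n A"
  obtains B where "B \<in> carrier_mat n n" "A * B = 1\<^sub>m n" "B * A = 1\<^sub>m n"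
proof -
  have "vec_space.rank n A = n" using rk vec_space.rank_le_nc[OF A] by simp
  then show ?thesis using det_nonzero_obtain_inverse[OF A] vec_space.det_rank_iff[OF A] that by metis
qed

lemma inverse_full_rank:
  fixes A B :: "real mat"
  assumes A: "A \<in> carrier_mat n n" and B: "B \<in> carrier_mat n n" and AB: "A * B = 1\<^sub>m n"
  shows "vec_space.rank n A = n"
proof -
  have "det A * det B = 1" using det_mult[OF A B] AB by simp
  then have "det A \<noteq> 0" by auto
  then show ?thesis using vec_space.det_rank_iff[OF A] by simp
qed

text \<open>The rows of \<open>E\<^sup>T * W\<close> are pairwise orthogonal with squared norms
  \<open>\<mu> i\<close>, so the rows with \<open>\<mu> i = 0\<close> vanish and the projection onto
  the others changes nothing.\<close>

lemma gram_diag_support: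
  assumes E: "orth n E" and W: "W \<in> carrier_mat n m"
    and gram: "W * W\<^sup>T = E * mat_diag n \<mu> * E\<^sup>T"
  shows "E * (mat_diag n (\<lambda>i. if \<mu> i = 0 then 0 else 1) * (E\<^sup>T * W)) = W"
proof -
  have [simp]: "dim_row E = n" "dim_col E = n" and EE: "E\<^sup>T * E = 1\<^sub>m n" using E by (auto simp: orth_def)
  have [simp]: "dim_row W = n" "dim_col W = m" using W by auto
  define Y where "Y = E\<^sup>T * W"
  have Yd [simp]: "dim_row Y = n" "dim_col Y = m" by (simp_all add: Y_def)
  have "Y * Y\<^sup>T = E\<^sup>T * (W * W\<^sup>T) * E" by (simp add: Y_def mat_ring)
  also have "\<dots> = mat_diag n \<mu>" unfolding gram by (simp add: mat_ring orth_cancel[OF E] EE)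
  finally have YY: "Y * Y\<^sup>T = mat_diag n \<mu>" .
  have "Y $$ (i, j) = 0" if i: "i < n" "\<mu> i = 0" and j: "j < m" for i j
  proof -
    have "(\<Sum>l<m. Y $$ (i, l) * Y $$ (i, l)) = (Y * Y\<^sup>T) $$ (i, i)"
      using i by (subst mat_mult_index) auto
    then have "(\<Sum>l<m. Y $$ (i, l) * Y $$ (i, l)) = 0" unfolding YY using i by (simp add: mat_diag_def)
    then show ?thesis using j by (subst (asm) sum_nonneg_eq_0_iff) auto
  qed
  moreover have "mat_diag n (\<lambda>i. if \<mu> i = 0 then 0 else 1) * Y
      = mat n m (\<lambda>(i, j). (if \<mu> i = 0 then 0 else 1) * Y $$ (i, j))"
    by (rule mat_diag_mult_left) (rule carrier_matI; simp)
  ultimately have "mat_diag n (\<lambda>i. if \<mu> i = 0 then 0 else 1) * Y = Y"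
    by (intro eq_matI) auto
  then show ?thesis unfolding Y_def using orth_cancel[OF E] by simp
qed

text \<open>Multiplying \<open>W\<^sup>T\<close> by the pseudoinverse of
  \<open>W * W\<^sup>T\<close> works, because then \<open>W * G\<close> is the orthogonal projection
  onto the range of \<open>W\<close>.\<close>

lemma generalized_inverse:
  fixes W :: "real mat"
  assumes W: "W \<in> carrier_mat n m"
  obtains G where "G \<in> carrier_mat m n" "W * (G * W) = W"
proof -
  have [simp]: "dim_row W = n" "dim_col W = m" using W by auto
  have "W * W\<^sup>T \<in> carrier_mat n n" "(W * W\<^sup>T)\<^sup>T = W * W\<^sup>T"
    by (simp_all add: mat_ring carrier_matI)
  then obtain E \<mu> where E: "orth n E" "W * W\<^sup>T = E * mat_diag n \<mu> * E\<^sup>T"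
    by (rule real_spectral)
  have [simp]: "dim_row E = n" "dim_col E = n" using E by (auto simp: orth_def)
  \<comment> \<open>Division by zero yields 0, so \<open>1 / \<mu> i\<close> is already the
    pseudoinverse on the kernel.\<close>
  define G where "G = W\<^sup>T * (E * mat_diag n (\<lambda>i. 1 / \<mu> i) * E\<^sup>T)"
  have [simp]: "dim_row G = m" "dim_col G = n" by (simp_all add: G_def)
  have "W * G = (W * W\<^sup>T) * (E * mat_diag n (\<lambda>i. 1 / \<mu> i) * E\<^sup>T)"
    by (simp add: G_def mat_mult_assoc)
  also have "\<dots> = E * mat_diag n (\<lambda>i. \<mu> i * (1 / \<mu> i)) * E\<^sup>T"
    unfolding E(2) by (rule orth_diag_mult[OF E(1)])
  also have "(\<lambda>i. \<mu> i * (1 / \<mu> i)) = (\<lambda>i. if \<mu> i = 0 then 0 else 1)" by auto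
  finally have WG: "W * G = E * mat_diag n (\<lambda>i. if \<mu> i = 0 then 0 else 1) * E\<^sup>T" .
  have "W * (G * W) = W * G * W" by (simp add: mat_mult_assoc)
  also have "\<dots> = W" unfolding WG using gram_diag_support[OF E(1) W E(2)] by (simp add: mat_mult_assoc)
  finally show ?thesis using that[of G] by (simp add: carrier_matI)
qed

text \<open>From above, \<open>W\<close> factors through the \<open>k\<close> eigenvectors with
  nonzero eigenvalue. From below, the compression of \<open>W * W\<^sup>T\<close> to these
  eigenvectors is an invertible diagonal matrix of size \<open>k\<close>.\<close>

lemma rank_gram_diag:
  assumes E: "orth n E" and W: "W \<in> carrier_mat n m"
    and gram: "W * W\<^sup>T = E * mat_diag n \<mu> * E\<^sup>T"
  shows "vec_space.rank n W = card {i. i < n \<and> \<mu> i \<noteq> 0}"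
proof -
  define k where "k = card {i. i < n \<and> \<mu> i \<noteq> 0}"
  obtain f where f: "bij_betw f {..<k} {i. i < n \<and> \<mu> i \<noteq> 0}"
    unfolding k_def using ex_bij_betw_nat_finite[of "{i. i < n \<and> \<mu> i \<noteq> 0}"] by (auto simp: atLeast0LessThan)
  have fn: "f l < n" "\<mu> (f l) \<noteq> 0" if "l < k" for l
    using bij_betwE[OF f] that by auto
  have finj: "f a = f b \<longleftrightarrow> a = b" if "a < k" "b < k" for a b
    using bij_betw_imp_inj_on[OF f] that by (auto dest: inj_onD)
  have [simp]: "dim_row E = n" "dim_col E = n" and EE: "E\<^sup>T * E = 1\<^sub>m n" using E by (auto simp: orth_def)
  have [simp]: "dim_row W = n" "dim_col W = m" using W by auto
  \<comment> \<open>The columns are the standard basis vectors at the indices with nonzero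
    eigenvalue, enumerated by \<open>f\<close>.\<close>
  define S where "S = mat n k (\<lambda>(i, l). if i = f l then 1 else (0::real))"
  have Sd [simp]: "dim_row S = n" "dim_col S = k" by (simp_all add: S_def)
  have SS: "S * S\<^sup>T = mat_diag n (\<lambda>i. if \<mu> i = 0 then 0 else 1)"
  proof (rule eq_matI)
    fix i j assume "i < dim_row (mat_diag n (\<lambda>i. if \<mu> i = 0 then 0 else (1::real)))"
      "j < dim_col (mat_diag n (\<lambda>i. if \<mu> i = 0 then 0 else (1::real)))"
    then have ij: "i < n" "j < n" by auto
    have "(S * S\<^sup>T) $$ (i, j) = (\<Sum>l<k. (if i = f l then 1 else 0) * (if j = f l then 1 else 0))"
      using ij by (subst mat_mult_index) (auto simp: S_def intro!: sum.cong)
    also have "\<dots> = (\<Sum>x\<in>{i. i < n \<and> \<mu> i \<noteq> 0}. (if i = x then 1 else 0) * (if j = x then 1 else 0))"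
      by (rule sum.reindex_bij_betw[OF f])
    also have "\<dots> = (\<Sum>x\<in>{i. i < n \<and> \<mu> i \<noteq> 0}. if x = i then (if i = j then 1 else 0) else 0)"
      by (intro sum.cong) auto
    also have "\<dots> = (if i \<in> {i. i < n \<and> \<mu> i \<noteq> 0} then (if i = j then 1 else 0) else 0)"
      by (subst sum.delta) simp_all
    finally show "(S * S\<^sup>T) $$ (i, j) = mat_diag n (\<lambda>i. if \<mu> i = 0 then 0 else 1) $$ (i, j)"
      using ij by (auto simp: mat_diag_def)
  qed simp_all
  have "W = (E * S) * (S\<^sup>T * (E\<^sup>T * W))"
    using gram_diag_support[OF assms] unfolding SS[symmetric] by (simp add: mat_mult_assoc)
  then have le: "vec_space.rank n W \<le> k"
    using rank_mult_le_inner[of "E * S" n k "S\<^sup>T * (E\<^sup>T * W)" m] by (simp add: carrier_matI)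
  define D where "D = mat_diag k (\<lambda>l. \<mu> (f l))"
  have SDS: "S\<^sup>T * (mat_diag n \<mu> * S) = D"
  proof (rule eq_matI)
    fix a b assume "a < dim_row D" "b < dim_col D"
    then have ab: "a < k" "b < k" by (auto simp: D_def)
    have DS: "mat_diag n \<mu> * S = mat n k (\<lambda>(i, j). \<mu> i * S $$ (i, j))"
      by (rule mat_diag_mult_left) (rule carrier_matI; simp)
    have "(S\<^sup>T * (mat_diag n \<mu> * S)) $$ (a, b) =
        (\<Sum>i<n. (if i = f a then 1 else 0) * (\<mu> i * (if i = f b then 1 else 0)))"
      unfolding DS using ab by (subst mat_mult_index) (auto simp: S_def intro!: sum.cong)
    also have "\<dots> = \<mu> (f a) * (if f a = f b then 1 else 0)"
      by (rule sum_if_eq_mult) (rule fn[OF ab(1)])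
    finally show "(S\<^sup>T * (mat_diag n \<mu> * S)) $$ (a, b) = D $$ (a, b)"
      using ab by (auto simp: D_def mat_diag_def finj)
  qed (simp_all add: D_def)
  have "D = (S\<^sup>T * E\<^sup>T) * (W * (W\<^sup>T * (E * S)))"
  proof -
    have "(S\<^sup>T * E\<^sup>T) * (W * (W\<^sup>T * (E * S))) = (S\<^sup>T * E\<^sup>T) * ((W * W\<^sup>T) * (E * S))"
      by (simp add: mat_mult_assoc)
    also have "\<dots> = S\<^sup>T * (mat_diag n \<mu> * S)"
      unfolding gram by (simp add: mat_mult_assoc orth_cancel[OF E])
    finally show ?thesis by (simp add: SDS)
  qed
  then have "vec_space.rank k D \<le> vec_space.rank n (W * (W\<^sup>T * (E * S)))"
    using rank_mult_le_right[of "S\<^sup>T * E\<^sup>T" k n "W * (W\<^sup>T * (E * S))" k] by (simp add: carrier_matI)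
  also have "\<dots> \<le> vec_space.rank n W"
    by (rule rank_mult_le_left[OF W, of _ k]) (simp add: carrier_matI)
  also have "vec_space.rank k D = k"
  proof (rule inverse_full_rank)
    have "D * mat_diag k (\<lambda>l. 1 / \<mu> (f l)) = mat_diag k (\<lambda>l. \<mu> (f l) * (1 / \<mu> (f l)))"
      unfolding D_def by (rule mat_diag_diag)
    also have "\<dots> = 1\<^sub>m k" by (rule eq_matI) (auto simp: mat_diag_def fn)
    finally show "D * mat_diag k (\<lambda>l. 1 / \<mu> (f l)) = 1\<^sub>m k" .
  qed (simp_all add: D_def)
  finally show ?thesis using le by (simp add: k_def)
qed

text \<open>Factor \<open>U = A * B\<close> through its rank \<open>k\<close> and let
  \<open>H\<close> be a generalized inverse of \<open>B * P\<close>. Then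
  \<open>K = B * P * H\<close> is idempotent, and the rank hypothesis makes it invertible; hence
  \<open>K\<close> is the identity and \<open>X = H * B\<close> works.\<close>

lemma range_eq_factor:
  fixes U P :: "real mat"
  assumes U: "U \<in> carrier_mat n m" and P: "P \<in> carrier_mat m p"
    and rk: "vec_space.rank n U \<le> vec_space.rank n (U * P)"
  obtains X where "X \<in> carrier_mat p m" "U = (U * P) * X"
proof -
  define k where "k = vec_space.rank n U"
  obtain A B where A: "A \<in> carrier_mat n k" and B: "B \<in> carrier_mat k m" and AB: "U = A * B"
    using rank_factorization[OF U] unfolding k_def by blast
  have [simp]: "dim_row A = n" "dim_col A = k" "dim_row B = k" "dim_col B = m" "dim_row P = m" "dim_col P = p"
    using A B P by auto
  have BP: "B * P \<in> carrier_mat k p" by (simp add: carrier_matI)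
  obtain H where H: "H \<in> carrier_mat p k" "(B * P) * (H * (B * P)) = B * P"
    using generalized_inverse[OF BP] by blast
  have [simp]: "dim_row H = p" "dim_col H = k" using H by auto
  define K where "K = B * P * H"
  have KC: "K \<in> carrier_mat k k" by (simp add: K_def carrier_matI)
  have [simp]: "dim_row K = k" "dim_col K = k" using KC by auto
  have KBP: "K * (B * P) = B * P" using H(2) by (simp add: K_def mat_mult_assoc)
  have "U * P = A * (K * (B * P))" unfolding KBP by (simp add: AB mat_mult_assoc)
  then have "k \<le> vec_space.rank n (A * (K * (B * P)))" using rk by (simp add: k_def)
  also have "\<dots> \<le> vec_space.rank k (K * (B * P))"
    by (rule rank_mult_le_right[OF A, of _ p]) (simp add: carrier_matI)
  also have "\<dots> \<le> vec_space.rank k K"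
    by (rule rank_mult_le_left[OF KC BP])
  finally obtain Z where Z: "Z \<in> carrier_mat k k" "K * Z = 1\<^sub>m k"
    using full_rank_obtain_inverse[OF KC] by metis
  have [simp]: "dim_row Z = k" "dim_col Z = k" using Z by auto
  have KK: "K * K = K"
  proof -
    have "K * K = (K * (B * P)) * H" by (simp add: K_def mat_mult_assoc)
    then show ?thesis unfolding KBP by (simp add: K_def)
  qed
  have "K * (K * Z) = K * Z" using KK by (simp add: mat_mult_assoc[symmetric])
  then have K1: "K = 1\<^sub>m k" unfolding Z(2) by (simp add: mat_mult_one_right)
  have "(U * P) * (H * B) = A * (K * B)" by (simp add: AB K_def mat_mult_assoc)
  also have "K * B = B" unfolding K1 by (rule mat_mult_one_left) simp
  also have "A * B = U" by (rule AB[symmetric])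
  finally have "U * P * (H * B) = U" .
  from that[OF _ this[symmetric]] show ?thesis by (simp add: carrier_matI)
qed

subsection \<open>Matrices near a given matrix\<close>

lemma frob_norm_one: "frob_norm (1\<^sub>m n) = sqrt (real n)"
proof -
  have "(\<Sum>j<n. (1\<^sub>m n $$ (i, j) :: real)\<^sup>2) = 1" if "i < n" for i
  proof -
    have "(\<Sum>j<n. (1\<^sub>m n $$ (i, j) :: real)\<^sup>2) = (\<Sum>j<n. if j = i then 1 else 0)"
      using that by (intro sum.cong) auto
    then show ?thesis using that by simp
  qed
  then show ?thesis by (simp add: frob_norm_def)
qed

text \<open>A kernel vector v would satisfy v = - A v, hence |v| \<le> |v| / 2. The inverse
  satisfies Y = 1 - A Y, hence |Y| \<le> sqrt n + |Y| / 2.\<close>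

lemma one_plus_small_inverse:
  assumes A: "A \<in> carrier_mat n n" and small: "frob_norm A \<le> 1 / 2"
  obtains Y where "Y \<in> carrier_mat n n" "(1\<^sub>m n + A) * Y = 1\<^sub>m n" "Y * (1\<^sub>m n + A) = 1\<^sub>m n"
    "frob_norm Y \<le> 2 * sqrt (real n)"
proof -
  have [simp]: "dim_row A = n" "dim_col A = n" using A by auto
  have B: "1\<^sub>m n + A \<in> carrier_mat n n" by (simp add: carrier_matI)
  have "det (1\<^sub>m n + A) \<noteq> 0"
  proof
    assume "det (1\<^sub>m n + A) = 0"
    then obtain v where v: "v \<in> carrier_vec n" "v \<noteq> 0\<^sub>v n" "(1\<^sub>m n + A) *\<^sub>v v = 0\<^sub>v n"
      using det_0_iff_vec_prod_zero_field[OF B] by auto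
    \<comment> \<open>As a one-column matrix, the vector falls under submultiplicativity of the
      Frobenius norm.\<close>
    define X where "X = mat_of_cols n [v]"
    have [simp]: "dim_row X = n" "dim_col X = 1" by (simp_all add: X_def)
    have "(1\<^sub>m n + A) * X = 0\<^sub>m n 1"
    proof (rule eq_matI)
      fix i j assume ij: "i < dim_row (0\<^sub>m n 1)" "j < dim_col (0\<^sub>m n 1)"
      have "col X j = v" using ij v(1) by (simp add: X_def)
      then have "((1\<^sub>m n + A) * X) $$ (i, j) = ((1\<^sub>m n + A) *\<^sub>v v) $ i" using ij by simp
      then show "((1\<^sub>m n + A) * X) $$ (i, j) = 0\<^sub>m n 1 $$ (i, j)" using ij by (simp only: v(3)) simp
    qed simp_all
    then have *: "X + A * X = 0\<^sub>m n 1" by (simp add: mat_ring)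
    have "X = (-1) \<cdot>\<^sub>m (A * X)"
    proof (rule eq_matI)
      fix i j assume "i < dim_row ((-1) \<cdot>\<^sub>m (A * X))" "j < dim_col ((-1) \<cdot>\<^sub>m (A * X))"
      then show "X $$ (i, j) = ((-1) \<cdot>\<^sub>m (A * X)) $$ (i, j)"
        using arg_cong[OF *, of "\<lambda>M. M $$ (i, j)"] by (simp del: index_mult_mat(1))
    qed simp_all
    then have "frob_norm X = frob_norm (A * X)" by (metis abs_minus_cancel abs_one frob_norm_smult mult_1)
    also have "\<dots> \<le> frob_norm A * frob_norm X" by (rule frob_norm_mult) simp
    also have "\<dots> \<le> 1 / 2 * frob_norm X" by (rule mult_right_mono[OF small]) simp
    finally have "frob_norm X = 0" using frob_norm_nonneg[of X] by linarith
    then have "X = 0\<^sub>m n 1" by (intro frob_norm_eq_0D) (simp_all add: carrier_matI)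
    have "v $ i = 0" if "i < n" for i
      using arg_cong[OF \<open>X = 0\<^sub>m n 1\<close>, of "\<lambda>M. M $$ (i, 0)"] that by (simp add: X_def mat_of_cols_index)
    then have "v = 0\<^sub>v n" using v(1) by (intro eq_vecI) auto
    then show False using v(2) by simp
  qed
  then obtain Y where Y: "Y \<in> carrier_mat n n" "(1\<^sub>m n + A) * Y = 1\<^sub>m n" "Y * (1\<^sub>m n + A) = 1\<^sub>m n"
    using det_nonzero_obtain_inverse[OF B] by metis
  have [simp]: "dim_row Y = n" "dim_col Y = n" using Y by auto
  have *: "Y + A * Y = 1\<^sub>m n" using Y(2) by (simp add: mat_ring)
  have "Y = 1\<^sub>m n - A * Y"
  proof (rule eq_matI)
    fix i j assume "i < dim_row (1\<^sub>m n - A * Y)" "j < dim_col (1\<^sub>m n - A * Y)"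
    then show "Y $$ (i, j) = (1\<^sub>m n - A * Y) $$ (i, j)"
      using arg_cong[OF *, of "\<lambda>M. M $$ (i, j)"] by (simp del: index_mult_mat(1) index_one_mat(1))
  qed simp_all
  then have "frob_norm Y = frob_norm (1\<^sub>m n - A * Y)" by simp
  also have "\<dots> \<le> frob_norm (1\<^sub>m n) + frob_norm (A * Y)" by (rule frob_norm_triangle_diff) simp_all
  also have "frob_norm (A * Y) \<le> frob_norm A * frob_norm Y" by (rule frob_norm_mult) simp
  also have "frob_norm A * frob_norm Y \<le> 1 / 2 * frob_norm Y" by (rule mult_right_mono[OF small]) simp
  finally have "frob_norm Y \<le> 2 * sqrt (real n)" by (simp add: frob_norm_one)
  then show ?thesis using that Y by blast
qed

text \<open>Because \<open>W * (G * W) = W\<close>, the matrix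
  \<open>(1\<^sub>m n + (V - W) * G) * W\<close> equals \<open>V * (G * W)\<close>. So the
  invertible left factor carries the range of \<open>W\<close> into that of \<open>V\<close>, and
  its inverse \<open>Y\<close> carries \<open>V * (G * W)\<close> back to \<open>W\<close>.\<close>

lemma perturbed_range:
  assumes W: "W \<in> carrier_mat n m" and G: "G \<in> carrier_mat m n" "W * (G * W) = W"
    and V: "V \<in> carrier_mat n m" and small: "frob_norm (V - W) * frob_norm G \<le> 1 / 2"
  obtains Y where "Y \<in> carrier_mat n n" "(1\<^sub>m n + (V - W) * G) * Y = 1\<^sub>m n"
    "Y * (V * (G * W)) = W" "Y * ((1\<^sub>m n + (V - W) * G) * W) = W" "frob_norm Y \<le> 2 * sqrt (real n)"
proof -
  have [simp]: "dim_row W = n" "dim_col W = m" "dim_row G = m" "dim_col G = n"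
    "dim_row V = n" "dim_col V = m" using W G V by auto
  have "frob_norm ((V - W) * G) \<le> 1 / 2"
    by (rule order_trans[OF frob_norm_mult small]) simp
  moreover have "(V - W) * G \<in> carrier_mat n n" by (rule carrier_matI) simp_all
  ultimately obtain Y where Y: "Y \<in> carrier_mat n n" "(1\<^sub>m n + (V - W) * G) * Y = 1\<^sub>m n"
      "Y * (1\<^sub>m n + (V - W) * G) = 1\<^sub>m n" "frob_norm Y \<le> 2 * sqrt (real n)"
    using one_plus_small_inverse by blast
  have [simp]: "dim_row Y = n" "dim_col Y = n" using Y by auto
  have YW: "Y * ((1\<^sub>m n + (V - W) * G) * W) = W"
    using mat_mult_cancel_mid[OF Y(3), of W] by (simp add: mat_mult_one_left)
  have "(1\<^sub>m n + (V - W) * G) * W = W + (V * (G * W) - W)" by (simp add: mat_ring G(2))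
  also have "\<dots> = V * (G * W)" by (rule eq_matI) (simp_all del: index_mult_mat(1))
  finally have eq: "(1\<^sub>m n + (V - W) * G) * W = V * (G * W)" .
  show ?thesis by (rule that[OF Y(1,2) YW[unfolded eq] YW Y(4)])
qed

text \<open>For \<open>V\<close> near \<open>W\<close>, \<open>W\<close> is recovered as
  \<open>Y * (V * (G * W))\<close>, a product that contains \<open>V\<close> as a factor.\<close>

lemma rank_lower_semicontinuous:
  assumes W: "W \<in> carrier_mat n m"
  obtains \<delta> where "\<delta> > 0"
    "\<And>V. V \<in> carrier_mat n m \<Longrightarrow> frob_dist V W < \<delta> \<Longrightarrow> vec_space.rank n W \<le> vec_space.rank n V"
proof -
  obtain G where G: "G \<in> carrier_mat m n" "W * (G * W) = W" using generalized_inverse[OF W] .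
  have [simp]: "dim_row W = n" "dim_col W = m" "dim_row G = m" "dim_col G = n" using W G by auto
  have G1: "frob_norm G + 1 > 0" using frob_norm_nonneg[of G] by linarith
  \<comment> \<open>Makes |V - W| |G| at most 1/2; the added 1 keeps the quotient positive even for
    G = 0.\<close>
  define \<delta> where "\<delta> = 1 / (2 * (frob_norm G + 1))"
  have "\<delta> > 0" using G1 by (simp add: \<delta>_def)
  moreover have "vec_space.rank n W \<le> vec_space.rank n V"
    if V: "V \<in> carrier_mat n m" and d: "frob_dist V W < \<delta>" for V
  proof -
    have [simp]: "dim_row V = n" "dim_col V = m" using V by auto
    have "frob_norm (V - W) * frob_norm G \<le> \<delta> * (frob_norm G + 1)"
      using d \<open>\<delta> > 0\<close> by (intro mult_mono) (auto simp: frob_dist_def)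
    also have "\<dots> = 1 / 2" using G1 by (simp add: \<delta>_def)
    finally obtain Y where Y: "Y \<in> carrier_mat n n" "Y * (V * (G * W)) = W"
      using perturbed_range[OF W G V] by metis
    have [simp]: "dim_row Y = n" "dim_col Y = n" using Y by auto
    have "W = Y * (V * (G * W))" using Y(2) by simp
    then have "vec_space.rank n W = vec_space.rank n (Y * (V * (G * W)))" by simp
    also have "\<dots> \<le> vec_space.rank n (V * (G * W))"
      by (rule rank_mult_le_right[OF Y(1), of _ m]) (simp add: carrier_matI)
    also have "\<dots> \<le> vec_space.rank n V"
      by (rule rank_mult_le_left[OF V, of _ m]) (simp add: carrier_matI)
    finally show ?thesis .
  qed
  ultimately show ?thesis using that by blast
qed

text \<open>With a generalized inverse \<open>G\<close> of \<open>W\<close>, take \<open>A = (V - W) G\<close>; then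
  \<open>U = (1 + A)\<^sup>-\<^sup>1 V\<close> has the same range as \<open>W\<close>.\<close>

lemma fixed_rank_orbit:
  assumes W: "W \<in> fixed_rank n m k"
  obtains \<delta> C where "\<delta> > 0" "C \<ge> 0"
    "\<And>V. V \<in> fixed_rank n m k \<Longrightarrow> frob_dist V W < \<delta> \<Longrightarrow>
       \<exists>A\<in>carrier_mat n n. \<exists>B\<in>carrier_mat m m. V = (1\<^sub>m n + A) * W * (1\<^sub>m m + B) \<and>
         frob_norm A + frob_norm B \<le> C * frob_dist V W"
proof -
  have WC: "W \<in> carrier_mat n m" and Wk: "vec_space.rank n W = k" using W by (auto simp: fixed_rank_def)
  obtain G where G: "G \<in> carrier_mat m n" "W * (G * W) = W" using generalized_inverse[OF WC] .
  have [simp]: "dim_row W = n" "dim_col W = m" "dim_row G = m" "dim_col G = n" using WC G by auto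
  define c where "c = frob_norm G"
  have c: "c \<ge> 0" by (simp add: c_def)
  define \<delta> where "\<delta> = 1 / (2 * (c + 1))"
  define s where "s = 2 * sqrt (real n)"
  have s: "s \<ge> 0" by (simp add: s_def)
  \<comment> \<open>The first summand bounds \<open>A = (V - W) * G\<close>; the second bounds
    \<open>B = G * (U - W)\<close>, using |U - W| \<le> s (1 + c |W|) |V - W|.\<close>
  define C where "C = c + c * (s * (1 + c * frob_norm W))"
  have "\<delta> > 0" using c by (simp add: \<delta>_def)
  moreover have "C \<ge> 0" using c s by (simp add: C_def)
  moreover have "\<exists>A\<in>carrier_mat n n. \<exists>B\<in>carrier_mat m m. V = (1\<^sub>m n + A) * W * (1\<^sub>m m + B) \<and>
         frob_norm A + frob_norm B \<le> C * frob_dist V W"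
    if V: "V \<in> fixed_rank n m k" and d: "frob_dist V W < \<delta>" for V
  proof -
    have VC: "V \<in> carrier_mat n m" and Vk: "vec_space.rank n V = k" using V by (auto simp: fixed_rank_def)
    have [simp]: "dim_row V = n" "dim_col V = m" using VC by auto
    have "frob_norm (V - W) * frob_norm G \<le> \<delta> * (c + 1)"
      using d \<open>\<delta> > 0\<close> by (intro mult_mono) (auto simp: frob_dist_def c_def)
    also have "\<dots> = 1 / 2" using c by (simp add: \<delta>_def)
    finally obtain Y where Y: "Y \<in> carrier_mat n n" "(1\<^sub>m n + (V - W) * G) * Y = 1\<^sub>m n"
      "Y * (V * (G * W)) = W" "Y * ((1\<^sub>m n + (V - W) * G) * W) = W" "frob_norm Y \<le> s"
      using perturbed_range[OF WC G VC] unfolding s_def by metis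
    have [simp]: "dim_row Y = n" "dim_col Y = n" using Y by auto
    define A where "A = (V - W) * G"
    have [simp]: "dim_row A = n" "dim_col A = n" by (simp_all add: A_def)
    define U where "U = Y * V"
    have [simp]: "dim_row U = n" "dim_col U = m" by (simp_all add: U_def)
    have UP: "U * (G * W) = W" using Y(3) by (simp add: U_def mat_mult_assoc)
    have "vec_space.rank n U \<le> k"
      unfolding U_def using rank_mult_le_right[OF Y(1) VC] Vk by simp
    \<comment> \<open>The range of \<open>W = U * (G * W)\<close> lies in that of \<open>U\<close>,
      and the ranks agree, so \<open>U\<close> factors as \<open>W * X\<close>.\<close>
    then have "vec_space.rank n U \<le> vec_space.rank n (U * (G * W))" by (simp add: UP Wk)
    moreover have "U \<in> carrier_mat n m" "G * W \<in> carrier_mat m m" by (rule carrier_matI; simp)+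
    ultimately obtain X where X: "X \<in> carrier_mat m m" "U = W * X"
      using range_eq_factor[of U n m "G * W" m] unfolding UP by blast
    have [simp]: "dim_row X = m" "dim_col X = m" using X by auto
    have WGU: "W * (G * U) = U"
      unfolding X(2) using mat_mult_cancel_mid[of "W" "G * W" W X] G(2) by (simp add: mat_mult_assoc)
    \<comment> \<open>\<open>W * G\<close> acts as the identity on the range of \<open>W\<close>,
      which contains that of \<open>U\<close>; therefore \<open>W * B = U - W\<close>.\<close>
    define B where "B = G * (U - W)"
    have [simp]: "dim_row B = m" "dim_col B = m" by (simp_all add: B_def)
    have "W * (1\<^sub>m m + B) = W + (U - W)"
      by (simp add: B_def mat_ring WGU G(2))
    also have "\<dots> = U" by (rule eq_matI) simp_all
    finally have WB: "W * (1\<^sub>m m + B) = U" .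
    have "(1\<^sub>m n + A) * W * (1\<^sub>m m + B) = (1\<^sub>m n + A) * U"
      by (subst mat_mult_assoc) (simp_all add: WB)
    also have "\<dots> = V"
      unfolding U_def A_def using mat_mult_cancel_mid[OF Y(2), of V] by (simp add: mat_mult_one_left)
    finally have eq: "V = (1\<^sub>m n + A) * W * (1\<^sub>m m + B)" by simp
    let ?d = "frob_dist V W"
    have d0: "?d \<ge> 0" by (simp add: frob_dist_def)
    have nA: "frob_norm A \<le> ?d * c"
      unfolding A_def frob_dist_def c_def by (rule frob_norm_mult) simp
    \<comment> \<open>Since \<open>Y\<close> undoes the factor \<open>1\<^sub>m n + A\<close>,
      \<open>W\<close> can be written as \<open>Y * ((1\<^sub>m n + A) * W)\<close>. This shows that
      U - W is linear in the displacement although \<open>Y\<close> is only bounded.\<close>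
    have "U - W = Y * ((V - W) - A * W)"
    proof -
      have "Y * ((V - W) - A * W) = Y * (V - (W + A * W))"
        by (rule arg_cong[of _ _ "\<lambda>X. Y * X"], rule eq_matI) (simp_all del: index_mult_mat(1))
      also have "W + A * W = (1\<^sub>m n + A) * W" by (simp add: mat_ring)
      also have "Y * (V - (1\<^sub>m n + A) * W) = U - W"
        using Y(4) by (simp add: mat_mult_diff_right U_def A_def)
      finally show ?thesis by simp
    qed
    then have "frob_norm (U - W) \<le> frob_norm Y * frob_norm ((V - W) - A * W)"
      using frob_norm_mult[of Y "(V - W) - A * W"] by simp
    also have "\<dots> \<le> s * (?d + ?d * c * frob_norm W)"
    proof (rule mult_mono[OF Y(5)])
      have "frob_norm ((V - W) - A * W) \<le> frob_norm (V - W) + frob_norm (A * W)"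
        by (rule frob_norm_triangle_diff) simp_all
      also have "frob_norm (A * W) \<le> frob_norm A * frob_norm W" by (rule frob_norm_mult) simp
      also have "\<dots> \<le> ?d * c * frob_norm W" by (rule mult_right_mono[OF nA]) simp
      finally show "frob_norm ((V - W) - A * W) \<le> ?d + ?d * c * frob_norm W" by (simp add: frob_dist_def)
    qed (simp_all add: s)
    finally have UW: "frob_norm (U - W) \<le> s * (?d + ?d * c * frob_norm W)" .
    have "frob_norm B \<le> c * frob_norm (U - W)" unfolding B_def c_def by (rule frob_norm_mult) simp
    also have "\<dots> \<le> c * (s * (?d + ?d * c * frob_norm W))" by (rule mult_left_mono[OF UW c])
    finally have "frob_norm A + frob_norm B \<le> C * ?d" using nA by (simp add: C_def algebra_simps)
    with eq show ?thesis by (intro bexI[of _ A] bexI[of _ B] conjI carrier_matI) simp_all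
  qed
  ultimately show ?thesis using that by blast
qed

subsection \<open>The Bures--Wasserstein loss\<close>

text \<open>Positive definiteness in the form in which it is consumed: the arguments below multiply
  by inverses instead of testing strict positivity on vectors.\<close>

definition pos_inv :: "nat \<Rightarrow> real mat \<Rightarrow> bool" where
  "pos_inv n S \<longleftrightarrow> pos_semidef n S \<and> (\<exists>R\<in>carrier_mat n n. S * R = 1\<^sub>m n)"

lemma pos_inv_orth_diag:
  assumes E: "orth n E" and f: "\<And>i. i < n \<Longrightarrow> 0 < f i"
  shows "pos_inv n (E * mat_diag n f * E\<^sup>T)"
proof -
  have [simp]: "dim_row E = n" "dim_col E = n" using E by (auto simp: orth_def)
  have "pos_semidef n (E * mat_diag n f * E\<^sup>T)"
    by (rule pos_semidef_orth_diag[OF E]) (simp add: f less_imp_le)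
  moreover have "(E * mat_diag n f * E\<^sup>T) * (E * mat_diag n (\<lambda>i. 1 / f i) * E\<^sup>T) = 1\<^sub>m n"
  proof -
    have "mat_diag n (\<lambda>i. f i * (1 / f i)) = 1\<^sub>m n"
      by (rule eq_matI) (auto simp: mat_diag_def dest: f)
    then show ?thesis unfolding orth_diag_mult[OF E] using E by (simp add: orth_def)
  qed
  moreover have "E * mat_diag n (\<lambda>i. 1 / f i) * E\<^sup>T \<in> carrier_mat n n"
    by (rule carrier_matI) simp_all
  ultimately show ?thesis unfolding pos_inv_def by blast
qed

text \<open>With Q the root and Z the inverse of \<open>A\<close>, take R = Q Z. Left and right
  inverses coincide, so R is symmetric, and then R = \<open>R\<^sup>T * Q * R\<close> is congruent
  to Q and hence positive semidefinite.\<close>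

lemma pos_inv_sqrt:
  assumes A: "pos_inv n A"
  obtains R where "pos_semidef n R" "mat_sqrt n A * R = 1\<^sub>m n" "R * mat_sqrt n A = 1\<^sub>m n"
proof -
  define Q where "Q = mat_sqrt n A"
  have Q: "pos_semidef n Q" "Q * Q = A" using mat_sqrt[of n A] A by (auto simp: pos_inv_def Q_def)
  have QC: "Q \<in> carrier_mat n n" and QT: "Q\<^sup>T = Q" using Q by (auto simp: pos_semidef_def)
  have [simp]: "dim_row Q = n" "dim_col Q = n" using QC by auto
  obtain Z where Z: "Z \<in> carrier_mat n n" "A * Z = 1\<^sub>m n" using A by (auto simp: pos_inv_def)
  have [simp]: "dim_row Z = n" "dim_col Z = n" using Z by auto
  define R where "R = Q * Z"
  have RC: "R \<in> carrier_mat n n" unfolding R_def by (rule carrier_matI) simp_all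
  have [simp]: "dim_row R = n" "dim_col R = n" using RC by auto
  have QR: "Q * R = 1\<^sub>m n" unfolding R_def Z(2)[symmetric] Q(2)[symmetric] by (simp add: mat_mult_assoc)
  have RQ: "R * Q = 1\<^sub>m n" by (rule mat_mult_left_right_inverse[OF QC RC QR])
  have "(Q * R)\<^sup>T = 1\<^sub>m n" unfolding QR by simp
  then have RTQ: "R\<^sup>T * Q = 1\<^sub>m n" by (simp add: mat_transpose_mult QT)
  have "R\<^sup>T * (Q * R) = R" using mat_mult_cancel_mid[OF RTQ, of R] by (simp add: mat_mult_one_left)
  then have RT: "R\<^sup>T = R" unfolding QR by (simp add: mat_mult_one_right)
  have "R\<^sup>T * Q * R = R" unfolding RTQ by (simp add: mat_mult_one_left)
  then have "pos_semidef n R" using pos_semidef_congruence[OF Q(1) RC] by simp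
  then show ?thesis using that QR RQ by (simp add: Q_def)
qed

locale bures_target =
  fixes n :: nat and \<Omega> \<Sigma>0 :: "real mat" and lam :: "nat \<Rightarrow> real"
  assumes orth_Omega: "orth n \<Omega>"
    and Sigma0_eq: "\<Sigma>0 = \<Omega> * mat_diag n lam * \<Omega>\<^sup>T"
    and lam_pos: "\<And>i. i < n \<Longrightarrow> 0 < lam i"
begin

text \<open>The principal root of \<open>\<Sigma>0\<close>, written in its eigenbasis so that traces
  become explicit sums over eigenvalues; \<open>mat_sqrt_Sigma0\<close> identifies the two.\<close>

definition "P = \<Omega> * mat_diag n (\<lambda>i. sqrt (lam i)) * \<Omega>\<^sup>T"

text \<open>The squared Bures-Wasserstein distance between \<open>S\<close> and
  \<open>\<Sigma>0\<close>, as a function of the covariance and not of its factor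
  \<open>W\<close>.\<close>

definition "bures S = mat_trace S + mat_trace \<Sigma>0 - 2 * mat_trace (mat_sqrt n (P * S * P))"

lemma Omega_dims [simp]: "dim_row \<Omega> = n" "dim_col \<Omega> = n"
  using orth_Omega by (auto simp: orth_def)

lemma Omega_cancel: "\<Omega>\<^sup>T * \<Omega> = 1\<^sub>m n" "\<Omega> * \<Omega>\<^sup>T = 1\<^sub>m n"
  using orth_Omega by (auto simp: orth_def)

lemma P_dims [simp]: "dim_row P = n" "dim_col P = n"
  by (simp_all add: P_def)

lemma Sigma0_dims [simp]: "dim_row \<Sigma>0 = n" "dim_col \<Sigma>0 = n"
  by (simp_all add: Sigma0_eq)

lemma P_carrier: "P \<in> carrier_mat n n"
  by (rule carrier_matI) simp_all

lemma P_pos_inv: "pos_inv n P"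
  unfolding P_def by (rule pos_inv_orth_diag[OF orth_Omega]) (simp add: lam_pos)

lemma P_sym: "P\<^sup>T = P"
  using P_pos_inv by (auto simp: pos_inv_def pos_semidef_def)

lemma P_mult_P: "P * P = \<Sigma>0"
proof -
  have "mat_diag n (\<lambda>i. sqrt (lam i) * sqrt (lam i)) = mat_diag n lam"
    by (rule eq_matI) (auto simp: mat_diag_def dest: lam_pos)
  then show ?thesis unfolding P_def orth_diag_mult[OF orth_Omega] by (simp add: Sigma0_eq)
qed

lemma mat_sqrt_Sigma0: "mat_sqrt n \<Sigma>0 = P"
  using P_pos_inv P_mult_P by (intro mat_sqrt_eq) (auto simp: pos_inv_def)

lemma trace_Sigma0: "mat_trace \<Sigma>0 = (\<Sum>i<n. lam i)"
  unfolding Sigma0_eq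
  by (subst mat_trace_comm) (simp_all add: mat_mult_assoc[symmetric] Omega_cancel mat_mult_one_left mat_trace_mat_diag)

lemma pos_inv_PSP:
  assumes S: "pos_inv n S"
  shows "pos_inv n (P * S * P)"
proof -
  obtain R where R: "R \<in> carrier_mat n n" "S * R = 1\<^sub>m n" and Sp: "pos_semidef n S"
    using S by (auto simp: pos_inv_def)
  obtain Z where Z: "Z \<in> carrier_mat n n" "P * Z = 1\<^sub>m n"
    using P_pos_inv by (auto simp: pos_inv_def)
  have [simp]: "dim_row R = n" "dim_col R = n" "dim_row Z = n" "dim_col Z = n" "dim_row S = n" "dim_col S = n"
    using R Z Sp by (auto simp: pos_semidef_def)
  have "(P * S * P) * (Z * R * Z) = P * (S * ((P * Z) * (R * Z)))" by (simp add: mat_mult_assoc)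
  also have "\<dots> = P * ((S * R) * Z)" unfolding Z(2) by (simp add: mat_mult_assoc mat_mult_one_left)
  also have "\<dots> = 1\<^sub>m n" unfolding R(2) by (simp add: mat_mult_one_left Z(2))
  finally have "(P * S * P) * (Z * R * Z) = 1\<^sub>m n" .
  moreover have "Z * R * Z \<in> carrier_mat n n" by (rule carrier_matI) simp_all
  moreover have "pos_semidef n (P * S * P)"
    using pos_semidef_congruence[OF Sp P_carrier] by (simp add: P_sym)
  ultimately show ?thesis unfolding pos_inv_def by blast
qed

text \<open>\<open>T\<close> is the optimal transport map from \<open>S\<close> to \<open>\<Sigma>0\<close>. The affine minorant of the loss
  touching it at \<open>S\<close> comes from \<open>tr ((Q' - Q) Q\<^sup>-\<^sup>1 (Q' - Q)) \<ge> 0\<close>, where \<open>Q\<close> and \<open>Q'\<close> are the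
  square roots attached to \<open>S\<close> and \<open>S'\<close>.\<close>

lemma bures_minorant:
  assumes S: "pos_inv n S"
  obtains T where "T \<in> carrier_mat n n" "T\<^sup>T = T" "T * S * T = \<Sigma>0"
    "\<And>S'. pos_inv n S' \<Longrightarrow>
       (mat_trace S' - mat_trace (T * S')) - (mat_trace S - mat_trace (T * S)) \<le> bures S' - bures S"
proof -
  define Q where "Q = mat_sqrt n (P * S * P)"
  have Q: "pos_semidef n Q" "Q * Q = P * S * P"
    using mat_sqrt[of n "P * S * P"] pos_inv_PSP[OF S] by (auto simp: pos_inv_def Q_def)
  obtain R where R: "pos_semidef n R" "Q * R = 1\<^sub>m n" "R * Q = 1\<^sub>m n"
    using pos_inv_sqrt[OF pos_inv_PSP[OF S]] unfolding Q_def by metis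
  have [simp]: "dim_row S = n" "dim_col S = n" "dim_row Q = n" "dim_col Q = n" "dim_row R = n" "dim_col R = n"
    using S Q R by (auto simp: pos_semidef_def pos_inv_def)
  have QT: "Q\<^sup>T = Q" and RT: "R\<^sup>T = R" using Q R by (auto simp: pos_semidef_def)
  \<comment> \<open>As R inverts the root Q of P S P, the product T S T collapses to P R Q Q R P = P
    P.\<close>
  define T where "T = P * R * P"
  have [simp]: "dim_row T = n" "dim_col T = n" by (simp_all add: T_def)
  have TT: "T\<^sup>T = T" by (simp add: T_def mat_transpose_mult P_sym RT mat_mult_assoc)
  have "T * S * T = P * (R * ((P * S * P) * (R * P)))" by (simp add: T_def mat_mult_assoc)
  also have "\<dots> = P * ((R * Q) * ((Q * R) * P))" unfolding Q(2)[symmetric] by (simp add: mat_mult_assoc)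
  also have "\<dots> = \<Sigma>0" unfolding R(2,3) by (simp add: mat_mult_one_left P_mult_P)
  finally have TST: "T * S * T = \<Sigma>0" .
  have tr_T: "mat_trace (T * S') = mat_trace (R * (P * S' * P))" if "dim_row S' = n" "dim_col S' = n" for S'
  proof -
    have "T * S' = P * (R * (P * S'))" using that by (simp add: T_def mat_mult_assoc)
    then show ?thesis using mat_trace_comm[of P "R * (P * S')"] that by (simp add: mat_mult_assoc)
  qed
  \<comment> \<open>This is the equality case, by which the affine minorant touches the loss at
    \<open>S\<close>.\<close>
  have trS: "mat_trace (T * S) = mat_trace Q"
    using R(3) by (simp add: tr_T Q(2)[symmetric] mat_mult_assoc[symmetric] mat_mult_one_left)
  have main: "2 * mat_trace (mat_sqrt n (P * S' * P)) \<le> mat_trace (T * S') + mat_trace Q"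
    if S': "pos_inv n S'" for S'
  proof -
    define Q' where "Q' = mat_sqrt n (P * S' * P)"
    have Q': "pos_semidef n Q'" "Q' * Q' = P * S' * P"
      using mat_sqrt[of n "P * S' * P"] pos_inv_PSP[OF S'] by (auto simp: pos_inv_def Q'_def)
    have [simp]: "dim_row Q' = n" "dim_col Q' = n" "dim_row S' = n" "dim_col S' = n"
      using Q' S' by (auto simp: pos_semidef_def pos_inv_def)
    have QT': "Q'\<^sup>T = Q'" using Q' by (auto simp: pos_semidef_def)
    have DC: "Q' - Q \<in> carrier_mat n n" by (rule carrier_matI) simp_all
    have DT: "(Q' - Q)\<^sup>T = Q' - Q" by (simp add: mat_transpose_diff QT QT')
    have "0 \<le> mat_trace ((Q' - Q)\<^sup>T * R * (Q' - Q))"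
      by (rule pos_semidef_trace_nonneg[OF pos_semidef_congruence[OF R(1) DC]])
    also have "(Q' - Q)\<^sup>T * R * (Q' - Q) = (Q' * (R * Q') - Q * (R * Q')) - (Q' * (R * Q) - Q * (R * Q))"
      unfolding DT by (simp add: mat_mult_assoc mat_mult_diff_left mat_mult_diff_right)
    also have "Q' * (R * Q) = Q'" unfolding R(3) by (simp add: mat_mult_one_right)
    also have "Q * (R * Q') = Q'"
      using mat_mult_cancel_mid[OF R(2), of Q'] by (simp add: mat_mult_one_left)
    also have "Q * (R * Q) = Q" unfolding R(3) by (simp add: mat_mult_one_right)
    also have "mat_trace ((Q' * (R * Q') - Q') - (Q' - Q)) = mat_trace (Q' * (R * Q')) - 2 * mat_trace Q' + mat_trace Q"
      by (simp add: mat_trace_diff)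
    also have "mat_trace (Q' * (R * Q')) = mat_trace (R * (Q' * Q'))"
      using mat_trace_comm[of Q' "R * Q'"] by (simp add: mat_mult_assoc)
    also have "\<dots> = mat_trace (T * S')" unfolding Q'(2) by (simp add: tr_T)
    finally show ?thesis by (simp add: Q'_def)
  qed
  show ?thesis
  proof (rule that[OF _ TT TST])
    show "T \<in> carrier_mat n n" by (rule carrier_matI) simp_all
    fix S' assume "pos_inv n S'"
    from main[OF this] show "(mat_trace S' - mat_trace (T * S')) - (mat_trace S - mat_trace (T * S))
        \<le> bures S' - bures S"
      unfolding trS bures_def Q_def by linarith
  qed
qed

text \<open>Multiplied by its own transpose, \<open>P * B\<close> gives P S P, the square of the
  root Q; so Q inverse times \<open>P * B\<close> is orthogonal.\<close>

lemma polar: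
  assumes S: "pos_inv n S" and B: "pos_semidef n B" "B * B = S"
  obtains U where "orth n U" "P * B = mat_sqrt n (P * S * P) * U"
proof -
  define Q where "Q = mat_sqrt n (P * S * P)"
  have Q: "pos_semidef n Q" "Q * Q = P * S * P"
    using mat_sqrt[of n "P * S * P"] pos_inv_PSP[OF S] by (auto simp: pos_inv_def Q_def)
  obtain R where R: "pos_semidef n R" "Q * R = 1\<^sub>m n" "R * Q = 1\<^sub>m n"
    using pos_inv_sqrt[OF pos_inv_PSP[OF S]] unfolding Q_def by metis
  have [simp]: "dim_row B = n" "dim_col B = n" "dim_row Q = n" "dim_col Q = n" "dim_row R = n" "dim_col R = n"
    using B Q R by (auto simp: pos_semidef_def)
  have RT: "R\<^sup>T = R" and BT: "B\<^sup>T = B" using R B by (auto simp: pos_semidef_def)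
  define U where "U = R * (P * B)"
  have [simp]: "dim_row U = n" "dim_col U = n" by (simp_all add: U_def)
  have "U * U\<^sup>T = R * ((P * (B * B) * P) * R)"
    by (simp add: U_def mat_transpose_mult RT BT P_sym mat_mult_assoc)
  also have "\<dots> = (R * Q) * (Q * R)" unfolding B(2) Q(2)[symmetric] by (simp add: mat_mult_assoc)
  also have "\<dots> = 1\<^sub>m n" unfolding R(2,3) by simp
  finally have "orth n (U\<^sup>T)" by (intro orthI) (simp_all add: carrier_matI)
  then have "orth n U" using orth_transpose[of n "U\<^sup>T"] by simp
  moreover have "P * B = Q * U"
    unfolding U_def using mat_mult_cancel_mid[OF R(2), of "P * B"] by (simp add: mat_mult_one_left)
  ultimately show ?thesis using that by (simp add: Q_def)
qed

text \<open>By polar decomposition the claim is tr (Q U) \<le> tr Q for orthogonal U and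
  semidefinite Q. The trace of the semidefinite matrix
  \<open>(1\<^sub>m n - U)\<^sup>T * Q * (1\<^sub>m n - U)\<close> is twice the difference.\<close>

lemma trace_P_mult_le:
  assumes S: "pos_inv n S" and B: "pos_semidef n B" "B * B = S"
  shows "mat_trace (P * B) \<le> mat_trace (mat_sqrt n (P * S * P))"
proof -
  define Q where "Q = mat_sqrt n (P * S * P)"
  have Q: "pos_semidef n Q"
    using mat_sqrt[of n "P * S * P"] pos_inv_PSP[OF S] by (auto simp: pos_inv_def Q_def)
  have QT: "Q\<^sup>T = Q" and [simp]: "dim_row Q = n" "dim_col Q = n" using Q by (auto simp: pos_semidef_def)
  obtain U where U: "orth n U" "P * B = Q * U" using polar[OF assms] unfolding Q_def .
  have [simp]: "dim_row U = n" "dim_col U = n" and UU: "U * U\<^sup>T = 1\<^sub>m n" using U by (auto simp: orth_def)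
  have "1\<^sub>m n - U \<in> carrier_mat n n" by (rule carrier_matI) simp_all
  from pos_semidef_trace_nonneg[OF pos_semidef_congruence[OF Q this]]
  have "0 \<le> mat_trace ((1\<^sub>m n - U)\<^sup>T * Q * (1\<^sub>m n - U))" .
  also have "(1\<^sub>m n - U)\<^sup>T * Q * (1\<^sub>m n - U) = (Q - U\<^sup>T * Q) - (Q * U - U\<^sup>T * (Q * U))"
    by (simp add: mat_transpose_diff mat_mult_assoc mat_mult_diff_left mat_mult_diff_right mat_mult_one_left mat_mult_one_right)
  also have "mat_trace \<dots> = mat_trace Q - mat_trace (Q * U) - mat_trace (U\<^sup>T * Q) + mat_trace (U\<^sup>T * (Q * U))"
    by (simp add: mat_trace_diff)
  also have "mat_trace (U\<^sup>T * Q) = mat_trace (Q * U)"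
    using mat_trace_transpose[of "Q * U"] by (simp add: mat_transpose_mult QT)
  also have "mat_trace (U\<^sup>T * (Q * U)) = mat_trace Q"
    using mat_trace_comm[of "U\<^sup>T" "Q * U"] by (simp add: mat_mult_assoc UU mat_mult_one_right)
  finally show ?thesis unfolding U(2) Q_def[symmetric] by simp
qed

section \<open>Spectral formulas and bounds for the loss\<close>

lemma trace_diag_mult:
  assumes "G \<in> carrier_mat n n" "H \<in> carrier_mat n n"
  shows "mat_trace (mat_diag n f * (G * (mat_diag n g * H)))
    = (\<Sum>i<n. \<Sum>j<n. f i * g j * (G $$ (i, j) * H $$ (j, i)))"
proof -
  have [simp]: "dim_row G = n" "dim_col G = n" "dim_row H = n" "dim_col H = n" using assms by auto
  have fG: "mat_diag n f * G = mat n n (\<lambda>(i, j). f i * G $$ (i, j))"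
    by (rule mat_diag_mult_left[OF assms(1)])
  have gH: "mat_diag n g * H = mat n n (\<lambda>(i, j). g i * H $$ (i, j))"
    by (rule mat_diag_mult_left[OF assms(2)])
  have "mat_trace (mat_diag n f * (G * (mat_diag n g * H))) = mat_trace ((mat_diag n f * G) * (mat_diag n g * H))"
    by (simp add: mat_mult_assoc)
  also have "\<dots> = (\<Sum>i<n. \<Sum>j<n. (f i * G $$ (i, j)) * (g j * H $$ (j, i)))"
    unfolding fG gH by (subst mat_trace_mult) (auto intro!: sum.cong)
  finally show ?thesis by (simp add: mult_ac)
qed

text \<open>Expanding each factor in its own eigenbasis makes the trace bilinear in the two spectra.
  \<open>K\<close> is later the identity for the upper bound on the loss and an orthogonal factor
  for the lower one.\<close>

lemma trace_P_orth_diag: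
  assumes E: "orth n E" and K: "K \<in> carrier_mat n n"
  shows "mat_trace (P * (E * mat_diag n g * E\<^sup>T) * K) =
    (\<Sum>i<n. \<Sum>j<n. sqrt (lam i) * g j * ((\<Omega>\<^sup>T * E) $$ (i, j) * (E\<^sup>T * K * \<Omega>) $$ (j, i)))"
proof -
  have [simp]: "dim_row E = n" "dim_col E = n" "dim_row K = n" "dim_col K = n"
    using E K by (auto simp: orth_def)
  have "mat_trace (P * (E * mat_diag n g * E\<^sup>T) * K) =
    mat_trace (\<Omega> * (mat_diag n (\<lambda>i. sqrt (lam i)) * (\<Omega>\<^sup>T * (E * (mat_diag n g * (E\<^sup>T * K))))))"
    by (simp add: P_def mat_mult_assoc)
  also have "\<dots> = mat_trace (mat_diag n (\<lambda>i. sqrt (lam i)) * ((\<Omega>\<^sup>T * E) * (mat_diag n g * (E\<^sup>T * K * \<Omega>))))"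
    by (subst mat_trace_comm) (simp_all add: mat_mult_assoc)
  also have "\<dots> = (\<Sum>i<n. \<Sum>j<n. sqrt (lam i) * g j * ((\<Omega>\<^sup>T * E) $$ (i, j) * (E\<^sup>T * K * \<Omega>) $$ (j, i)))"
    by (rule trace_diag_mult; rule carrier_matI; simp)
  finally show ?thesis .
qed

lemma orth_sum_squares:
  assumes G: "orth k G"
  shows "i < k \<Longrightarrow> (\<Sum>j<k. (G $$ (i, j))\<^sup>2) = 1" "j < k \<Longrightarrow> (\<Sum>i<k. (G $$ (i, j))\<^sup>2) = 1"
proof -
  have [simp]: "dim_row G = k" "dim_col G = k" and GG: "G * G\<^sup>T = 1\<^sub>m k" "G\<^sup>T * G = 1\<^sub>m k"
    using G by (auto simp: orth_def)
  show "(\<Sum>j<k. (G $$ (i, j))\<^sup>2) = 1" if i: "i < k"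
  proof -
    have "(\<Sum>j<k. (G $$ (i, j))\<^sup>2) = (G * G\<^sup>T) $$ (i, i)"
      using i by (subst mat_mult_index) (auto simp: power2_eq_square intro!: sum.cong)
    then show ?thesis unfolding GG using i by simp
  qed
  show "(\<Sum>i<k. (G $$ (i, j))\<^sup>2) = 1" if j: "j < k"
  proof -
    have "(\<Sum>i<k. (G $$ (i, j))\<^sup>2) = (G\<^sup>T * G) $$ (j, j)"
      using j by (subst mat_mult_index) (auto simp: power2_eq_square intro!: sum.cong)
    then show ?thesis unfolding GG using j by simp
  qed
qed

lemma sqrt_orth_diag:
  assumes E: "orth n E" and s: "\<And>i. i < n \<Longrightarrow> 0 < s i"
  shows "pos_semidef n (E * mat_diag n (\<lambda>i. sqrt (s i)) * E\<^sup>T)"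
    "(E * mat_diag n (\<lambda>i. sqrt (s i)) * E\<^sup>T) * (E * mat_diag n (\<lambda>i. sqrt (s i)) * E\<^sup>T) = E * mat_diag n s * E\<^sup>T"
proof -
  show "pos_semidef n (E * mat_diag n (\<lambda>i. sqrt (s i)) * E\<^sup>T)"
    by (rule pos_semidef_orth_diag[OF E]) (simp add: s less_imp_le)
  have "mat_diag n (\<lambda>i. sqrt (s i) * sqrt (s i)) = mat_diag n s"
    by (rule eq_matI) (auto simp: mat_diag_def dest: s)
  then show "(E * mat_diag n (\<lambda>i. sqrt (s i)) * E\<^sup>T) * (E * mat_diag n (\<lambda>i. sqrt (s i)) * E\<^sup>T) = E * mat_diag n s * E\<^sup>T"
    unfolding orth_diag_mult[OF E] by simp
qed

lemma trace_orth_diag: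
  assumes E: "orth n E"
  shows "mat_trace (E * mat_diag n s * E\<^sup>T) = (\<Sum>i<n. s i)"
proof -
  have [simp]: "dim_row E = n" "dim_col E = n" and EE: "E\<^sup>T * E = 1\<^sub>m n"
    using E by (auto simp: orth_def)
  have "mat_trace (E * (mat_diag n s * E\<^sup>T)) = mat_trace (mat_diag n s * (E\<^sup>T * E))"
    by (subst mat_trace_comm) (simp_all add: mat_mult_assoc)
  then show ?thesis unfolding EE by (simp add: mat_mult_assoc mat_mult_one_right mat_trace_mat_diag)
qed

text \<open>The principal root B of the argument gives tr (P B) as a lower bound for the trace that
  enters the loss negatively. It avoids computing the root of P S P when the eigenbases
  differ.\<close>

lemma bures_upper:
  assumes E: "orth n E" and s: "\<And>i. i < n \<Longrightarrow> 0 < s i"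
  shows "bures (E * mat_diag n s * E\<^sup>T) \<le> (\<Sum>i<n. s i) + (\<Sum>i<n. lam i)
    - 2 * (\<Sum>i<n. \<Sum>j<n. sqrt (lam i) * sqrt (s j) * ((\<Omega>\<^sup>T * E) $$ (i, j))\<^sup>2)"
proof -
  have [simp]: "dim_row E = n" "dim_col E = n" using E by (auto simp: orth_def)
  let ?B = "E * mat_diag n (\<lambda>i. sqrt (s i)) * E\<^sup>T"
  have "mat_trace (P * ?B) = mat_trace (P * ?B * 1\<^sub>m n)"
    by (simp add: mat_mult_one_right)
  also have "\<dots> = (\<Sum>i<n. \<Sum>j<n. sqrt (lam i) * sqrt (s j) * ((\<Omega>\<^sup>T * E) $$ (i, j) * (E\<^sup>T * 1\<^sub>m n * \<Omega>) $$ (j, i)))"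
    by (rule trace_P_orth_diag[OF E one_carrier_mat])
  also have "\<dots> = (\<Sum>i<n. \<Sum>j<n. sqrt (lam i) * sqrt (s j) * ((\<Omega>\<^sup>T * E) $$ (i, j))\<^sup>2)"
  proof (intro sum.cong refl)
    fix i j assume "i \<in> {..<n}" "j \<in> {..<n}"
    moreover have "E\<^sup>T * 1\<^sub>m n * \<Omega> = (\<Omega>\<^sup>T * E)\<^sup>T" by (simp add: mat_transpose_mult mat_mult_one_right)
    ultimately show "sqrt (lam i) * sqrt (s j) * ((\<Omega>\<^sup>T * E) $$ (i, j) * (E\<^sup>T * 1\<^sub>m n * \<Omega>) $$ (j, i)) =
      sqrt (lam i) * sqrt (s j) * ((\<Omega>\<^sup>T * E) $$ (i, j))\<^sup>2"
      by (simp add: power2_eq_square del: index_mult_mat(1))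
  qed
  finally have tr: "mat_trace (P * ?B) = (\<Sum>i<n. \<Sum>j<n. sqrt (lam i) * sqrt (s j) * ((\<Omega>\<^sup>T * E) $$ (i, j))\<^sup>2)" .
  have "mat_trace (P * ?B) \<le> mat_trace (mat_sqrt n (P * (E * mat_diag n s * E\<^sup>T) * P))"
    by (rule trace_P_mult_le[OF pos_inv_orth_diag[OF E] sqrt_orth_diag[OF E]]) (rule s, assumption)+
  then show ?thesis unfolding bures_def tr trace_Sigma0 trace_orth_diag[OF E] by simp
qed

text \<open>With a common eigenbasis the root of P S P is diagonal there too, and the loss is the
  squared Hellinger distance of the spectra.\<close>

lemma bures_commuting:
  assumes s: "\<And>i. i < n \<Longrightarrow> 0 < s i"
  shows "bures (\<Omega> * mat_diag n s * \<Omega>\<^sup>T) = (\<Sum>i<n. (sqrt (s i) - sqrt (lam i))\<^sup>2)"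
proof -
  let ?R = "\<Omega> * mat_diag n (\<lambda>i. sqrt (lam i * s i)) * \<Omega>\<^sup>T"
  have "P * (\<Omega> * mat_diag n s * \<Omega>\<^sup>T) * P = \<Omega> * mat_diag n (\<lambda>i. sqrt (lam i) * s i * sqrt (lam i)) * \<Omega>\<^sup>T"
    unfolding P_def orth_diag_mult[OF orth_Omega] ..
  also have "mat_diag n (\<lambda>i. sqrt (lam i) * s i * sqrt (lam i)) = mat_diag n (\<lambda>i. lam i * s i)"
    by (rule eq_matI) (auto simp: mat_diag_def dest: lam_pos)
  finally have "mat_sqrt n (P * (\<Omega> * mat_diag n s * \<Omega>\<^sup>T) * P) = ?R"
    using sqrt_orth_diag[OF orth_Omega, of "\<lambda>i. lam i * s i"] by (intro mat_sqrt_eq) (simp_all add: s lam_pos)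
  then have "bures (\<Omega> * mat_diag n s * \<Omega>\<^sup>T) = (\<Sum>i<n. s i) + (\<Sum>i<n. lam i) - 2 * (\<Sum>i<n. sqrt (lam i * s i))"
    by (simp add: bures_def trace_Sigma0 trace_orth_diag[OF orth_Omega])
  also have "\<dots> = (\<Sum>i<n. s i + lam i - 2 * sqrt (lam i * s i))"
    by (simp add: sum.distrib sum_subtractf sum_distrib_left)
  also have "\<dots> = (\<Sum>i<n. (sqrt (s i) - sqrt (lam i))\<^sup>2)"
    using lam_pos s by (intro sum.cong refl) (simp add: power2_diff less_imp_le real_sqrt_mult)
  finally show ?thesis .
qed

text \<open>Von Neumann's trace inequality in the form of a doubly stochastic coupling \<open>c\<close> of the spectra.\<close>

lemma bures_lower:
  assumes E: "orth n E" and s: "\<And>i. i < n \<Longrightarrow> 0 < s i"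
  obtains c :: "nat \<Rightarrow> nat \<Rightarrow> real" where "\<And>i j. 0 \<le> c i j"
    "\<And>i. i < n \<Longrightarrow> (\<Sum>j<n. c i j) = 1" "\<And>j. j < n \<Longrightarrow> (\<Sum>i<n. c i j) = 1"
    "(\<Sum>i<n. \<Sum>j<n. c i j * (sqrt (lam i) - sqrt (s j))\<^sup>2) \<le> bures (E * mat_diag n s * E\<^sup>T)"
proof -
  have [simp]: "dim_row E = n" "dim_col E = n" using E by (auto simp: orth_def)
  let ?S = "E * mat_diag n s * E\<^sup>T"
  let ?B = "E * mat_diag n (\<lambda>i. sqrt (s i)) * E\<^sup>T"
  have S: "pos_inv n ?S" by (rule pos_inv_orth_diag[OF E]) (rule s)
  define Q where "Q = mat_sqrt n (P * ?S * P)"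
  have Qp: "pos_semidef n Q"
    using mat_sqrt[of n "P * ?S * P"] pos_inv_PSP[OF S] by (auto simp: pos_inv_def Q_def)
  have [simp]: "dim_row Q = n" "dim_col Q = n" using Qp by (auto simp: pos_semidef_def)
  have "pos_semidef n ?B" "?B * ?B = ?S" using sqrt_orth_diag[OF E, of s] s by auto
  then obtain U where U: "orth n U" "P * ?B = Q * U" using polar[OF S] unfolding Q_def by blast
  have [simp]: "dim_row U = n" "dim_col U = n" and UU: "U * U\<^sup>T = 1\<^sub>m n" using U by (auto simp: orth_def)
  define G where "G = \<Omega>\<^sup>T * E"
  define H where "H = E\<^sup>T * U\<^sup>T * \<Omega>"
  have G: "orth n G" unfolding G_def by (intro orth_mult orth_transpose orth_Omega E)
  have H: "orth n H" unfolding H_def by (intro orth_mult orth_transpose orth_Omega E U(1))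
  \<comment> \<open>The squared entries of an orthogonal matrix are doubly stochastic, and so is the
    mean of two such arrays; by AM-GM this mean dominates the mixed products of entries in the
    trace.\<close>
  define c where "c i j = ((G $$ (i, j))\<^sup>2 + (H $$ (j, i))\<^sup>2) / 2" for i j
  have c0: "0 \<le> c i j" for i j by (simp add: c_def)
  have rows: "(\<Sum>j<n. c i j) = 1" if "i < n" for i
    using orth_sum_squares(1)[OF G that] orth_sum_squares(2)[OF H that]
    by (simp add: c_def sum_divide_distrib[symmetric] sum.distrib)
  have cols: "(\<Sum>i<n. c i j) = 1" if "j < n" for j
    using orth_sum_squares(2)[OF G that] orth_sum_squares(1)[OF H that]
    by (simp add: c_def sum_divide_distrib[symmetric] sum.distrib)
  have "Q = P * ?B * U\<^sup>T" unfolding U(2) by (simp add: mat_mult_assoc UU mat_mult_one_right)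
  then have "mat_trace Q = (\<Sum>i<n. \<Sum>j<n. sqrt (lam i) * sqrt (s j) * (G $$ (i, j) * H $$ (j, i)))"
    using trace_P_orth_diag[OF E, of "U\<^sup>T" "\<lambda>j. sqrt (s j)"] unfolding G_def H_def by (simp add: carrier_matI)
  also have "\<dots> \<le> (\<Sum>i<n. \<Sum>j<n. sqrt (lam i) * sqrt (s j) * c i j)"
  proof (intro sum_mono mult_left_mono)
    fix i j assume "i \<in> {..<n}" "j \<in> {..<n}"
    then show "0 \<le> sqrt (lam i) * sqrt (s j)" using lam_pos[of i] s[of j] by simp
    have "0 \<le> (G $$ (i, j) - H $$ (j, i))\<^sup>2" by simp
    then show "G $$ (i, j) * H $$ (j, i) \<le> c i j" by (simp add: c_def power2_diff)
  qed
  finally have trQ: "mat_trace Q \<le> (\<Sum>i<n. \<Sum>j<n. sqrt (lam i) * sqrt (s j) * c i j)" .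
  \<comment> \<open>The marginals of \<open>c\<close> are 1, so the two pure traces can be spread
    over \<open>c\<close> and combine with the mixed term into squares.\<close>
  have "(\<Sum>i<n. \<Sum>j<n. c i j * (sqrt (lam i) - sqrt (s j))\<^sup>2)
      = (\<Sum>i<n. \<Sum>j<n. lam i * c i j + s j * c i j - 2 * (sqrt (lam i) * sqrt (s j) * c i j))"
    using lam_pos s by (intro sum.cong refl) (simp add: power2_diff less_imp_le algebra_simps)
  also have "\<dots> = (\<Sum>i<n. \<Sum>j<n. lam i * c i j) + (\<Sum>i<n. \<Sum>j<n. s j * c i j)
      - 2 * (\<Sum>i<n. \<Sum>j<n. sqrt (lam i) * sqrt (s j) * c i j)"
    by (simp add: sum.distrib sum_subtractf sum_distrib_left)
  also have "(\<Sum>i<n. \<Sum>j<n. lam i * c i j) = (\<Sum>i<n. lam i)"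
    by (intro sum.cong refl) (simp add: sum_distrib_left[symmetric] rows)
  also have "(\<Sum>i<n. \<Sum>j<n. s j * c i j) = (\<Sum>j<n. \<Sum>i<n. s j * c i j)" by (rule sum.swap)
  also have "\<dots> = (\<Sum>j<n. s j)"
    by (intro sum.cong refl) (simp add: sum_distrib_left[symmetric] cols)
  also have "(\<Sum>i<n. lam i) + (\<Sum>j<n. s j) - 2 * (\<Sum>i<n. \<Sum>j<n. sqrt (lam i) * sqrt (s j) * c i j)
      \<le> bures ?S"
    using trQ unfolding bures_def trace_Sigma0 trace_orth_diag[OF E] Q_def by simp
  finally show ?thesis using that[of c] c0 rows cols by blast
qed

end

section \<open>Spectra of regularized Gram matrices\<close>

lemma gram_spectral:
  assumes W: "W \<in> carrier_mat n m"
  obtains E \<mu> where "orth n E" "W * W\<^sup>T = E * mat_diag n \<mu> * E\<^sup>T" "\<And>i. i < n \<Longrightarrow> 0 \<le> \<mu> i"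
proof -
  have WW: "pos_semidef n (W * W\<^sup>T)" by (rule pos_semidef_gram[OF W])
  obtain E \<mu> where E: "orth n E" "W * W\<^sup>T = E * mat_diag n \<mu> * E\<^sup>T"
    using real_spectral[OF pos_semidefD[OF WW]] .
  then show ?thesis using that pos_semidef_eigenvalue_nonneg[OF WW E] by blast
qed

lemma reg_cov_orth_diag:
  assumes E: "orth n E" and gram: "W * W\<^sup>T = E * mat_diag n \<mu> * E\<^sup>T"
  shows "reg_cov n \<tau> W = E * mat_diag n (\<lambda>i. \<mu> i + \<tau>) * E\<^sup>T"
proof -
  have [simp]: "dim_row E = n" "dim_col E = n" and EE: "E * E\<^sup>T = 1\<^sub>m n" using E by (auto simp: orth_def)
  have "mat_diag n (\<lambda>i. \<mu> i + \<tau>) = mat_diag n \<mu> + \<tau> \<cdot>\<^sub>m 1\<^sub>m n"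
    by (rule eq_matI) (auto simp: mat_diag_def)
  then have "E * mat_diag n (\<lambda>i. \<mu> i + \<tau>) * E\<^sup>T = E * mat_diag n \<mu> * E\<^sup>T + \<tau> \<cdot>\<^sub>m 1\<^sub>m n"
    by (simp add: mat_ring EE)
  then show ?thesis by (simp add: reg_cov_def gram)
qed

subsection \<open>Plane rotations\<close>

text \<open>Entry (k, l) of a Givens rotation in the plane of the axes \<open>i\<close> and
  \<open>j\<close>, with cosine \<open>c\<close> and sine \<open>s\<close>; an entry function keeps
  the sums below elementary.\<close>

definition rot :: "nat \<Rightarrow> nat \<Rightarrow> real \<Rightarrow> real \<Rightarrow> nat \<Rightarrow> nat \<Rightarrow> real" where
  "rot i j c s k l =
     (if k = i then (if l = i then c else if l = j then - s else 0)
      else if k = j then (if l = i then s else if l = j then c else 0)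
      else if k = l then 1 else 0)"

lemma sum_split_two:
  fixes F :: "nat \<Rightarrow> real"
  assumes "i < n" "j < n" "i \<noteq> j"
  shows "(\<Sum>l<n. F l) = F i + F j + (\<Sum>l\<in>{..<n} - {i, j}. F l)"
proof -
  have "(\<Sum>l<n. F l) = F i + (\<Sum>l\<in>{..<n} - {i}. F l)"
    using assms by (intro sum.remove) auto
  also have "(\<Sum>l\<in>{..<n} - {i}. F l) = F j + (\<Sum>l\<in>{..<n} - {i} - {j}. F l)"
    using assms by (intro sum.remove) auto
  also have "{..<n} - {i} - {j} = {..<n} - {i, j}" by auto
  finally show ?thesis by simp
qed

text \<open>\<open>x\<close> is the sine of the angle. Squaring the entries moves the fraction x^2
  of the weight between \<open>i\<close> and \<open>j\<close>, which is exactly the correction term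
  of the bilinear sum; the distance to the identity stays linear in \<open>x\<close> because (c -
  1)^2 \<le> x^2.\<close>

lemma plane_rotation:
  fixes x :: real
  assumes ij: "i < n" "j < n" "i \<noteq> j" and x: "0 \<le> x" "x \<le> 1"
  obtains G where "orth n G" "frob_norm (G - 1\<^sub>m n) \<le> 2 * x"
    "\<forall>u v. (\<Sum>k<n. \<Sum>l<n. u k * v l * (G $$ (k, l))\<^sup>2)
       = (\<Sum>k<n. u k * v k) + x\<^sup>2 * ((u i - u j) * (v j - v i))"
proof -
  define c where "c = sqrt (1 - x\<^sup>2)"
  have x2: "x\<^sup>2 \<le> 1" using x by (simp add: power_le_one)
  have c2: "c\<^sup>2 = 1 - x\<^sup>2" using x2 by (simp add: c_def)
  have c0: "0 \<le> c" and c1: "c \<le> 1" using x2 by (simp_all add: c_def)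
  have cc: "c * c + x * x = 1" using c2 by (simp add: power2_eq_square)
  define g where "g = rot i j c x"
  have rest: "g k l = (if k = l then 1 else 0)" if "k \<in> {..<n} - {i, j}" for k l
    using that by (auto simp: g_def rot_def)
  define G where "G = mat n n (\<lambda>(k, l). g k l)"
  have [simp]: "dim_row G = n" "dim_col G = n" by (simp_all add: G_def)
  have Gg: "G $$ (k, l) = g k l" if "k < n" "l < n" for k l using that by (simp add: G_def)
  have "orth n G"
  proof (rule orthI)
    show "G\<^sup>T * G = 1\<^sub>m n"
    proof (rule eq_matI)
      fix a b assume "a < dim_row (1\<^sub>m n)" "b < dim_col (1\<^sub>m n)"
      then have ab: "a < n" "b < n" by auto
      have "(G\<^sup>T * G) $$ (a, b) = (\<Sum>l<n. g l a * g l b)"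
        using ab by (subst mat_mult_index) (auto simp: Gg intro!: sum.cong)
      also have "\<dots> = g i a * g i b + g j a * g j b + (\<Sum>l\<in>{..<n} - {i, j}. g l a * g l b)"
        by (rule sum_split_two[OF ij])
      also have "(\<Sum>l\<in>{..<n} - {i, j}. g l a * g l b) =
          (\<Sum>l\<in>{..<n} - {i, j}. if l = a then (if a = b then 1 else 0) else 0)"
        by (intro sum.cong refl) (simp add: rest)
      also have "\<dots> = (if a \<in> {..<n} - {i, j} then (if a = b then 1 else 0) else 0)"
        by (subst sum.delta) simp_all
      finally show "(G\<^sup>T * G) $$ (a, b) = 1\<^sub>m n $$ (a, b)"
        using ab ij cc by (auto simp: g_def rot_def)
    qed simp_all
  qed (simp add: carrier_matI)
  moreover have "frob_norm (G - 1\<^sub>m n) \<le> 2 * x"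
  proof -
    have row: "(\<Sum>l<n. (g k l - (if k = l then 1 else 0))\<^sup>2) = (c - 1)\<^sup>2 + x\<^sup>2" if "k = i \<or> k = j" for k
    proof -
      have "(\<Sum>l\<in>{..<n} - {i, j}. (g k l - (if k = l then 1 else 0))\<^sup>2) = 0"
        using that by (intro sum.neutral) (auto simp: g_def rot_def)
      then show ?thesis unfolding sum_split_two[OF ij] using that ij by (auto simp: g_def rot_def)
    qed
    have "(frob_norm (G - 1\<^sub>m n))\<^sup>2 = (\<Sum>k<n. \<Sum>l<n. (g k l - (if k = l then 1 else 0))\<^sup>2)"
      unfolding frob_norm_sq by (intro sum.cong) (auto simp: Gg)
    also have "\<dots> = 2 * ((c - 1)\<^sup>2 + x\<^sup>2)"
    proof -
      have "(\<Sum>k\<in>{..<n} - {i, j}. \<Sum>l<n. (g k l - (if k = l then 1 else 0))\<^sup>2) = 0"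
        by (intro sum.neutral ballI) (simp add: rest)
      then show ?thesis unfolding sum_split_two[OF ij, of "\<lambda>k. \<Sum>l<n. _ k l"] by (simp add: row)
    qed
    also have "(c - 1)\<^sup>2 \<le> x\<^sup>2"
    proof -
      have "(c - 1)\<^sup>2 = 1 + c\<^sup>2 - 2 * c" by (simp add: power2_diff)
      also have "\<dots> \<le> 1 - c\<^sup>2" using mult_left_mono[OF c1 c0] by (simp add: power2_eq_square)
      finally show ?thesis by (simp add: c2)
    qed
    finally have "(frob_norm (G - 1\<^sub>m n))\<^sup>2 \<le> (2 * x)\<^sup>2" by (simp add: power2_eq_square)
    then show ?thesis by (rule power2_le_imp_le) (use x in simp)
  qed
  moreover have "(\<Sum>k<n. \<Sum>l<n. u k * v l * (G $$ (k, l))\<^sup>2)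
       = (\<Sum>k<n. u k * v k) + x\<^sup>2 * ((u i - u j) * (v j - v i))" for u v
  proof -
    have row: "(\<Sum>l<n. u k * v l * (g k l)\<^sup>2) = u k * v i * (g k i)\<^sup>2 + u k * v j * (g k j)\<^sup>2"
      if "k = i \<or> k = j" for k
    proof -
      have "(\<Sum>l\<in>{..<n} - {i, j}. u k * v l * (g k l)\<^sup>2) = 0"
        using that by (intro sum.neutral) (auto simp: g_def rot_def)
      then show ?thesis unfolding sum_split_two[OF ij] by simp
    qed
    have "(\<Sum>k<n. \<Sum>l<n. u k * v l * (G $$ (k, l))\<^sup>2) = (\<Sum>k<n. \<Sum>l<n. u k * v l * (g k l)\<^sup>2)"
      by (intro sum.cong refl) (simp add: Gg)
    also have "\<dots> = (\<Sum>l<n. u i * v l * (g i l)\<^sup>2) + (\<Sum>l<n. u j * v l * (g j l)\<^sup>2)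
        + (\<Sum>k\<in>{..<n} - {i, j}. \<Sum>l<n. u k * v l * (g k l)\<^sup>2)"
      by (rule sum_split_two[OF ij])
    also have "(\<Sum>k\<in>{..<n} - {i, j}. \<Sum>l<n. u k * v l * (g k l)\<^sup>2) = (\<Sum>k\<in>{..<n} - {i, j}. u k * v k)"
    proof (intro sum.cong refl)
      fix k assume k: "k \<in> {..<n} - {i, j}"
      have "(\<Sum>l<n. u k * v l * (g k l)\<^sup>2) = (\<Sum>l<n. (if l = k then 1 else 0) * (u k * v l))"
        by (intro sum.cong refl) (auto simp: rest[OF k])
      then show "(\<Sum>l<n. u k * v l * (g k l)\<^sup>2) = u k * v k"
        using k sum_if_eq_mult[of k n "\<lambda>l. u k * v l"] by simp
    qed
    also have "(\<Sum>l<n. u i * v l * (g i l)\<^sup>2) + (\<Sum>l<n. u j * v l * (g j l)\<^sup>2)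
        + (\<Sum>k\<in>{..<n} - {i, j}. u k * v k)
        = u i * v i + u j * v j + (\<Sum>k\<in>{..<n} - {i, j}. u k * v k) + x\<^sup>2 * ((u i - u j) * (v j - v i))"
      using ij by (simp add: row) (simp add: g_def rot_def c2 algebra_simps)
    also have "u i * v i + u j * v j + (\<Sum>k\<in>{..<n} - {i, j}. u k * v k) = (\<Sum>k<n. u k * v k)"
      by (rule sum_split_two[OF ij, symmetric])
    finally show ?thesis .
  qed
  ultimately show ?thesis using that by blast
qed

subsection \<open>Critical points and minimizers on the fixed-rank manifolds\<close>

text \<open>A bathtub argument: the weighted sum is smallest when all the mass sits on the last
  \<open>n - r\<close> indices, where \<open>g\<close> is smallest. Both sides are compared with the
  threshold value \<open>g r\<close>.\<close>

lemma sum_weights_antimono: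
  fixes a g :: "nat \<Rightarrow> real"
  assumes a: "\<And>i. i < n \<Longrightarrow> 0 \<le> a i" "\<And>i. i < n \<Longrightarrow> a i \<le> 1"
    and total: "real (n - r) \<le> (\<Sum>i<n. a i)" and r: "r \<le> n"
    and g: "\<And>i j. i \<le> j \<Longrightarrow> j < n \<Longrightarrow> g j \<le> g i" "\<And>i. i < n \<Longrightarrow> 0 \<le> g i"
  shows "(\<Sum>i\<in>{r..<n}. g i) \<le> (\<Sum>i<n. a i * g i)"
proof (cases "r < n")
  case True
  have split: "(\<Sum>i<n. h i) = (\<Sum>i<r. h i) + (\<Sum>i\<in>{r..<n}. h i)" for h :: "nat \<Rightarrow> real"
    using sum.atLeastLessThan_concat[of 0 r n h] r by (simp add: atLeast0LessThan)
  \<comment> \<open>Excess mass costs at least nothing. Replacing \<open>g r\<close> by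
    \<open>g i\<close> then raises the terms before \<open>r\<close> and lowers the subtracted ones
    from \<open>r\<close> on.\<close>
  have "0 \<le> g r * ((\<Sum>i<n. a i) - real (n - r))"
    using g(2)[OF True] total by simp
  also have "\<dots> = (\<Sum>i<r. a i * g r) - (\<Sum>i\<in>{r..<n}. (1 - a i) * g r)"
    by (simp add: split sum_distrib_right[symmetric] sum_subtractf algebra_simps)
  also have "\<dots> \<le> (\<Sum>i<r. a i * g i) - (\<Sum>i\<in>{r..<n}. (1 - a i) * g i)"
    using a g True by (intro diff_mono sum_mono mult_left_mono) auto
  also have "\<dots> = (\<Sum>i<n. a i * g i) - (\<Sum>i\<in>{r..<n}. g i)"
    by (simp add: split left_diff_distrib sum_subtractf)
  finally show ?thesis by simp
qed (use r a g in \<open>auto intro!: sum_nonneg\<close>)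

locale bures_reg = bures_target +
  fixes \<tau> :: real
  assumes tau_pos: "0 < \<tau>"
begin

lemma pos_inv_reg_cov:
  assumes W: "W \<in> carrier_mat n m"
  shows "pos_inv n (reg_cov n \<tau> W)"
proof -
  obtain E \<mu> where E: "orth n E" "W * W\<^sup>T = E * mat_diag n \<mu> * E\<^sup>T" "\<And>i. i < n \<Longrightarrow> 0 \<le> \<mu> i"
    using gram_spectral[OF W] by blast
  show ?thesis unfolding reg_cov_orth_diag[OF E(1,2)]
    by (rule pos_inv_orth_diag[OF E(1)]) (use E(3) tau_pos in \<open>simp add: add_nonneg_pos\<close>)
qed

lemma loss1_eq_bures:
  assumes W: "W \<in> carrier_mat n m"
  shows "loss1 n \<Sigma>0 \<tau> W = bures (reg_cov n \<tau> W)"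
proof -
  have "pos_semidef n (mat_sqrt n (P * reg_cov n \<tau> W * P))"
    using mat_sqrt[of n "P * reg_cov n \<tau> W * P"] pos_inv_PSP[OF pos_inv_reg_cov[OF W]]
    by (auto simp: pos_inv_def)
  then have [simp]: "dim_row (mat_sqrt n (P * reg_cov n \<tau> W * P)) = n"
      "dim_col (mat_sqrt n (P * reg_cov n \<tau> W * P)) = n"
    by (auto simp: pos_semidef_def)
  have [simp]: "dim_row (reg_cov n \<tau> W) = n" "dim_col (reg_cov n \<tau> W) = n"
    by (simp_all add: reg_cov_def)
  show ?thesis
    unfolding loss1_def mat_sqrt_Sigma0 bures_def by (simp add: mat_trace_linear)
qed

text \<open>The perturbation direction is the defect D = M - T M itself, where M is the Gram matrix.
  Along it the affine minorant has slope 2 |D|^2, while criticality allows the loss above it only a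
  change of lower order; so D vanishes. Perturbing from the left suffices.\<close>

lemma critical_transport_fixes:
  assumes W: "W \<in> carrier_mat n m"
    and crit: "\<And>\<epsilon>. \<epsilon> > 0 \<Longrightarrow> \<exists>\<delta>>0. \<forall>A\<in>carrier_mat n n. frob_norm A < \<delta> \<longrightarrow>
      \<bar>loss1 n \<Sigma>0 \<tau> ((1\<^sub>m n + A) * W) - loss1 n \<Sigma>0 \<tau> W\<bar> \<le> \<epsilon> * frob_norm A"
  obtains T where "T \<in> carrier_mat n n" "T\<^sup>T = T" "T * reg_cov n \<tau> W * T = \<Sigma>0"
    "T * (W * W\<^sup>T) = W * W\<^sup>T"
proof -
  have [simp]: "dim_row W = n" "dim_col W = m" using W by auto
  obtain T where T: "T \<in> carrier_mat n n" "T\<^sup>T = T" "T * reg_cov n \<tau> W * T = \<Sigma>0"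
    "\<And>S'. pos_inv n S' \<Longrightarrow> (mat_trace S' - mat_trace (T * S'))
        - (mat_trace (reg_cov n \<tau> W) - mat_trace (T * reg_cov n \<tau> W)) \<le> bures S' - bures (reg_cov n \<tau> W)"
    using bures_minorant[OF pos_inv_reg_cov[OF W]] by metis
  have [simp]: "dim_row T = n" "dim_col T = n" using T by auto
  define M where "M = W * W\<^sup>T"
  have [simp]: "dim_row M = n" "dim_col M = n" by (simp_all add: M_def)
  have MT: "M\<^sup>T = M" by (simp add: M_def mat_transpose_mult)
  have WWX: "W * (W\<^sup>T * X) = M * X" if "dim_row X = n" for X
    using that by (simp add: M_def mat_mult_assoc)
  define D where "D = M - T * M"
  have [simp]: "dim_row D = n" "dim_col D = n" by (simp_all add: D_def)
  have DT: "D\<^sup>T = M - M * T" by (simp add: D_def mat_transpose_diff mat_transpose_mult MT T(2))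
  \<comment> \<open>The Gram matrix is quadratic in the perturbation; this is the coefficient of t^2
    in the minorant.\<close>
  define \<kappa> where "\<kappa> = mat_trace (D * (M * D\<^sup>T)) - mat_trace (T * (D * (M * D\<^sup>T)))"
  define q where "q = (frob_norm D)\<^sup>2"
  have tr1: "mat_trace (D * M) - mat_trace (T * (D * M)) = q"
  proof -
    have "mat_trace (T * (D * M)) = mat_trace (D * (M * T))"
      by (subst mat_trace_comm) (simp_all add: mat_mult_assoc)
    then have "mat_trace (D * M) - mat_trace (T * (D * M)) = mat_trace (D * D\<^sup>T)"
      unfolding DT by (simp add: mat_mult_diff_right mat_trace_diff)
    then show ?thesis by (simp add: mat_trace_mult_transpose q_def)
  qed
  have tr2: "mat_trace (M * D\<^sup>T) - mat_trace (T * (M * D\<^sup>T)) = q"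
  proof -
    have "mat_trace (M * D\<^sup>T) - mat_trace (T * (M * D\<^sup>T)) = mat_trace (D * D\<^sup>T)"
      unfolding D_def by (simp add: mat_mult_diff_left mat_trace_diff mat_mult_assoc)
    then show ?thesis by (simp add: mat_trace_mult_transpose q_def)
  qed
  have lower: "t * (2 * q) + t\<^sup>2 * \<kappa> \<le> loss1 n \<Sigma>0 \<tau> ((1\<^sub>m n + t \<cdot>\<^sub>m D) * W) - loss1 n \<Sigma>0 \<tau> W" for t
  proof -
    let ?V = "(1\<^sub>m n + t \<cdot>\<^sub>m D) * W"
    have VC: "?V \<in> carrier_mat n m" by (rule carrier_matI) simp_all
    have VV: "?V * ?V\<^sup>T = M + t \<cdot>\<^sub>m (M * D\<^sup>T) + (t \<cdot>\<^sub>m (D * M) + t \<cdot>\<^sub>m (t \<cdot>\<^sub>m (D * (M * D\<^sup>T))))"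
    proof -
      have 1: "?V = W + t \<cdot>\<^sub>m (D * W)" by (simp add: mat_mult_add_left mat_mult_one_left mat_mult_smult_left)
      have 2: "?V\<^sup>T = W\<^sup>T + t \<cdot>\<^sub>m (W\<^sup>T * D\<^sup>T)"
        unfolding 1 by (simp add: mat_transpose_add mat_transpose_smult mat_transpose_mult)
      have "?V * ?V\<^sup>T = (W + t \<cdot>\<^sub>m (D * W)) * (W\<^sup>T + t \<cdot>\<^sub>m (W\<^sup>T * D\<^sup>T))" unfolding 2 unfolding 1 ..
      also have "\<dots> = M + t \<cdot>\<^sub>m (D * M) + t \<cdot>\<^sub>m (M * D\<^sup>T + t \<cdot>\<^sub>m (D * (M * D\<^sup>T)))"
        by (simp add: mat_mult_add_left mat_mult_add_right mat_mult_smult_left mat_mult_smult_right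
            mat_mult_assoc WWX M_def[symmetric])
      also have "\<dots> = M + t \<cdot>\<^sub>m (M * D\<^sup>T) + (t \<cdot>\<^sub>m (D * M) + t \<cdot>\<^sub>m (t \<cdot>\<^sub>m (D * (M * D\<^sup>T))))"
        by (rule eq_matI) (simp_all add: distrib_left del: index_mult_mat(1))
      finally show ?thesis .
    qed
    have "(mat_trace (reg_cov n \<tau> ?V) - mat_trace (T * reg_cov n \<tau> ?V))
        - (mat_trace (reg_cov n \<tau> W) - mat_trace (T * reg_cov n \<tau> W))
      = t * ((mat_trace (D * M) - mat_trace (T * (D * M))) + (mat_trace (M * D\<^sup>T) - mat_trace (T * (M * D\<^sup>T))))
        + t * t * \<kappa>"
      unfolding reg_cov_def VV M_def[symmetric] \<kappa>_def
      by (simp add: mat_mult_add_right mat_mult_smult_right mat_trace_linear algebra_simps)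
    also have "\<dots> = t * (2 * q) + t\<^sup>2 * \<kappa>" unfolding tr1 tr2 by (simp add: power2_eq_square)
    finally show ?thesis
      using T(4)[OF pos_inv_reg_cov[OF VC]] by (simp add: loss1_eq_bures[OF VC] loss1_eq_bures[OF W])
  qed
  have "frob_norm D = 0"
  proof (rule ccontr)
    assume "frob_norm D \<noteq> 0"
    then have D0: "frob_norm D > 0" using frob_norm_nonneg[of D] by linarith
    then have q0: "q > 0" by (simp add: q_def)
    obtain \<delta> where \<delta>: "\<delta> > 0" "\<And>A. A \<in> carrier_mat n n \<Longrightarrow> frob_norm A < \<delta> \<Longrightarrow>
      \<bar>loss1 n \<Sigma>0 \<tau> ((1\<^sub>m n + A) * W) - loss1 n \<Sigma>0 \<tau> W\<bar> \<le> frob_norm D / 2 * frob_norm A"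
      using crit[of "frob_norm D / 2"] D0 by auto
    \<comment> \<open>The first bound keeps the perturbation inside the radius supplied by
      criticality for tolerance |D| / 2. The second keeps the quadratic term below t q, so that t q
      \<le> t q / 2 would follow.\<close>
    define t where "t = min (\<delta> / (2 * frob_norm D)) (q / (\<bar>\<kappa>\<bar> + 1))"
    have t0: "t > 0" using \<delta>(1) D0 q0 by (simp add: t_def)
    have "t * frob_norm D \<le> \<delta> / (2 * frob_norm D) * frob_norm D"
      using D0 by (intro mult_right_mono) (auto simp: t_def)
    also have "\<dots> < \<delta>" using D0 \<delta>(1) by simp
    finally have small: "frob_norm (t \<cdot>\<^sub>m D) < \<delta>" using t0 by (simp add: frob_norm_smult)
    have tk: "t * \<bar>\<kappa>\<bar> \<le> q"
    proof -
      have "t * \<bar>\<kappa>\<bar> \<le> t * (\<bar>\<kappa>\<bar> + 1)" using t0 by simp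
      also have "\<dots> \<le> q / (\<bar>\<kappa>\<bar> + 1) * (\<bar>\<kappa>\<bar> + 1)" by (intro mult_right_mono) (auto simp: t_def)
      also have "\<dots> = q" by simp
      finally show ?thesis .
    qed
    have "t \<cdot>\<^sub>m D \<in> carrier_mat n n" by (rule carrier_matI) simp_all
    from lower[of t] \<delta>(2)[OF this small]
    have "t * (2 * q) + t\<^sup>2 * \<kappa> \<le> frob_norm D / 2 * frob_norm (t \<cdot>\<^sub>m D)" by linarith
    also have "\<dots> = t * (q / 2)" using t0 by (simp add: frob_norm_smult q_def power2_eq_square)
    finally have "t * (2 * q + t * \<kappa>) \<le> t * (q / 2)" by (simp add: algebra_simps power2_eq_square)
    then have "2 * q + t * \<kappa> \<le> q / 2" using t0 by simp
    moreover have "- (t * \<bar>\<kappa>\<bar>) \<le> t * \<kappa>" using t0 by (metis abs_ge_minus_self abs_mult abs_of_pos minus_le_iff)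
    ultimately show False using tk q0 by linarith
  qed
  then have D0: "D = 0\<^sub>m n n" by (intro frob_norm_eq_0D) (simp_all add: carrier_matI)
  have "T * M = M"
  proof (rule eq_matI)
    fix i j assume "i < dim_row M" "j < dim_col M"
    then show "(T * M) $$ (i, j) = M $$ (i, j)"
      using arg_cong[OF D0, of "\<lambda>X. X $$ (i, j)"] by (simp add: D_def del: index_mult_mat(1))
  qed simp_all
  then show ?thesis using that T unfolding M_def by blast
qed

text \<open>With \<open>M = W W\<^sup>T\<close> and the transport map \<open>T\<close>, criticality \<open>T M = M\<close> turns
  \<open>T (M + \<tau>) T = \<Sigma>0\<close> into \<open>\<Sigma>0 M = M\<^sup>2 + \<tau> M\<close>; so \<open>M\<close> commutes with \<open>\<Sigma>0\<close>.\<close>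

lemma critical_gram:
  assumes W: "W \<in> carrier_mat n m"
    and crit: "\<And>\<epsilon>. \<epsilon> > 0 \<Longrightarrow> \<exists>\<delta>>0. \<forall>A\<in>carrier_mat n n. frob_norm A < \<delta> \<longrightarrow>
      \<bar>loss1 n \<Sigma>0 \<tau> ((1\<^sub>m n + A) * W) - loss1 n \<Sigma>0 \<tau> W\<bar> \<le> \<epsilon> * frob_norm A"
    and distinct: "\<And>i j. i < n \<Longrightarrow> j < n \<Longrightarrow> i \<noteq> j \<Longrightarrow> lam i \<noteq> lam j"
  obtains \<mu> where "W * W\<^sup>T = \<Omega> * mat_diag n \<mu> * \<Omega>\<^sup>T" "\<And>i. i < n \<Longrightarrow> 0 \<le> \<mu> i"
    "\<And>i. i < n \<Longrightarrow> \<mu> i = 0 \<or> \<mu> i = lam i - \<tau>"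
proof -
  have [simp]: "dim_row W = n" "dim_col W = m" using W by auto
  obtain T where T: "T \<in> carrier_mat n n" "T\<^sup>T = T" "T * reg_cov n \<tau> W * T = \<Sigma>0"
    "T * (W * W\<^sup>T) = W * W\<^sup>T"
    using critical_transport_fixes[OF W crit] by blast
  have [simp]: "dim_row T = n" "dim_col T = n" using T by auto
  define M where "M = W * W\<^sup>T"
  have [simp]: "dim_row M = n" "dim_col M = n" by (simp_all add: M_def)
  have MT: "M\<^sup>T = M" by (simp add: M_def mat_transpose_mult)
  have TM: "T * M = M" using T(4) by (simp add: M_def)
  have "(T * M)\<^sup>T = M" unfolding TM by (rule MT)
  then have MTm: "M * T = M" by (simp add: mat_transpose_mult MT T(2))
  have S: "\<Sigma>0 = M + \<tau> \<cdot>\<^sub>m (T * T)"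
  proof -
    have "\<Sigma>0 = T * (M + \<tau> \<cdot>\<^sub>m 1\<^sub>m n) * T" using T(3) by (simp add: reg_cov_def M_def)
    also have "\<dots> = T * (M * T) + \<tau> \<cdot>\<^sub>m (T * T)" by (simp add: mat_ring)
    finally show ?thesis unfolding MTm TM .
  qed
  have SM: "\<Sigma>0 * M = M * M + \<tau> \<cdot>\<^sub>m M"
    unfolding S by (simp add: mat_ring TM)
  define K where "K = \<Omega>\<^sup>T * (M * \<Omega>)"
  have KC: "K \<in> carrier_mat n n" unfolding K_def by (rule carrier_matI) simp_all
  have [simp]: "dim_row K = n" "dim_col K = n" using KC by auto
  have KT: "K\<^sup>T = K" by (simp add: K_def mat_transpose_mult MT mat_mult_assoc)
  have \<Omega>c: "\<Omega>\<^sup>T * (\<Omega> * X) = X" "\<Omega> * (\<Omega>\<^sup>T * X) = X" if "dim_row X = n" for X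
    using orth_cancel[OF orth_Omega that] .
  have MK: "M = \<Omega> * K * \<Omega>\<^sup>T"
    by (simp add: K_def mat_mult_assoc \<Omega>c Omega_cancel mat_mult_one_right)
  have LK: "mat_diag n lam * K = K * K + \<tau> \<cdot>\<^sub>m K"
  proof -
    have "\<Omega>\<^sup>T * ((\<Sigma>0 * M) * \<Omega>) = mat_diag n lam * K"
      by (simp add: Sigma0_eq K_def mat_mult_assoc \<Omega>c)
    moreover have "\<Omega>\<^sup>T * ((M * M + \<tau> \<cdot>\<^sub>m M) * \<Omega>) = K * K + \<tau> \<cdot>\<^sub>m K"
      by (simp add: K_def mat_mult_add_left mat_mult_add_right mat_mult_smult_left mat_mult_smult_right mat_mult_assoc \<Omega>c)
    ultimately show ?thesis unfolding SM by simp
  qed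
  \<comment> \<open>The right-hand side of \<open>LK\<close> is symmetric, so transposition yields
    the same matrix: K commutes with the diagonal of eigenvalues.\<close>
  have KL: "K * mat_diag n lam = K * K + \<tau> \<cdot>\<^sub>m K"
    using arg_cong[OF LK, of transpose_mat]
    by (simp add: mat_transpose_mult mat_transpose_add mat_transpose_smult KT mat_transpose_mat_diag)
  have LKi: "(mat_diag n lam * K) $$ (i, j) = lam i * K $$ (i, j)" if "i < n" "j < n" for i j
    using that by (simp add: mat_diag_mult_left[OF KC])
  have KLi: "(K * mat_diag n lam) $$ (i, j) = K $$ (i, j) * lam j" if "i < n" "j < n" for i j
    using that by (simp add: mat_diag_mult_right[OF KC])
  \<comment> \<open>Commutation reads (lam i - lam j) K_ij = 0, and the eigenvalues are
    distinct.\<close>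
  have off: "K $$ (i, j) = 0" if "i < n" "j < n" "i \<noteq> j" for i j
    using LKi[of i j] KLi[of i j] distinct[of i j] that unfolding LK KL by (metis mult.commute mult_cancel_right)
  define \<mu> where "\<mu> i = K $$ (i, i)" for i
  have K\<mu>: "K = mat_diag n \<mu>"
    by (rule eq_matI) (auto simp: mat_diag_def \<mu>_def off)
  have "\<mu> i = 0 \<or> \<mu> i = lam i - \<tau>" if i: "i < n" for i
  proof -
    have "lam i * \<mu> i = (mat_diag n lam * K) $$ (i, i)" using LKi[OF i i] by (simp add: \<mu>_def)
    also have "\<dots> = \<mu> i * \<mu> i + \<tau> * \<mu> i"
      unfolding LK unfolding K\<mu> using i by (simp del: index_mult_mat(1)) (simp add: mat_diag_def)
    finally have "\<mu> i * (lam i - \<mu> i - \<tau>) = 0" by (simp add: algebra_simps)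
    then show ?thesis by auto
  qed
  moreover have gram: "W * W\<^sup>T = \<Omega> * mat_diag n \<mu> * \<Omega>\<^sup>T" using MK unfolding K\<mu> M_def .
  moreover have "0 \<le> \<mu> i" if "i < n" for i
    by (rule pos_semidef_eigenvalue_nonneg[OF pos_semidef_gram[OF W] orth_Omega gram that])
  ultimately show ?thesis using that by blast
qed

text \<open>Rotating \<open>W\<close> in the eigenbasis keeps rank and spectrum. The upper bound for
  the rotated matrix differs from the exact loss of \<open>W\<close> by -2 x^2 times a product of
  two positive differences of square roots.\<close>

lemma rotation_decreases_loss:
  assumes W: "W \<in> carrier_mat n m" and gram: "W * W\<^sup>T = \<Omega> * mat_diag n \<mu> * \<Omega>\<^sup>T"
    and \<mu>: "\<And>i. i < n \<Longrightarrow> 0 \<le> \<mu> i" and ij: "i < n" "j < n" "\<mu> i < \<mu> j" "lam j < lam i"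
    and \<delta>: "\<delta> > 0"
  obtains V where "V \<in> fixed_rank n m (vec_space.rank n W)" "frob_dist V W < \<delta>"
    "loss1 n \<Sigma>0 \<tau> V < loss1 n \<Sigma>0 \<tau> W"
proof -
  have [simp]: "dim_row W = n" "dim_col W = m" using W by auto
  define N where "N = frob_norm \<Omega> * frob_norm (\<Omega>\<^sup>T * W)"
  have N: "N \<ge> 0" by (simp add: N_def)
  \<comment> \<open>The displacement is at most 2 x N, hence at most \<delta> / 2; the added 1
    guards against N = 0.\<close>
  define x where "x = min 1 (\<delta> / (4 * (N + 1)))"
  have x: "0 < x" "x \<le> 1" using \<delta> N by (auto simp: x_def)
  have "i \<noteq> j" using ij by auto
  then obtain G where G: "orth n G" "frob_norm (G - 1\<^sub>m n) \<le> 2 * x"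
    and Gsum: "\<forall>u v. (\<Sum>k<n. \<Sum>l<n. u k * v l * (G $$ (k, l))\<^sup>2)
       = (\<Sum>k<n. u k * v k) + x\<^sup>2 * ((u i - u j) * (v j - v i))"
    by (rule plane_rotation[OF ij(1,2) _ less_imp_le[OF x(1)] x(2)])
  have [simp]: "dim_row G = n" "dim_col G = n" using G by (auto simp: orth_def)
  define R where "R = \<Omega> * G * \<Omega>\<^sup>T"
  have R: "orth n R" unfolding R_def by (intro orth_mult orth_transpose orth_Omega G(1))
  have RC: "R \<in> carrier_mat n n" and RTC: "R\<^sup>T \<in> carrier_mat n n" using R by (auto simp: orth_def)
  have [simp]: "dim_row R = n" "dim_col R = n" using RC by auto
  define V where "V = R * W"
  have VC: "V \<in> carrier_mat n m" unfolding V_def by (rule carrier_matI) simp_all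
  have WV: "W = R\<^sup>T * V" unfolding V_def using orth_cancel(1)[OF R] by simp
  have rank_eq: "vec_space.rank n V = vec_space.rank n W"
  proof (rule antisym)
    show "vec_space.rank n V \<le> vec_space.rank n W"
      unfolding V_def by (rule rank_mult_le_right[OF RC W])
    have "vec_space.rank n (R\<^sup>T * V) \<le> vec_space.rank n V" by (rule rank_mult_le_right[OF RTC VC])
    then show "vec_space.rank n W \<le> vec_space.rank n V" unfolding WV[symmetric] .
  qed
  have "V - W = \<Omega> * ((G - 1\<^sub>m n) * (\<Omega>\<^sup>T * W))"
  proof -
    have "\<Omega> * ((G - 1\<^sub>m n) * (\<Omega>\<^sup>T * W)) = V - \<Omega> * (\<Omega>\<^sup>T * W)"
      by (simp add: V_def R_def mat_mult_assoc mat_mult_diff_left mat_mult_diff_right mat_mult_one_left)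
    then show ?thesis using orth_cancel(2)[OF orth_Omega, of W] by simp
  qed
  then have "frob_dist V W \<le> frob_norm \<Omega> * frob_norm ((G - 1\<^sub>m n) * (\<Omega>\<^sup>T * W))"
    unfolding frob_dist_def using frob_norm_mult[of \<Omega> "(G - 1\<^sub>m n) * (\<Omega>\<^sup>T * W)"] by simp
  also have "\<dots> \<le> frob_norm \<Omega> * (2 * x * frob_norm (\<Omega>\<^sup>T * W))"
  proof (rule mult_left_mono)
    have "frob_norm ((G - 1\<^sub>m n) * (\<Omega>\<^sup>T * W)) \<le> frob_norm (G - 1\<^sub>m n) * frob_norm (\<Omega>\<^sup>T * W)"
      by (rule frob_norm_mult) simp
    also have "\<dots> \<le> 2 * x * frob_norm (\<Omega>\<^sup>T * W)" by (rule mult_right_mono[OF G(2)]) simp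
    finally show "frob_norm ((G - 1\<^sub>m n) * (\<Omega>\<^sup>T * W)) \<le> 2 * x * frob_norm (\<Omega>\<^sup>T * W)" .
  qed simp
  also have "\<dots> = 2 * x * N" by (simp add: N_def)
  also have "\<dots> \<le> 2 * (\<delta> / (4 * (N + 1))) * (N + 1)"
    using N \<delta> by (intro mult_mono) (auto simp: x_def)
  also have "\<dots> < \<delta>" using N \<delta> by (simp add: field_simps add_pos_nonneg)
  finally have close: "frob_dist V W < \<delta>" .
  let ?s = "\<lambda>k. \<mu> k + \<tau>"
  have s: "0 < ?s k" if "k < n" for k using \<mu>[OF that] tau_pos by linarith
  have E: "orth n (\<Omega> * G)" by (rule orth_mult[OF orth_Omega G(1)])
  have "V * V\<^sup>T = R * (W * W\<^sup>T) * R\<^sup>T" by (simp add: V_def mat_transpose_mult mat_mult_assoc)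
  also have "\<dots> = (\<Omega> * G) * mat_diag n \<mu> * (\<Omega> * G)\<^sup>T"
    unfolding gram R_def
    by (simp add: mat_transpose_mult mat_mult_assoc orth_cancel[OF orth_Omega])
  finally have VV: "V * V\<^sup>T = (\<Omega> * G) * mat_diag n \<mu> * (\<Omega> * G)\<^sup>T" .
  have OG: "\<Omega>\<^sup>T * (\<Omega> * G) = G" using orth_cancel(1)[OF orth_Omega] by simp
  have "loss1 n \<Sigma>0 \<tau> V \<le> (\<Sum>k<n. ?s k) + (\<Sum>k<n. lam k)
      - 2 * (\<Sum>k<n. \<Sum>l<n. sqrt (lam k) * sqrt (?s l) * (G $$ (k, l))\<^sup>2)"
    unfolding loss1_eq_bures[OF VC] reg_cov_orth_diag[OF E VV]
    using bures_upper[OF E, of ?s] s unfolding OG by blast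
  also have "\<dots> = (\<Sum>k<n. ?s k) + (\<Sum>k<n. lam k) - 2 * (\<Sum>k<n. sqrt (lam k) * sqrt (?s k))
      - 2 * x\<^sup>2 * ((sqrt (lam i) - sqrt (lam j)) * (sqrt (?s j) - sqrt (?s i)))"
    unfolding Gsum[rule_format] by (simp add: algebra_simps)
  also have "\<dots> < (\<Sum>k<n. ?s k) + (\<Sum>k<n. lam k) - 2 * (\<Sum>k<n. sqrt (lam k) * sqrt (?s k))"
    using ij x by simp
  also have "\<dots> = (\<Sum>k<n. ?s k + lam k - 2 * (sqrt (lam k) * sqrt (?s k)))"
    by (simp add: sum.distrib sum_subtractf sum_distrib_left)
  also have "\<dots> = (\<Sum>k<n. (sqrt (?s k) - sqrt (lam k))\<^sup>2)"
    using lam_pos s by (intro sum.cong refl) (simp add: power2_diff less_imp_le)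
  also have "\<dots> = loss1 n \<Sigma>0 \<tau> W"
    unfolding loss1_eq_bures[OF W] reg_cov_orth_diag[OF orth_Omega gram]
    by (rule bures_commuting[symmetric]) (rule s)
  finally show ?thesis using that[of V] VC rank_eq close by (simp add: fixed_rank_def)
qed

text \<open>Only the null directions of the Gram matrix are charged in the coupling bound; the
  remaining nonnegative squares are dropped. A null direction coupled to \<open>lam i\<close> costs
  \<open>(sqrt (lam i) - sqrt \<tau>)\<^sup>2\<close>, which decreases with the index because \<tau>
  \<le> lam i.\<close>

lemma loss1_lower_bound:
  assumes V: "V \<in> carrier_mat n m" and rk: "vec_space.rank n V \<le> r" and r: "r \<le> n"
    and dec: "\<And>i j. i \<le> j \<Longrightarrow> j < n \<Longrightarrow> lam j \<le> lam i" and \<tau>: "\<And>i. i < n \<Longrightarrow> \<tau> \<le> lam i"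
  shows "(\<Sum>i\<in>{r..<n}. (sqrt (lam i) - sqrt \<tau>)\<^sup>2) \<le> loss1 n \<Sigma>0 \<tau> V"
proof -
  obtain E \<mu> where E: "orth n E" "V * V\<^sup>T = E * mat_diag n \<mu> * E\<^sup>T" "\<And>i. i < n \<Longrightarrow> 0 \<le> \<mu> i"
    using gram_spectral[OF V] by blast
  let ?s = "\<lambda>i. \<mu> i + \<tau>"
  have s: "0 < ?s i" if "i < n" for i using E(3)[OF that] tau_pos by linarith
  obtain c where c: "\<And>i j. 0 \<le> c i j" "\<And>i. i < n \<Longrightarrow> (\<Sum>j<n. c i j) = 1" "\<And>j. j < n \<Longrightarrow> (\<Sum>i<n. c i j) = 1"
    "(\<Sum>i<n. \<Sum>j<n. c i j * (sqrt (lam i) - sqrt (?s j))\<^sup>2) \<le> bures (E * mat_diag n ?s * E\<^sup>T)"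
    using bures_lower[OF E(1), of ?s] s by blast
  define J where "J = {j. j < n \<and> \<mu> j = 0}"
  have Jsub: "J \<subseteq> {..<n}" by (auto simp: J_def)
  have "card J + vec_space.rank n V = n"
  proof -
    have "card J + card {i. i < n \<and> \<mu> i \<noteq> 0} = card (J \<union> {i. i < n \<and> \<mu> i \<noteq> 0})"
      by (subst card_Un_disjoint) (auto simp: J_def)
    also have "J \<union> {i. i < n \<and> \<mu> i \<noteq> 0} = {..<n}" by (auto simp: J_def)
    finally show ?thesis by (simp add: rank_gram_diag[OF E(1) V E(2)])
  qed
  then have cJ: "n - r \<le> card J" using rk by linarith
  \<comment> \<open>The share of \<open>lam i\<close> that is coupled to null directions: at most 1
    for each \<open>i\<close>, and in total the number of null directions.\<close>
  define a where "a i = (\<Sum>j\<in>J. c i j)" for i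
  define g where "g i = (sqrt (lam i) - sqrt \<tau>)\<^sup>2" for i
  have "(\<Sum>i\<in>{r..<n}. g i) \<le> (\<Sum>i<n. a i * g i)"
  proof (rule sum_weights_antimono[OF _ _ _ r])
    show "0 \<le> a i" for i by (simp add: a_def sum_nonneg c)
    show "a i \<le> 1" if "i < n" for i
      unfolding a_def c(2)[OF that, symmetric] by (rule sum_mono2) (use Jsub c in auto)
    have "(\<Sum>i<n. a i) = (\<Sum>j\<in>J. \<Sum>i<n. c i j)" unfolding a_def by (rule sum.swap)
    also have "\<dots> = (\<Sum>j\<in>J. 1)" by (rule sum.cong) (auto simp: J_def c(3))
    finally show "real (n - r) \<le> (\<Sum>i<n. a i)" using cJ by simp
    show "0 \<le> g i" for i by (simp add: g_def)
    show "g j \<le> g i" if "i \<le> j" "j < n" for i j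
      unfolding g_def using dec[OF that] \<tau>[OF that(2)] by (intro power_mono) auto
  qed
  also have "\<dots> = (\<Sum>i<n. \<Sum>j\<in>J. c i j * (sqrt (lam i) - sqrt (?s j))\<^sup>2)"
    unfolding a_def sum_distrib_right by (intro sum.cong refl) (auto simp: g_def J_def)
  also have "\<dots> \<le> (\<Sum>i<n. \<Sum>j<n. c i j * (sqrt (lam i) - sqrt (?s j))\<^sup>2)"
    by (intro sum_mono sum_mono2) (use Jsub c in auto)
  also have "\<dots> \<le> loss1 n \<Sigma>0 \<tau> V"
    unfolding loss1_eq_bures[OF V] reg_cov_orth_diag[OF E(1,2)] by (rule c(4))
  finally show ?thesis by (simp add: g_def)
qed

end

context bures_reg
begin

lemma local_minimizer_optimal:
  assumes W: "W \<in> fixed_rank n m r" and r: "r \<le> n"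
    and dec: "\<And>i j. i < j \<Longrightarrow> j < n \<Longrightarrow> lam j < lam i" and \<tau>: "\<And>i. i < n \<Longrightarrow> \<tau> \<le> lam i"
    and crit: "\<And>\<epsilon>. \<epsilon> > 0 \<Longrightarrow> \<exists>\<delta>>0. \<forall>A\<in>carrier_mat n n. frob_norm A < \<delta> \<longrightarrow>
      \<bar>loss1 n \<Sigma>0 \<tau> ((1\<^sub>m n + A) * W) - loss1 n \<Sigma>0 \<tau> W\<bar> \<le> \<epsilon> * frob_norm A"
    and loc: "local_minimizer frob_dist (fixed_rank n m r) (loss1 n \<Sigma>0 \<tau>) W"
  shows "is_arg_min (loss1 n \<Sigma>0 \<tau>) (\<lambda>V. V \<in> fixed_rank n m r) W"
    and "reg_cov n \<tau> W = \<Omega> * four_block_mat (mat_diag r lam) (0\<^sub>m r (n - r))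
      (0\<^sub>m (n - r) r) (\<tau> \<cdot>\<^sub>m 1\<^sub>m (n - r)) * \<Omega>\<^sup>T"
proof -
  have WC: "W \<in> carrier_mat n m" and Wr: "vec_space.rank n W = r" using W by (auto simp: fixed_rank_def)
  have distinct: "lam i \<noteq> lam j" if "i < n" "j < n" "i \<noteq> j" for i j
    using dec[of i j] dec[of j i] that by (cases "i < j") auto
  obtain \<mu> where gram: "W * W\<^sup>T = \<Omega> * mat_diag n \<mu> * \<Omega>\<^sup>T" and \<mu>0: "\<And>i. i < n \<Longrightarrow> 0 \<le> \<mu> i"
    and \<mu>: "\<And>i. i < n \<Longrightarrow> \<mu> i = 0 \<or> \<mu> i = lam i - \<tau>"
    using critical_gram[OF WC crit distinct] by blast
  define J where "J = {i. i < n \<and> \<mu> i \<noteq> 0}"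
  have cJ: "card J = r" using rank_gram_diag[OF orth_Omega WC gram] Wr by (simp add: J_def)
  have fJ: "finite J" by (simp add: J_def)
  \<comment> \<open>Both sets have \<open>r\<close> elements, so if they differ, each contains an
    index missing from the other. This yields the pair to be exchanged.\<close>
  have J: "J = {..<r}"
  proof (rule ccontr)
    assume neq: "J \<noteq> {..<r}"
    have "\<not> {..<r} \<subseteq> J"
    proof
      assume "{..<r} \<subseteq> J"
      from card_subset_eq[OF fJ this] show False using neq by (simp add: cJ)
    qed
    then obtain i where i: "i < r" "i \<notin> J" by auto
    have "\<not> J \<subseteq> {..<r}"
    proof
      assume "J \<subseteq> {..<r}"
      from card_subset_eq[OF finite_lessThan this] show False using neq by (simp add: cJ)
    qed
    then obtain j where j: "j \<in> J" "r \<le> j" by (meson lessThan_iff not_le subsetI)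
    have jn: "j < n" "\<mu> j \<noteq> 0" using j(1) by (simp_all add: J_def)
    have "i < n" using i(1) r by simp
    then have "\<mu> i = 0" using i(2) by (simp add: J_def)
    then have "\<mu> i < \<mu> j" using \<mu>0[OF jn(1)] jn(2) by simp
    moreover have "lam j < lam i" using i(1) j(2) by (intro dec[OF _ jn(1)]) simp
    moreover note \<open>i < n\<close> jn(1)
    ultimately have ij: "i < n" "j < n" "\<mu> i < \<mu> j" "lam j < lam i" by blast+
    obtain \<epsilon> where \<epsilon>: "\<epsilon> > 0" "\<And>V. V \<in> fixed_rank n m r \<Longrightarrow> frob_dist V W < \<epsilon> \<Longrightarrow> loss1 n \<Sigma>0 \<tau> W \<le> loss1 n \<Sigma>0 \<tau> V"
      using loc unfolding local_minimizer_def by blast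
    obtain V where "V \<in> fixed_rank n m r" "frob_dist V W < \<epsilon>" "loss1 n \<Sigma>0 \<tau> V < loss1 n \<Sigma>0 \<tau> W"
      using rotation_decreases_loss[OF WC gram \<mu>0 ij \<epsilon>(1)] unfolding Wr by blast
    then show False using \<epsilon>(2)[of V] by linarith
  qed
  have iJ: "i < n \<and> \<mu> i \<noteq> 0 \<longleftrightarrow> i < r" for i
  proof -
    have "i \<in> J \<longleftrightarrow> i < r" unfolding J by simp
    then show ?thesis by (simp only: J_def mem_Collect_eq)
  qed
  have \<mu>r: "\<mu> i = lam i - \<tau>" if "i < r" for i using \<mu>[of i] iJ[of i] that by blast
  have \<mu>n: "\<mu> i = 0" if "r \<le> i" "i < n" for i using that iJ[of i] by linarith
  have "mat_diag n (\<lambda>i. \<mu> i + \<tau>) = four_block_mat (mat_diag r lam) (0\<^sub>m r (n - r))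
      (0\<^sub>m (n - r) r) (\<tau> \<cdot>\<^sub>m 1\<^sub>m (n - r))"
    by (rule eq_matI) (use r in \<open>auto simp: mat_diag_def \<mu>r \<mu>n\<close>)
  then show "reg_cov n \<tau> W = \<Omega> * four_block_mat (mat_diag r lam) (0\<^sub>m r (n - r))
      (0\<^sub>m (n - r) r) (\<tau> \<cdot>\<^sub>m 1\<^sub>m (n - r)) * \<Omega>\<^sup>T"
    using reg_cov_orth_diag[OF orth_Omega gram] by simp
  have "loss1 n \<Sigma>0 \<tau> W = (\<Sum>i<n. (sqrt (\<mu> i + \<tau>) - sqrt (lam i))\<^sup>2)"
    unfolding loss1_eq_bures[OF WC] reg_cov_orth_diag[OF orth_Omega gram]
    by (rule bures_commuting) (use \<mu>0 tau_pos in \<open>simp add: add_nonneg_pos\<close>)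
  \<comment> \<open>Selected directions match exactly, as there \<mu> i + \<tau> = lam i.\<close>
  also have "\<dots> = (\<Sum>i\<in>{r..<n}. (sqrt (\<mu> i + \<tau>) - sqrt (lam i))\<^sup>2)"
    by (rule sum.mono_neutral_right) (auto simp: \<mu>r not_le)
  also have "\<dots> = (\<Sum>i\<in>{r..<n}. (sqrt (lam i) - sqrt \<tau>)\<^sup>2)"
    by (rule sum.cong) (auto simp: \<mu>n power2_commute)
  finally have val: "loss1 n \<Sigma>0 \<tau> W = (\<Sum>i\<in>{r..<n}. (sqrt (lam i) - sqrt \<tau>)\<^sup>2)" .
  have "loss1 n \<Sigma>0 \<tau> W \<le> loss1 n \<Sigma>0 \<tau> V" if V: "V \<in> fixed_rank n m r" for V
    unfolding val
  proof (rule loss1_lower_bound[OF _ _ r])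
    show "V \<in> carrier_mat n m" "vec_space.rank n V \<le> r" using V by (auto simp: fixed_rank_def)
    show "lam j \<le> lam i" if "i \<le> j" "j < n" for i j using dec[of i j] that by (cases "i = j") auto
  qed (rule \<tau>)
  then show "is_arg_min (loss1 n \<Sigma>0 \<tau>) (\<lambda>V. V \<in> fixed_rank n m r) W"
    using W by (auto simp: is_arg_min_def not_less)
qed

end

subsection \<open>Curves in the fixed-rank manifolds\<close>

lemma differentiable_at_0_lipschitz:
  fixes f :: "real \<Rightarrow> real"
  assumes "f differentiable (at 0)"
  obtains L where "L \<ge> 0" "eventually (\<lambda>t. \<bar>f t - f 0\<bar> \<le> L * \<bar>t\<bar>) (at 0)"
proof -
  obtain D where "(f has_real_derivative D) (at 0)"
    using assms real_differentiable_def by blast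
  then have "((\<lambda>t. \<bar>(f t - f 0) / t\<bar>) \<longlongrightarrow> \<bar>D\<bar>) (at 0)"
    by (intro tendsto_rabs) (simp add: has_field_derivative_iff)
  then have ev: "eventually (\<lambda>t. \<bar>(f t - f 0) / t\<bar> < \<bar>D\<bar> + 1) (at 0)"
    by (rule order_tendstoD) simp
  have "eventually (\<lambda>t. \<bar>f t - f 0\<bar> \<le> (\<bar>D\<bar> + 1) * \<bar>t\<bar>) (at 0)"
    using ev
  proof eventually_elim
    case (elim t)
    then show ?case by (cases "t = 0") (auto simp: abs_divide divide_less_eq)
  qed
  then show ?thesis using that[of "\<bar>D\<bar> + 1"] by simp
qed

lemma curve_lipschitz:
  fixes \<gamma> :: "real \<Rightarrow> real mat"
  assumes \<gamma>: "\<And>t. \<gamma> t \<in> carrier_mat n m"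
    and diff: "\<And>i j. i < n \<Longrightarrow> j < m \<Longrightarrow> (\<lambda>t. \<gamma> t $$ (i, j)) differentiable (at 0)"
  obtains L where "L \<ge> 0" "eventually (\<lambda>t. frob_dist (\<gamma> t) (\<gamma> 0) \<le> L * \<bar>t\<bar>) (at 0)"
proof -
  \<comment> \<open>Every entry has its own Lipschitz constant; naming the property allows constants
    for all entries to be chosen at once.\<close>
  define ok where "ok i j L \<longleftrightarrow>
    0 \<le> L \<and> eventually (\<lambda>t. \<bar>\<gamma> t $$ (i, j) - \<gamma> 0 $$ (i, j)\<bar> \<le> L * \<bar>t\<bar>) (at 0)" for i j L
  define L where "L i j = (SOME x. ok i j x)" for i j
  have ok: "ok i j (L i j)" if "i < n" "j < m" for i j
    unfolding L_def
    by (rule someI_ex, rule differentiable_at_0_lipschitz[OF diff[OF that]]) (auto simp: ok_def)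
  have L: "\<And>i j. i < n \<Longrightarrow> j < m \<Longrightarrow> L i j \<ge> 0"
    "\<And>i j. i < n \<Longrightarrow> j < m \<Longrightarrow> eventually (\<lambda>t. \<bar>\<gamma> t $$ (i, j) - \<gamma> 0 $$ (i, j)\<bar> \<le> L i j * \<bar>t\<bar>) (at 0)"
    using ok unfolding ok_def by blast+
  have dims: "dim_row (\<gamma> t) = n" "dim_col (\<gamma> t) = m" for t using \<gamma>[of t] by auto
  have "eventually (\<lambda>t. \<forall>i\<in>{..<n}. \<forall>j\<in>{..<m}. \<bar>\<gamma> t $$ (i, j) - \<gamma> 0 $$ (i, j)\<bar> \<le> L i j * \<bar>t\<bar>) (at 0)"
    using L(2) by (intro eventually_ball_finite ballI finite_lessThan) auto
  then have "eventually (\<lambda>t. frob_dist (\<gamma> t) (\<gamma> 0) \<le> (\<Sum>i<n. \<Sum>j<m. L i j) * \<bar>t\<bar>) (at 0)"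
  proof eventually_elim
    case (elim t)
    have "frob_dist (\<gamma> t) (\<gamma> 0) \<le> (\<Sum>i<n. \<Sum>j<m. \<bar>(\<gamma> t - \<gamma> 0) $$ (i, j)\<bar>)"
      unfolding frob_dist_def using frob_norm_le_sum[of "\<gamma> t - \<gamma> 0"] by (simp add: dims)
    also have "\<dots> \<le> (\<Sum>i<n. \<Sum>j<m. L i j * \<bar>t\<bar>)"
      using elim by (intro sum_mono) (simp add: dims)
    finally show ?case by (simp add: sum_distrib_right)
  qed
  moreover have "0 \<le> (\<Sum>i<n. \<Sum>j<m. L i j)" using L(1) by (intro sum_nonneg) auto
  ultimately show ?thesis using that by blast
qed

text \<open>A curve differentiable at 0 moves at most linearly in |t|, and the orbit description
  turns this into multipliers \<open>A\<close> and \<open>B\<close> that are linear in |t|. So the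
  difference quotient of \<open>F\<close> along the curve tends to 0 for any \<open>F\<close> that
  satisfies the two-sided estimate.\<close>

lemma critical_fixed_rankI:
  assumes W: "W \<in> fixed_rank n m k"
    and crit: "\<And>\<epsilon>. \<epsilon> > 0 \<Longrightarrow> \<exists>\<delta>>0. \<forall>A\<in>carrier_mat n n. \<forall>B\<in>carrier_mat m m.
      frob_norm A + frob_norm B < \<delta> \<longrightarrow>
      \<bar>F ((1\<^sub>m n + A) * W * (1\<^sub>m m + B)) - F W\<bar> \<le> \<epsilon> * (frob_norm A + frob_norm B)"
  shows "critical_fixed_rank n m k F W"
  unfolding critical_fixed_rank_def
proof (intro conjI allI impI W)
  fix \<gamma> :: "real \<Rightarrow> real mat"
  assume "(\<forall>t. \<gamma> t \<in> fixed_rank n m k) \<and> \<gamma> 0 = W \<and>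
    (\<forall>i<n. \<forall>j<m. (\<lambda>t. \<gamma> t $$ (i, j)) differentiable (at 0))"
  then have \<gamma>: "\<And>t. \<gamma> t \<in> fixed_rank n m k" and \<gamma>0: "\<gamma> 0 = W"
    and diff: "\<And>i j. i < n \<Longrightarrow> j < m \<Longrightarrow> (\<lambda>t. \<gamma> t $$ (i, j)) differentiable (at 0)" by auto
  have \<gamma>C: "\<gamma> t \<in> carrier_mat n m" for t using \<gamma>[of t] by (simp add: fixed_rank_def)
  obtain L where L: "L \<ge> 0" "eventually (\<lambda>t. frob_dist (\<gamma> t) W \<le> L * \<bar>t\<bar>) (at 0)"
    using curve_lipschitz[OF \<gamma>C diff] unfolding \<gamma>0 by blast
  obtain \<delta>0 C where C: "\<delta>0 > 0" "C \<ge> 0"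
    "\<And>V. V \<in> fixed_rank n m k \<Longrightarrow> frob_dist V W < \<delta>0 \<Longrightarrow>
       \<exists>A\<in>carrier_mat n n. \<exists>B\<in>carrier_mat m m. V = (1\<^sub>m n + A) * W * (1\<^sub>m m + B) \<and>
         frob_norm A + frob_norm B \<le> C * frob_dist V W"
    using fixed_rank_orbit[OF W] by blast
  have "((\<lambda>t. (F (\<gamma> t) - F (\<gamma> 0)) / t) \<longlongrightarrow> 0) (at 0)"
  proof (rule tendstoI)
    fix \<epsilon> :: real assume "\<epsilon> > 0"
    \<comment> \<open>The added 1 makes division by \<open>c\<close> safe when the curve or the
      multipliers do not move.\<close>
    define c where "c = C * L + 1"
    define \<epsilon>' where "\<epsilon>' = \<epsilon> / (2 * c)"
    have CL: "c > 0" using C L by (simp add: c_def add_nonneg_pos)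
    have "\<epsilon>' > 0" using \<open>\<epsilon> > 0\<close> CL by (simp add: \<epsilon>'_def)
    then obtain \<delta>1 where \<delta>1: "\<delta>1 > 0" "\<And>A B. A \<in> carrier_mat n n \<Longrightarrow> B \<in> carrier_mat m m \<Longrightarrow>
        frob_norm A + frob_norm B < \<delta>1 \<Longrightarrow>
        \<bar>F ((1\<^sub>m n + A) * W * (1\<^sub>m m + B)) - F W\<bar> \<le> \<epsilon>' * (frob_norm A + frob_norm B)"
      using crit by blast
    have "((\<lambda>t. L * \<bar>t\<bar>) \<longlongrightarrow> L * \<bar>0\<bar>) (at 0)" by (intro tendsto_intros)
    then have e1: "eventually (\<lambda>t. L * \<bar>t\<bar> < \<delta>0) (at 0)"
      by (rule order_tendstoD) (use C in simp)
    have "((\<lambda>t. C * (L * \<bar>t\<bar>)) \<longlongrightarrow> C * (L * \<bar>0\<bar>)) (at 0)" by (intro tendsto_intros)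
    then have e2: "eventually (\<lambda>t. C * (L * \<bar>t\<bar>) < \<delta>1) (at 0)"
      by (rule order_tendstoD) (use \<delta>1 in simp)
    have e3: "eventually (\<lambda>t. t \<noteq> (0::real)) (at 0)" by (simp add: eventually_at_filter)
    from L(2) e1 e2 e3 show "eventually (\<lambda>t. dist ((F (\<gamma> t) - F (\<gamma> 0)) / t) 0 < \<epsilon>) (at 0)"
    proof eventually_elim
      case (elim t)
      then obtain A B where AB: "A \<in> carrier_mat n n" "B \<in> carrier_mat m m"
        "\<gamma> t = (1\<^sub>m n + A) * W * (1\<^sub>m m + B)" "frob_norm A + frob_norm B \<le> C * frob_dist (\<gamma> t) W"
        using C(3)[OF \<gamma>[of t]] by fastforce
      have le: "frob_norm A + frob_norm B \<le> C * (L * \<bar>t\<bar>)"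
        using AB(4) mult_left_mono[OF elim(1) C(2)] by linarith
      have "\<bar>F (\<gamma> t) - F W\<bar> \<le> \<epsilon>' * (frob_norm A + frob_norm B)"
        unfolding AB(3) by (rule \<delta>1(2)[OF AB(1,2)]) (use le elim in linarith)
      also have "\<dots> \<le> \<epsilon>' * (C * (L * \<bar>t\<bar>))" using le \<open>\<epsilon>' > 0\<close> by simp
      also have "\<dots> \<le> \<epsilon>' * (c * \<bar>t\<bar>)"
        using \<open>\<epsilon>' > 0\<close> by (intro mult_left_mono) (auto simp: c_def algebra_simps)
      also have "\<dots> = \<epsilon> / 2 * \<bar>t\<bar>" using CL by (simp add: \<epsilon>'_def)
      also have "\<dots> < \<epsilon> * \<bar>t\<bar>" using \<open>\<epsilon> > 0\<close> elim by simp
      finally show ?case using elim by (simp add: \<gamma>0 dist_real_def abs_divide divide_less_eq)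
    qed
  qed
  then show "((\<lambda>t. F (\<gamma> t)) has_real_derivative 0) (at 0)" by (simp add: has_field_derivative_iff)
qed

subsection \<open>Layered parametrization\<close>

lemma params_layer: "W \<in> params N d \<Longrightarrow> 1 \<le> j \<Longrightarrow> j \<le> N \<Longrightarrow> W j \<in> carrier_mat (d j) (d (j - 1))"
  by (auto simp: params_def)

lemma params_update:
  "W \<in> params N d \<Longrightarrow> 1 \<le> j \<Longrightarrow> j \<le> N \<Longrightarrow> X \<in> carrier_mat (d j) (d (j - 1)) \<Longrightarrow> W(j := X) \<in> params N d"
  by (auto simp: params_def PiE_def extensional_def Pi_def)

lemma layer_prod_carrier:
  assumes "W \<in> params N d" "j \<le> N"
  shows "layer_prod d j W \<in> carrier_mat (d j) (d 0)"
  using assms(2)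
proof (induction j)
  case (Suc j)
  then show ?case using params_layer[OF assms(1), of "Suc j"] by simp
qed simp

lemma layer_prod_cong: "(\<And>i. 1 \<le> i \<Longrightarrow> i \<le> j \<Longrightarrow> V i = W i) \<Longrightarrow> layer_prod d j V = layer_prod d j W"
  by (induction j) auto

lemma layer_prod_update_first:
  assumes W: "W \<in> params N d" and X: "X \<in> carrier_mat (d 0) (d 0)" and j: "1 \<le> j" "j \<le> N"
  shows "layer_prod d j (W(1 := W 1 * X)) = layer_prod d j W * X"
  using j
proof (induction j)
  case (Suc j)
  have Wj: "W (Suc j) \<in> carrier_mat (d (Suc j)) (d j)" using params_layer[OF W, of "Suc j"] Suc by simp
  have Lj: "layer_prod d j W \<in> carrier_mat (d j) (d 0)" using layer_prod_carrier[OF W, of j] Suc by simp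
  show ?case
  proof (cases "j = 0")
    case True
    then show ?thesis using Wj X by simp
  next
    case False
    then show ?thesis using Suc Wj Lj X by (simp add: mat_mult_assoc)
  qed
qed simp

lemma layer_prod_update_last:
  assumes W: "W \<in> params N d" and Y: "Y \<in> carrier_mat (d N) (d N)" and N: "1 \<le> N"
  shows "layer_prod d N (W(N := Y * W N)) = Y * layer_prod d N W"
proof -
  obtain N' where N': "N = Suc N'" using N by (cases N) auto
  have "layer_prod d N' (W(N := Y * W N)) = layer_prod d N' W"
    by (rule layer_prod_cong) (auto simp: N')
  then show ?thesis
    using params_layer[OF W, of N] layer_prod_carrier[OF W, of N'] Y by (simp add: N' mat_mult_assoc)
qed

lemma params_dist_L2: "params_dist N V W = L2_set (\<lambda>j. frob_dist (V j) (W j)) {1..N}"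
  by (simp add: params_dist_def L2_set_def)

lemma frob_dist_nonneg [simp]: "0 \<le> frob_dist A B"
  by (simp add: frob_dist_def)

lemma params_dist_nonneg [simp]: "0 \<le> params_dist N V W"
  by (simp add: params_dist_L2)

lemma frob_dist_self [simp]: "frob_dist A A = 0"
  by (simp add: frob_dist_def frob_norm_def)

lemma params_dist_update:
  assumes "1 \<le> j" "j \<le> N"
  shows "params_dist N (W(j := X)) W \<le> frob_dist X (W j)"
proof -
  have "params_dist N (W(j := X)) W \<le> (\<Sum>l\<in>{1..N}. frob_dist ((W(j := X)) l) (W l))"
    unfolding params_dist_L2 by (rule L2_set_le_sum) simp
  also have "\<dots> = (\<Sum>l\<in>{1..N}. if l = j then frob_dist X (W j) else 0)"
    by (intro sum.cong) auto
  also have "\<dots> = frob_dist X (W j)" using assms by simp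
  finally show ?thesis .
qed

lemma params_dist_triangle:
  assumes U: "U \<in> params N d" and V: "V \<in> params N d" and W: "W \<in> params N d"
  shows "params_dist N U W \<le> params_dist N U V + params_dist N V W"
proof -
  have "params_dist N U W \<le> L2_set (\<lambda>j. frob_dist (U j) (V j) + frob_dist (V j) (W j)) {1..N}"
    unfolding params_dist_L2
  proof (rule L2_set_mono)
    fix j assume "j \<in> {1..N}"
    then have d: "U j \<in> carrier_mat (d j) (d (j - 1))" "V j \<in> carrier_mat (d j) (d (j - 1))"
      "W j \<in> carrier_mat (d j) (d (j - 1))"
      using params_layer[OF U] params_layer[OF V] params_layer[OF W] by auto
    have "U j - W j = (U j - V j) + (V j - W j)"
      by (rule eq_matI) (use d in auto)
    then show "frob_dist (U j) (W j) \<le> frob_dist (U j) (V j) + frob_dist (V j) (W j)"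
      unfolding frob_dist_def using frob_norm_triangle[of "V j - W j" "U j - V j"] d by simp
  qed simp
  also have "\<dots> \<le> params_dist N U V + params_dist N V W"
    unfolding params_dist_L2 by (rule L2_set_triangle_ineq)
  finally show ?thesis .
qed

text \<open>The first layer absorbs the right factor and the last layer the left one. The second
  update acts on the already updated tuple, so \<open>N = 1\<close> is covered, where both factors
  land on the same layer.\<close>

lemma lift_two_sided:
  assumes W: "W \<in> params N d" and N: "1 \<le> N"
  obtains K where "K \<ge> 0"
    "\<And>A B. A \<in> carrier_mat (d N) (d N) \<Longrightarrow> B \<in> carrier_mat (d 0) (d 0) \<Longrightarrow> frob_norm B \<le> 1 \<Longrightarrow>
      \<exists>V\<in>params N d. layer_prod d N V = (1\<^sub>m (d N) + A) * layer_prod d N W * (1\<^sub>m (d 0) + B) \<and>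
        params_dist N V W \<le> K * (frob_norm A + frob_norm B)"
proof -
  \<comment> \<open>The factor 2 covers \<open>N = 1\<close>: there the last layer has already been
    multiplied by \<open>1\<^sub>m (d 0) + B\<close>, with the norm of \<open>B\<close> at most
    1.\<close>
  define K where "K = 2 * frob_norm (W N) + frob_norm (W 1)"
  have "K \<ge> 0" by (simp add: K_def)
  moreover have "\<exists>V\<in>params N d. layer_prod d N V = (1\<^sub>m (d N) + A) * layer_prod d N W * (1\<^sub>m (d 0) + B) \<and>
        params_dist N V W \<le> K * (frob_norm A + frob_norm B)"
    if A: "A \<in> carrier_mat (d N) (d N)" and B: "B \<in> carrier_mat (d 0) (d 0)" and B1: "frob_norm B \<le> 1" for A B
  proof -
    have [simp]: "dim_row A = d N" "dim_col A = d N" "dim_row B = d 0" "dim_col B = d 0" using A B by auto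
    have "W 1 \<in> carrier_mat (d 1) (d (1 - 1))" by (rule params_layer[OF W]) (use N in auto)
    then have W1: "W 1 \<in> carrier_mat (d 1) (d 0)" by simp
    note [simp] = carrier_matD[OF W1] carrier_matD[OF W1[unfolded One_nat_def]]
    define U where "U = W(1 := W 1 * (1\<^sub>m (d 0) + B))"
    have UP: "U \<in> params N d" unfolding U_def
      by (rule params_update[OF W order_refl N carrier_matI]) simp_all
    have UN: "U N \<in> carrier_mat (d N) (d (N - 1))" by (rule params_layer[OF UP N]) simp
    then have [simp]: "dim_row (U N) = d N" "dim_col (U N) = d (N - 1)" by (rule carrier_matD)+
    define V where "V = U(N := (1\<^sub>m (d N) + A) * U N)"
    have VP: "V \<in> params N d" unfolding V_def
      by (rule params_update[OF UP N order_refl carrier_matI]) simp_all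
    have LC: "layer_prod d N W \<in> carrier_mat (d N) (d 0)" by (rule layer_prod_carrier[OF W]) simp
    have LU: "layer_prod d N U = layer_prod d N W * (1\<^sub>m (d 0) + B)"
      unfolding U_def by (rule layer_prod_update_first[OF W _ N]) (simp_all add: carrier_matI)
    have "layer_prod d N V = (1\<^sub>m (d N) + A) * layer_prod d N U"
      unfolding V_def by (rule layer_prod_update_last[OF UP _ N]) (simp add: carrier_matI)
    also have "\<dots> = (1\<^sub>m (d N) + A) * layer_prod d N W * (1\<^sub>m (d 0) + B)"
      unfolding LU using carrier_matD[OF LC] by (simp add: mat_mult_assoc)
    finally have LV: "layer_prod d N V = (1\<^sub>m (d N) + A) * layer_prod d N W * (1\<^sub>m (d 0) + B)" .
    have WB: "frob_norm (W 1 * B) \<le> frob_norm (W 1) * frob_norm B" by (rule frob_norm_mult) simp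
    have U1: "W 1 * (1\<^sub>m (d 0) + B) = W 1 + W 1 * B" by (simp add: mat_mult_add_right mat_mult_one_right)
    have "params_dist N U W \<le> frob_dist (W 1 * (1\<^sub>m (d 0) + B)) (W 1)"
      unfolding U_def by (rule params_dist_update) (use N in auto)
    also have "W 1 * (1\<^sub>m (d 0) + B) - W 1 = W 1 * B"
      unfolding U1 by (rule eq_matI) (simp_all del: index_mult_mat(1))
    then have "frob_dist (W 1 * (1\<^sub>m (d 0) + B)) (W 1) = frob_norm (W 1 * B)" by (simp add: frob_dist_def)
    finally have UW: "params_dist N U W \<le> frob_norm (W 1) * frob_norm B" using WB by linarith
    have nU: "frob_norm (U N) \<le> 2 * frob_norm (W N)"
    proof (cases "N = 1")
      case True
      then have "frob_norm (U N) = frob_norm (W 1 + W 1 * B)" unfolding U1[symmetric] by (simp add: U_def)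
      also have "\<dots> \<le> frob_norm (W 1) + frob_norm (W 1 * B)" by (rule frob_norm_triangle) simp_all
      also have "frob_norm (W 1 * B) \<le> frob_norm (W 1) * 1"
        using WB mult_left_mono[OF B1 frob_norm_nonneg[of "W 1"]] by linarith
      finally show ?thesis using True by simp
    qed (simp add: U_def)
    have "params_dist N V U \<le> frob_dist ((1\<^sub>m (d N) + A) * U N) (U N)"
      unfolding V_def by (rule params_dist_update[OF N]) simp
    also have "(1\<^sub>m (d N) + A) * U N - U N = A * U N"
      by (rule eq_matI) (simp_all add: mat_mult_add_left mat_mult_one_left del: index_mult_mat(1))
    then have "frob_dist ((1\<^sub>m (d N) + A) * U N) (U N) = frob_norm (A * U N)" by (simp add: frob_dist_def)
    also have "\<dots> \<le> frob_norm A * frob_norm (U N)" by (rule frob_norm_mult) simp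
    also have "\<dots> \<le> frob_norm A * (2 * frob_norm (W N))" by (rule mult_left_mono[OF nU]) simp
    finally have "params_dist N V W \<le> frob_norm A * (2 * frob_norm (W N)) + frob_norm (W 1) * frob_norm B"
      using UW params_dist_triangle[OF VP UP W] by linarith
    also have "\<dots> \<le> K * (frob_norm A + frob_norm B)"
      unfolding K_def by (simp add: algebra_simps)
    finally show ?thesis using VP LV by blast
  qed
  ultimately show ?thesis using that by blast
qed

text \<open>This replaces the chain rule: the vanishing differential on parameters is evaluated at
  lifts, whose distance is linear in the multipliers, so only the tolerance is rescaled.\<close>

lemma critical_params_two_sided:
  assumes crit: "critical_params N d (\<lambda>V. F (layer_prod d N V)) W" and N: "1 \<le> N" and \<epsilon>: "\<epsilon> > 0"
  shows "\<exists>\<delta>>0. \<forall>A\<in>carrier_mat (d N) (d N). \<forall>B\<in>carrier_mat (d 0) (d 0). frob_norm A + frob_norm B < \<delta> \<longrightarrow>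
      \<bar>F ((1\<^sub>m (d N) + A) * layer_prod d N W * (1\<^sub>m (d 0) + B)) - F (layer_prod d N W)\<bar>
        \<le> \<epsilon> * (frob_norm A + frob_norm B)"
proof -
  have W: "W \<in> params N d" using crit by (simp add: critical_params_def)
  obtain K where K: "K \<ge> 0"
    "\<And>A B. A \<in> carrier_mat (d N) (d N) \<Longrightarrow> B \<in> carrier_mat (d 0) (d 0) \<Longrightarrow> frob_norm B \<le> 1 \<Longrightarrow>
      \<exists>V\<in>params N d. layer_prod d N V = (1\<^sub>m (d N) + A) * layer_prod d N W * (1\<^sub>m (d 0) + B) \<and>
        params_dist N V W \<le> K * (frob_norm A + frob_norm B)"
    using lift_two_sided[OF W N] by blast
  have "\<epsilon> / (K + 1) > 0" using \<epsilon> K(1) by simp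
  then obtain \<delta> where \<delta>: "\<delta> > 0" "\<And>V. V \<in> params N d \<Longrightarrow> params_dist N V W < \<delta> \<Longrightarrow>
      \<bar>F (layer_prod d N V) - F (layer_prod d N W)\<bar> \<le> \<epsilon> / (K + 1) * params_dist N V W"
    using crit unfolding critical_params_def by blast
  show ?thesis
  \<comment> \<open>The bound 1 is what the lift demands of \<open>B\<close>; \<open>K + 1\<close>
    is used because \<open>K\<close> may be 0.\<close>
  proof (intro exI[of _ "min 1 (\<delta> / (K + 1))"] conjI ballI impI)
    show "0 < min 1 (\<delta> / (K + 1))" using \<delta>(1) K(1) by simp
    fix A B assume A: "A \<in> carrier_mat (d N) (d N)" and B: "B \<in> carrier_mat (d 0) (d 0)"
      and small: "frob_norm A + frob_norm B < min 1 (\<delta> / (K + 1))"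
    let ?x = "frob_norm A + frob_norm B"
    have "frob_norm B \<le> 1" using small frob_norm_nonneg[of A] by linarith
    then obtain V where V: "V \<in> params N d"
      "layer_prod d N V = (1\<^sub>m (d N) + A) * layer_prod d N W * (1\<^sub>m (d 0) + B)" "params_dist N V W \<le> K * ?x"
      using K(2)[OF A B] by blast
    have "params_dist N V W \<le> (K + 1) * ?x" 
      by (rule order_trans[OF V(3) mult_right_mono]) simp_all
    also have "\<dots> < \<delta>" using small K(1) by (simp add: pos_less_divide_eq mult.commute)
    finally have "\<bar>F (layer_prod d N V) - F (layer_prod d N W)\<bar> \<le> \<epsilon> / (K + 1) * params_dist N V W"
      by (rule \<delta>(2)[OF V(1)])
    also have "\<dots> \<le> \<epsilon> / (K + 1) * ((K + 1) * ?x)"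
      using \<open>params_dist N V W \<le> (K + 1) * ?x\<close> \<open>\<epsilon> / (K + 1) > 0\<close> by (intro mult_left_mono) auto
    also have "\<dots> = \<epsilon> * ?x" using K(1) by simp
    finally show "\<bar>F ((1\<^sub>m (d N) + A) * layer_prod d N W * (1\<^sub>m (d 0) + B)) - F (layer_prod d N W)\<bar> \<le> \<epsilon> * ?x"
      unfolding V(2) .
  qed
qed

text \<open>Near the product, every matrix of the same rank is the image of nearby parameters, so it
  cannot have a smaller value of \<open>F\<close>. This is openness of the parametrization onto the
  manifold, and it holds for each \<open>k\<close>.\<close>

lemma local_minimizer_params_imp_fixed_rank:
  assumes loc: "local_minimizer (params_dist N) (params N d) (\<lambda>V. F (layer_prod d N V)) W"
    and N: "1 \<le> N" and k: "layer_prod d N W \<in> fixed_rank (d N) (d 0) k"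
  shows "local_minimizer frob_dist (fixed_rank (d N) (d 0) k) F (layer_prod d N W)"
proof -
  obtain \<epsilon> where W: "W \<in> params N d" and \<epsilon>: "\<epsilon> > 0"
    "\<And>V. V \<in> params N d \<Longrightarrow> params_dist N V W < \<epsilon> \<Longrightarrow> F (layer_prod d N W) \<le> F (layer_prod d N V)"
    using loc unfolding local_minimizer_def by blast
  obtain K where K: "K \<ge> 0"
    "\<And>A B. A \<in> carrier_mat (d N) (d N) \<Longrightarrow> B \<in> carrier_mat (d 0) (d 0) \<Longrightarrow> frob_norm B \<le> 1 \<Longrightarrow>
      \<exists>V\<in>params N d. layer_prod d N V = (1\<^sub>m (d N) + A) * layer_prod d N W * (1\<^sub>m (d 0) + B) \<and>
        params_dist N V W \<le> K * (frob_norm A + frob_norm B)"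
    using lift_two_sided[OF W N] by blast
  obtain \<delta> C where C: "\<delta> > 0" "C \<ge> 0"
    "\<And>V. V \<in> fixed_rank (d N) (d 0) k \<Longrightarrow> frob_dist V (layer_prod d N W) < \<delta> \<Longrightarrow>
       \<exists>A\<in>carrier_mat (d N) (d N). \<exists>B\<in>carrier_mat (d 0) (d 0).
         V = (1\<^sub>m (d N) + A) * layer_prod d N W * (1\<^sub>m (d 0) + B) \<and>
         frob_norm A + frob_norm B \<le> C * frob_dist V (layer_prod d N W)"
    using fixed_rank_orbit[OF k] by blast
  \<comment> \<open>In turn: the radius of the orbit description, the bound 1 on \<open>B\<close>
    required by the lift, and the requirement that the lifted parameters lie within
    \<epsilon>.\<close>
  define \<eta> where "\<eta> = min \<delta> (min (1 / (C + 1)) (\<epsilon> / ((K + 1) * (C + 1))))"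
  have "\<eta> > 0" using C K \<epsilon> by (simp add: \<eta>_def)
  moreover have "F (layer_prod d N W) \<le> F X"
    if X: "X \<in> fixed_rank (d N) (d 0) k" and close: "frob_dist X (layer_prod d N W) < \<eta>" for X
  proof -
    let ?x = "frob_dist X (layer_prod d N W)"
    obtain A B where A: "A \<in> carrier_mat (d N) (d N)" and B: "B \<in> carrier_mat (d 0) (d 0)"
      and AB: "X = (1\<^sub>m (d N) + A) * layer_prod d N W * (1\<^sub>m (d 0) + B)" "frob_norm A + frob_norm B \<le> C * ?x"
      using C(3)[OF X] close unfolding \<eta>_def by fastforce
    have x: "frob_norm A + frob_norm B \<le> (C + 1) * ?x" 
      by (rule order_trans[OF AB(2) mult_right_mono]) simp_all
    have "?x < 1 / (C + 1)" "?x < \<epsilon> / ((K + 1) * (C + 1))" using close by (simp_all add: \<eta>_def)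
    then have small: "(C + 1) * ?x < 1" "(K + 1) * ((C + 1) * ?x) < \<epsilon>"
      using C(2) K(1) by (simp_all add: pos_less_divide_eq mult_ac)
    have "frob_norm B \<le> 1" using x small(1) frob_norm_nonneg[of A] by linarith
    then obtain V where V: "V \<in> params N d" "layer_prod d N V = X"
      "params_dist N V W \<le> K * (frob_norm A + frob_norm B)"
      using K(2)[OF A B] AB(1) by metis
    have "params_dist N V W \<le> (K + 1) * (frob_norm A + frob_norm B)"
      by (rule order_trans[OF V(3) mult_right_mono]) simp_all
    also have "\<dots> \<le> (K + 1) * ((C + 1) * ?x)" using x K(1) by (intro mult_left_mono) auto
    also have "\<dots> < \<epsilon>" by (rule small(2))
    finally show ?thesis using \<epsilon>(2)[OF V(1)] V(2) by simp
  qed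
  ultimately show ?thesis using k unfolding local_minimizer_def by blast
qed

section \<open>Continuity and maximal rank of the product\<close>

lemma layer_prod_continuous:
  assumes W: "W \<in> params N d" and j: "j \<le> N" and \<epsilon>: "\<epsilon> > 0"
  shows "\<exists>\<delta>>0. \<forall>V\<in>params N d. params_dist N V W < \<delta> \<longrightarrow>
    frob_dist (layer_prod d j V) (layer_prod d j W) < \<epsilon>"
  using j \<epsilon>
proof (induction j arbitrary: \<epsilon>)
  case 0
  then show ?case by (intro exI[of _ 1]) simp
next
  case (Suc j)
  let ?L = "layer_prod d j W"
  \<comment> \<open>Bounds the new layer as long as it stays within distance 1 of the old one;
    \<open>b\<close> exceeds the norm of the old partial product. Each half of the error then gets
    \<epsilon> / 2.\<close>
  define a where "a = frob_norm (W (Suc j)) + 1"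
  define b where "b = frob_norm ?L + 1"
  have a: "a > 0" and b: "b > 0" unfolding a_def b_def
    using frob_norm_nonneg[of "W (Suc j)"] frob_norm_nonneg[of ?L] by linarith+
  have "\<epsilon> / (2 * a) > 0" using Suc.prems a by simp
  then obtain \<delta> where \<delta>: "\<delta> > 0" "\<And>V. V \<in> params N d \<Longrightarrow> params_dist N V W < \<delta> \<Longrightarrow>
      frob_dist (layer_prod d j V) ?L < \<epsilon> / (2 * a)"
    using Suc.IH[of "\<epsilon> / (2 * a)"] Suc.prems(1) by auto
  define \<eta> where "\<eta> = min \<delta> (min 1 (\<epsilon> / (2 * b)))"
  have "\<eta> > 0" using \<delta>(1) b Suc.prems by (simp add: \<eta>_def)
  moreover have "frob_dist (layer_prod d (Suc j) V) (layer_prod d (Suc j) W) < \<epsilon>"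
    if V: "V \<in> params N d" and close: "params_dist N V W < \<eta>" for V
  proof -
    let ?M = "layer_prod d j V"
    have "?L \<in> carrier_mat (d j) (d 0)" "?M \<in> carrier_mat (d j) (d 0)"
      using layer_prod_carrier[OF W, of j] layer_prod_carrier[OF V, of j] Suc.prems by simp_all
    moreover have "W (Suc j) \<in> carrier_mat (d (Suc j)) (d j)" "V (Suc j) \<in> carrier_mat (d (Suc j)) (d j)"
      using params_layer[OF W, of "Suc j"] params_layer[OF V, of "Suc j"] Suc.prems by simp_all
    ultimately have [simp]: "dim_row ?L = d j" "dim_col ?L = d 0" "dim_row ?M = d j" "dim_col ?M = d 0"
      "dim_row (W (Suc j)) = d (Suc j)" "dim_col (W (Suc j)) = d j"
      "dim_row (V (Suc j)) = d (Suc j)" "dim_col (V (Suc j)) = d j" by (auto dest: carrier_matD)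
    have "frob_dist (V (Suc j)) (W (Suc j)) \<le> params_dist N V W"
      unfolding params_dist_L2
      using member_le_L2_set[of "{1..N}" "Suc j" "\<lambda>j. frob_dist (V j) (W j)"] Suc.prems by simp
    then have e: "frob_norm (V (Suc j) - W (Suc j)) < 1" "frob_norm (V (Suc j) - W (Suc j)) < \<epsilon> / (2 * b)"
      using close by (simp_all add: \<eta>_def frob_dist_def)
    have f: "frob_norm (?M - ?L) < \<epsilon> / (2 * a)"
      using \<delta>(2)[OF V] close by (simp add: \<eta>_def frob_dist_def)
    have "frob_norm (V (Suc j)) \<le> frob_norm (W (Suc j)) + frob_norm (V (Suc j) - W (Suc j))"
    proof -
      have "V (Suc j) = W (Suc j) + (V (Suc j) - W (Suc j))" by (rule eq_matI) simp_all
      then show ?thesis using frob_norm_triangle[of "V (Suc j) - W (Suc j)" "W (Suc j)"] by simp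
    qed
    then have nV: "frob_norm (V (Suc j)) \<le> a" using e(1) by (simp add: a_def)
    \<comment> \<open>The product rule for differences, changing one factor at a time.\<close>
    have "V (Suc j) * ?M - W (Suc j) * ?L = V (Suc j) * (?M - ?L) + (V (Suc j) - W (Suc j)) * ?L"
      unfolding mat_mult_diff_right[of "V (Suc j)" ?M ?L, simplified] mat_mult_diff_left[of "V (Suc j)" ?L "W (Suc j)", simplified]
      by (rule eq_matI) (simp_all del: index_mult_mat(1))
    then have "frob_dist (layer_prod d (Suc j) V) (layer_prod d (Suc j) W)
        \<le> frob_norm (V (Suc j) * (?M - ?L)) + frob_norm ((V (Suc j) - W (Suc j)) * ?L)"
      using frob_norm_triangle[of "(V (Suc j) - W (Suc j)) * ?L" "V (Suc j) * (?M - ?L)"]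
      by (simp add: frob_dist_def)
    also have "frob_norm (V (Suc j) * (?M - ?L)) \<le> frob_norm (V (Suc j)) * frob_norm (?M - ?L)"
      by (rule frob_norm_mult) simp
    also have "\<dots> \<le> a * frob_norm (?M - ?L)" by (rule mult_right_mono[OF nV]) simp
    also have "\<dots> < a * (\<epsilon> / (2 * a))" by (rule mult_strict_left_mono[OF f a])
    also have "\<dots> = \<epsilon> / 2" using a by simp
    also have "frob_norm ((V (Suc j) - W (Suc j)) * ?L) \<le> frob_norm (V (Suc j) - W (Suc j)) * frob_norm ?L"
      by (rule frob_norm_mult) simp
    also have "\<dots> \<le> \<epsilon> / (2 * b) * b"
      using e(2) b Suc.prems by (intro mult_mono) (auto simp: b_def)
    also have "\<dots> = \<epsilon> / 2" using b by simp
    finally show ?thesis by simp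
  qed
  ultimately show ?case by blast
qed

text \<open>The product factors through the space of dimension \<open>d j\<close>; the left cofactor
  is built up from layer \<open>j\<close> to layer \<open>N\<close>.\<close>

lemma rank_layer_prod_le:
  assumes W: "W \<in> params N d" and j: "j \<le> N"
  shows "vec_space.rank (d N) (layer_prod d N W) \<le> d j"
proof -
  have Lj: "layer_prod d j W \<in> carrier_mat (d j) (d 0)" by (rule layer_prod_carrier[OF W j])
  have "l \<le> N \<longrightarrow> (\<exists>C\<in>carrier_mat (d l) (d j). layer_prod d l W = C * layer_prod d j W)" if "j \<le> l" for l
    using that
  proof (induction l rule: dec_induct)
    case base
    show ?case using left_mult_one_mat[OF Lj] by (intro impI bexI[of _ "1\<^sub>m (d j)"]) simp_all
  next
    case (step l)
    show ?case
    proof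
      assume l: "Suc l \<le> N"
      then obtain C where C: "C \<in> carrier_mat (d l) (d j)" "layer_prod d l W = C * layer_prod d j W"
        using step by auto
      have Wl: "W (Suc l) \<in> carrier_mat (d (Suc l)) (d l)" using params_layer[OF W, of "Suc l"] l by simp
      have "layer_prod d (Suc l) W = (W (Suc l) * C) * layer_prod d j W"
        using assoc_mult_mat[OF Wl C(1) Lj] by (simp add: C(2))
      then show "\<exists>C\<in>carrier_mat (d (Suc l)) (d j). layer_prod d (Suc l) W = C * layer_prod d j W"
        using mult_carrier_mat[OF Wl C(1)] by blast
    qed
  qed
  from this[OF j] obtain C where "C \<in> carrier_mat (d N) (d j)" "layer_prod d N W = C * layer_prod d j W" by auto
  then show ?thesis using rank_mult_le_inner[OF _ Lj, of C "d N"] by simp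
qed

text \<open>The minimal width is the largest rank a product can have, and near a matrix of that rank
  the rank cannot drop. So all nearby parameters map into the manifold, and continuity
  finishes.\<close>

lemma local_minimizer_fixed_rank_imp_params:
  assumes W: "W \<in> params N d"
    and loc: "local_minimizer frob_dist (fixed_rank (d N) (d 0) (Min (d ` {0..N}))) F (layer_prod d N W)"
  shows "local_minimizer (params_dist N) (params N d) (\<lambda>V. F (layer_prod d N V)) W"
proof -
  let ?r = "Min (d ` {0..N})"
  obtain \<epsilon> where k: "layer_prod d N W \<in> fixed_rank (d N) (d 0) ?r" and \<epsilon>: "\<epsilon> > 0"
    "\<And>X. X \<in> fixed_rank (d N) (d 0) ?r \<Longrightarrow> frob_dist X (layer_prod d N W) < \<epsilon> \<Longrightarrow> F (layer_prod d N W) \<le> F X"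
    using loc unfolding local_minimizer_def by blast
  have LC: "layer_prod d N W \<in> carrier_mat (d N) (d 0)" by (rule layer_prod_carrier[OF W]) simp
  obtain \<eta> where \<eta>: "\<eta> > 0" "\<And>X. X \<in> carrier_mat (d N) (d 0) \<Longrightarrow> frob_dist X (layer_prod d N W) < \<eta> \<Longrightarrow>
      vec_space.rank (d N) (layer_prod d N W) \<le> vec_space.rank (d N) X"
    using rank_lower_semicontinuous[OF LC] by blast
  obtain \<delta> where \<delta>: "\<delta> > 0" "\<And>V. V \<in> params N d \<Longrightarrow> params_dist N V W < \<delta> \<Longrightarrow>
      frob_dist (layer_prod d N V) (layer_prod d N W) < min \<epsilon> \<eta>"
    using layer_prod_continuous[OF W order_refl, of "min \<epsilon> \<eta>"] \<epsilon>(1) \<eta>(1) by auto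
  have "F (layer_prod d N W) \<le> F (layer_prod d N V)" if V: "V \<in> params N d" and close: "params_dist N V W < \<delta>" for V
  proof (rule \<epsilon>(2))
    have VC: "layer_prod d N V \<in> carrier_mat (d N) (d 0)" by (rule layer_prod_carrier[OF V]) simp
    have "vec_space.rank (d N) (layer_prod d N V) \<le> ?r"
      using rank_layer_prod_le[OF V] by (subst Min_ge_iff) auto
    moreover have "?r \<le> vec_space.rank (d N) (layer_prod d N V)"
      using \<eta>(2)[OF VC] \<delta>(2)[OF V close] k by (simp add: fixed_rank_def)
    ultimately have "vec_space.rank (d N) (layer_prod d N V) = ?r" by (rule antisym)
    then show "layer_prod d N V \<in> fixed_rank (d N) (d 0) ?r"
      unfolding fixed_rank_def using VC by blast
    show "frob_dist (layer_prod d N V) (layer_prod d N W) < \<epsilon>" using \<delta>(2)[OF V close] by simp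
  qed
  then show ?thesis using W \<delta>(1) unfolding local_minimizer_def by blast
qed

theorem proposition4p6:
  fixes N n m :: nat
    and d :: "nat \<Rightarrow> nat"
    and \<Sigma>0 \<Omega> :: "real mat"
    and lam :: "nat \<Rightarrow> real"
    and \<tau> :: real
    and W :: "nat \<Rightarrow> real mat"
  assumes "N \<ge> 1"
    and "\<forall>j\<le>N. d j \<ge> 1"
    and "d 0 = m" and "d N = n"
    and "pos_def n \<Sigma>0"
    and "\<Omega> \<in> carrier_mat n n" and "\<Omega>\<^sup>T * \<Omega> = 1\<^sub>m n"
    and "\<Sigma>0 = \<Omega> * mat_diag n lam * \<Omega>\<^sup>T"
    and "\<forall>i j. i < j \<and> j < n \<longrightarrow> lam j < lam i" and "lam (n - 1) > 0"
    and "0 < \<tau>" and "\<tau> \<le> lam (n - 1)"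
    and "critical_params N d (lossN N d \<Sigma>0 \<tau>) W"
  shows
    "let W' = layer_prod d N W; k = vec_space.rank n W'; r = Min (d ` {0..N}) in
       critical_fixed_rank n m k (loss1 n \<Sigma>0 \<tau>) W' \<and>
       (k = r \<longrightarrow>
          (local_minimizer (params_dist N) (params N d) (lossN N d \<Sigma>0 \<tau>) W \<longleftrightarrow>
             local_minimizer frob_dist (fixed_rank n m r) (loss1 n \<Sigma>0 \<tau>) W') \<and>
          (local_minimizer frob_dist (fixed_rank n m r) (loss1 n \<Sigma>0 \<tau>) W' \<longrightarrow>
             is_arg_min (loss1 n \<Sigma>0 \<tau>) (\<lambda>V. V \<in> fixed_rank n m r) W' \<and>
             reg_cov n \<tau> W' =
               \<Omega> * four_block_mat (mat_diag r lam) (0\<^sub>m r (n - r))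
                                   (0\<^sub>m (n - r) r) (\<tau> \<cdot>\<^sub>m 1\<^sub>m (n - r)) * \<Omega>\<^sup>T))"
proof -
  define f where "f = loss1 n \<Sigma>0 \<tau>"
  define W' where "W' = layer_prod d N W"
  define r where "r = Min (d ` {0..N})"
  have dec: "lam j < lam i" if "i < j" "j < n" for i j using assms(9) that by blast
  \<comment> \<open>Eigenvalues are indexed from 0, so \<open>lam (n - 1)\<close> is the smallest
    one; positivity and the bound on \<tau> spread from it to all others.\<close>
  have last: "lam (n - 1) \<le> lam i" if "i < n" for i
  proof (cases "i < n - 1")
    case True
    then show ?thesis using dec[OF True] that by simp
  next
    case False
    then have "i = n - 1" using that by linarith
    then show ?thesis by simp
  qed
  interpret bures_reg n \<Omega> \<Sigma>0 lam \<tau>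
  proof
    show "orth n \<Omega>" using assms(6,7) by (rule orthI)
    show "0 < lam i" if "i < n" for i using last[OF that] assms(10) by linarith
  qed (use assms(8,11) in auto)
  have lossN: "lossN N d \<Sigma>0 \<tau> = (\<lambda>V. f (layer_prod d N V))"
    by (rule ext) (simp add: lossN_def f_def assms(4))
  have W: "W \<in> params N d" using assms(13) by (simp add: critical_params_def)
  have WC: "W' \<in> carrier_mat n m"
    using layer_prod_carrier[OF W order_refl] by (simp add: W'_def assms(3,4))
  have fr: "W' \<in> fixed_rank n m (vec_space.rank n W')" using WC by (simp add: fixed_rank_def)
  have crit: "\<exists>\<delta>>0. \<forall>A\<in>carrier_mat n n. \<forall>B\<in>carrier_mat m m. frob_norm A + frob_norm B < \<delta> \<longrightarrow>
      \<bar>f ((1\<^sub>m n + A) * W' * (1\<^sub>m m + B)) - f W'\<bar> \<le> \<epsilon> * (frob_norm A + frob_norm B)" if "\<epsilon> > 0" for \<epsilon>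
    using critical_params_two_sided[OF assms(13)[unfolded lossN] assms(1) that]
    unfolding W'_def assms(3,4) .
  \<comment> \<open>The transport argument perturbs from the left only, which is the case
    \<open>B = 0\<close> of the two-sided estimate.\<close>
  have crit_left: "\<exists>\<delta>>0. \<forall>A\<in>carrier_mat n n. frob_norm A < \<delta> \<longrightarrow>
      \<bar>f ((1\<^sub>m n + A) * W') - f W'\<bar> \<le> \<epsilon> * frob_norm A" if \<epsilon>: "\<epsilon> > 0" for \<epsilon>
  proof -
    obtain \<delta> where \<delta>: "\<delta> > 0" "\<And>A B. A \<in> carrier_mat n n \<Longrightarrow> B \<in> carrier_mat m m \<Longrightarrow>
      frob_norm A + frob_norm B < \<delta> \<Longrightarrow>
      \<bar>f ((1\<^sub>m n + A) * W' * (1\<^sub>m m + B)) - f W'\<bar> \<le> \<epsilon> * (frob_norm A + frob_norm B)"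
      using crit[OF \<epsilon>] by blast
    have "\<bar>f ((1\<^sub>m n + A) * W') - f W'\<bar> \<le> \<epsilon> * frob_norm A" if A: "A \<in> carrier_mat n n" "frob_norm A < \<delta>" for A
    proof -
      have "(1\<^sub>m n + A) * W' * (1\<^sub>m m + 0\<^sub>m m m) = (1\<^sub>m n + A) * W'"
        using WC A by (simp add: mat_mult_one_right)
      then show ?thesis using \<delta>(2)[OF A(1) zero_carrier_mat[of m m]] A(2) by simp
    qed
    then show ?thesis using \<delta>(1) by blast
  qed
  have "critical_fixed_rank n m (vec_space.rank n W') f W'"
    by (rule critical_fixed_rankI[OF fr crit])
  moreover have "(local_minimizer (params_dist N) (params N d) (lossN N d \<Sigma>0 \<tau>) W \<longleftrightarrow>
             local_minimizer frob_dist (fixed_rank n m r) f W') \<and>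
          (local_minimizer frob_dist (fixed_rank n m r) f W' \<longrightarrow>
             is_arg_min f (\<lambda>V. V \<in> fixed_rank n m r) W' \<and>
             reg_cov n \<tau> W' =
               \<Omega> * four_block_mat (mat_diag r lam) (0\<^sub>m r (n - r))
                                   (0\<^sub>m (n - r) r) (\<tau> \<cdot>\<^sub>m 1\<^sub>m (n - r)) * \<Omega>\<^sup>T)"
    if k: "vec_space.rank n W' = r"
  proof (intro conjI impI iffI)
    have Wr: "W' \<in> fixed_rank n m r" using fr unfolding k .
    show "local_minimizer frob_dist (fixed_rank n m r) f W'"
      if "local_minimizer (params_dist N) (params N d) (lossN N d \<Sigma>0 \<tau>) W"
      using local_minimizer_params_imp_fixed_rank[OF that[unfolded lossN] assms(1), of r] Wr
      unfolding W'_def assms(3,4) by blast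
    show "local_minimizer (params_dist N) (params N d) (lossN N d \<Sigma>0 \<tau>) W"
      if "local_minimizer frob_dist (fixed_rank n m r) f W'"
      unfolding lossN
      by (rule local_minimizer_fixed_rank_imp_params[OF W])
        (use that in \<open>simp only: W'_def r_def assms(3,4)\<close>)
    assume loc: "local_minimizer frob_dist (fixed_rank n m r) f W'"
    have rn: "r \<le> n" unfolding r_def assms(4)[symmetric] by (rule Min_le) auto
    have \<tau>: "\<tau> \<le> lam i" if "i < n" for i using last[OF that] assms(12) by linarith
    note opt = local_minimizer_optimal[OF Wr rn dec \<tau> crit_left[unfolded f_def] loc[unfolded f_def]]
    show "is_arg_min f (\<lambda>V. V \<in> fixed_rank n m r) W'" unfolding f_def by (rule opt(1))
    show "reg_cov n \<tau> W' = \<Omega> * four_block_mat (mat_diag r lam) (0\<^sub>m r (n - r))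
        (0\<^sub>m (n - r) r) (\<tau> \<cdot>\<^sub>m 1\<^sub>m (n - r)) * \<Omega>\<^sup>T" by (rule opt(2))
  qed
  ultimately show ?thesis unfolding Let_def f_def W'_def r_def by blast
qed

end
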